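(* The algebra homomorphism $\mathscr R\to C(\Omega)$, $\psi=\sum a_\lambda\sigma_\lambda\mapsto\widehat\psi(\omega)=\sum a_\lambda\widehat\sigma_\lambda(\omega)$, determines by restriction to $\mathscr R^0\subset\mathscr R$ a homomorphism $\mathscr R^0\to C_0(\Omega)$; that is, $\widehat\psi\in C_0(\Omega)$ for every $\psi\in\mathscr R^0$.
   Context: For $N\ge1$, $\mathbb S_N$ is the set of signatures of length $N$: vectors $\lambda=(\lambda_1\ge\dots\ge\lambda_N)\in\mathbb Z^N$; $\mathbb S_0=\{\varnothing\}$. Let $\varphi_n$, $n\in\mathbb Z$, be commuting formal variables of degree $1$, and $\varphi_\lambda=\varphi_{\lambda_1}\cdots\varphi_{\lambda_N}$. $R=\bigoplus_{N\ge0}R_N$ is the commutative graded complex algebra of formal power series of bounded degree in the $\varphi_n$; $R_N$ consists of all formal sums $\sum_{\lambda\in\mathbb S_N}a_\lambda\varphi_\lambda$, $a_\lambda\in\mathbb C$ arbitrary. Set $\sigma_\lambda=\det[\varphi_{\lambda_i-i+j}]_{i,j=1}^N$ for $\lambda\in\mathbb S_N$, $\sigma_\varnothing=1$. Each monomial occurs in only finitely many $\sigma_\lambda$ and every element of $R_N$ is uniquely a (possibly infinite) sum $\sum_{\lambda\in\mathbb S_N}a_\lambda\sigma_\lambda$. Let $\mathrm{Dim}_N\lambda=\prod_{1\le i<j\le N}\frac{\lambda_i-\lambda_j-i+j}{j-i}$. For $\psi=\sum_{\lambda\in\mathbb S_N}a_\lambda\sigma_\lambda\in R_N$ put $\Vert\psi\Vert=\sup_{\lambda}|a_\lambda|/\mathrm{Dim}_N\lambda\in[0,+\infty]$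 (with $\Vert1\Vert=1$), and $\Vert\sum_N\psi_N\Vert=\sum_N\Vert\psi_N\Vert$ for $\psi_N\in R_N$. $\mathscr R\subset R$ is the normed subalgebra of elements of finite norm. For $N\ge1$, $\mathscr R^0_N$ consists of those $\sum_{\lambda\in\mathbb S_N}a_\lambda\sigma_\lambda\in R_N$ for which $|a_\lambda|/\mathrm{Dim}_N\lambda\to0$ as $\lambda\to\infty$ (for each $\epsilon>0$ the ratio is $\le\epsilon$ outside a finite subset of $\mathbb S_N$); $\mathscr R^0=\bigoplus_{N\ge1}\mathscr R^0_N$, which is a (non-unital) subalgebra of $\mathscr R$. $\Omega$ is the set of $\omega=(\alpha^+,\beta^+;\alpha^-,\beta^-;\delta^+,\delta^-)\in\mathbb R_+^\infty\times\mathbb R_+^\infty\times\mathbb R_+^\infty\times\mathbb R_+^\infty\times\mathbb R_+\times\mathbb R_+$ with $\alpha^\pm=(\alpha^\pm_1\ge\alpha^\pm_2\ge\dots\ge0)$, $\beta^\pm=(\beta_1^\pm\ge\beta_2^\pm\ge\dots\ge0)$, $\sum_i(\alpha_i^\pm+\beta_i^\pm)\le\delta^\pm$, $\beta^+_1+\beta^-_1\le1$, with the topology induced by the product topology; it is locally compact. With $\gamma^\pm=\delta^\pm-\sum_i(\alpha_i^\pm+\beta_i^\pm)$ set $$\Phi(u;\omega)=e^{\gamma^+(u-1)+\gamma^-(u^{-1}-1)}\prod_{i=1}^\infty\frac{1+\beta_i^+(u-1)}{1-\alpha_i^+(u-1)}\,\frac{1+\beta_i^-(u^{-1}-1)}{1-\alpha_i^-(u^{-1}-1)},$$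 which is holomorphic near $|u|=1$; let $\Phi(u;\omega)=\sum_{n\in\mathbb Z}\widehat\varphi_n(\omega)u^n$ be its Laurent expansion there, and $\widehat\sigma_\lambda(\omega)=\det[\widehat\varphi_{\lambda_i-i+j}(\omega)]_{i,j=1}^N$ for $\lambda\in\mathbb S_N$, $\widehat\sigma_\varnothing=1$. $C(\Omega)$ is the algebra of bounded continuous functions on $\Omega$ and $C_0(\Omega)\subset C(\Omega)$ the subalgebra of functions vanishing at infinity. It is known that each $\widehat\varphi_n\in C_0(\Omega)$, and that for $\psi=\sum a_\lambda\sigma_\lambda\in\mathscr R$ the series $\sum a_\lambda\widehat\sigma_\lambda(\omega)$ converges absolutely for every $\omega$ and defines an algebra homomorphism $\mathscr R\to C(\Omega)$. *)

theory Defs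
  imports
    "HOL-Analysis.Analysis"
    "HOL-Library.Multiset"
    "Jordan_Normal_Form.Determinant"
begin

section \<open>The algebra of formal power series of bounded degree\<close>

text \<open>
  A monomial in the commuting variables \<open>\<phi>\<^sub>n\<close>, \<open>n \<in> \<int>\<close>, is the finite multiset of its indices;
  its degree is the size of the multiset. An element of \<open>R\<close> is the family of its coefficients.
\<close>

typedef phi_series = "{f :: int multiset \<Rightarrow> complex. \<exists>d. \<forall>M. f M \<noteq> 0 \<longrightarrow> size M \<le> d}"
  morphisms mcoeff Abs_phi_series
  by (rule exI[of _ "\<lambda>_. 0"]) auto

lemma phi_series_eqI: "(\<And>M. mcoeff x M = mcoeff y M) \<Longrightarrow> x = y"
  by (metis mcoeff_inject ext)

lemma mcoeff_bounded_degree: "\<exists>d. \<forall>M. mcoeff x M \<noteq> 0 \<longrightarrow> size M \<le> d"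
  using mcoeff[of x] by simp

lemma mcoeff_Abs:
  assumes "\<And>M. f M \<noteq> 0 \<Longrightarrow> size M \<le> d"
  shows "mcoeff (Abs_phi_series f) = f"
  using assms by (intro Abs_phi_series_inverse) auto

lemma finite_mset_splits [simp]: "finite {(A, B). A + B = (M :: 'a multiset)}"
proof -
  let ?S = "mset ` {xs. set xs \<subseteq> set_mset M \<and> length xs \<le> size M}"
  have fin: "finite ?S"
    by (intro finite_imageI finite_lists_length_le) simp
  have *: "A \<in> ?S" if sub: "A \<subseteq># M" for A
  proof -
    obtain xs where xs: "mset xs = A" using ex_mset by blast
    have "set xs \<subseteq> set_mset M" using set_mset_mono[OF sub] xs by auto
    moreover have "length xs \<le> size M" using size_mset_mono[OF sub] xs by auto
    ultimately show ?thesis using xs by blast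
  qed
  have "{(A, B). A + B = M} \<subseteq> ?S \<times> ?S"
    using * by auto
  then show ?thesis using fin finite_subset by blast
qed

instantiation phi_series :: comm_ring_1
begin

definition "0 = Abs_phi_series (\<lambda>_. 0)"
definition "1 = Abs_phi_series (\<lambda>M. if M = {#} then 1 else 0)"
definition "x + y = Abs_phi_series (\<lambda>M. mcoeff x M + mcoeff y M)"
definition "- x = Abs_phi_series (\<lambda>M. - mcoeff x M)"
definition "x - y = Abs_phi_series (\<lambda>M. mcoeff x M - mcoeff y M)"
definition "x * y = Abs_phi_series (\<lambda>M. \<Sum>(A, B) | A + B = M. mcoeff x A * mcoeff y B)"

lemma mcoeff_0 [simp]: "mcoeff 0 M = 0"
  unfolding zero_phi_series_def by (subst mcoeff_Abs[where d = 0]) auto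

lemma mcoeff_1: "mcoeff 1 M = (if M = {#} then 1 else 0)"
  unfolding one_phi_series_def by (subst mcoeff_Abs[where d = 0]) (auto split: if_splits)

lemma mcoeff_add [simp]: "mcoeff (x + y) M = mcoeff x M + mcoeff y M"
proof -
  obtain d e where "\<forall>M. mcoeff x M \<noteq> 0 \<longrightarrow> size M \<le> d" "\<forall>M. mcoeff y M \<noteq> 0 \<longrightarrow> size M \<le> e"
    using mcoeff_bounded_degree by metis
  then have *: "size M \<le> d + e" if "mcoeff x M \<noteq> 0 \<or> mcoeff y M \<noteq> 0" for M
    using that trans_le_add1 trans_le_add2 by metis
  show ?thesis
    unfolding plus_phi_series_def by (subst mcoeff_Abs[where d = "d + e"]) (rule *, auto)
qed

lemma mcoeff_uminus [simp]: "mcoeff (- x) M = - mcoeff x M"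
proof -
  obtain d where "\<forall>M. mcoeff x M \<noteq> 0 \<longrightarrow> size M \<le> d"
    using mcoeff_bounded_degree by metis
  then show ?thesis
    unfolding uminus_phi_series_def by (subst mcoeff_Abs[where d = d]) auto
qed

lemma mcoeff_diff [simp]: "mcoeff (x - y) M = mcoeff x M - mcoeff y M"
proof -
  obtain d e where "\<forall>M. mcoeff x M \<noteq> 0 \<longrightarrow> size M \<le> d" "\<forall>M. mcoeff y M \<noteq> 0 \<longrightarrow> size M \<le> e"
    using mcoeff_bounded_degree by metis
  then have *: "size M \<le> d + e" if "mcoeff x M \<noteq> 0 \<or> mcoeff y M \<noteq> 0" for M
    using that trans_le_add1 trans_le_add2 by metis
  show ?thesis
    unfolding minus_phi_series_def by (subst mcoeff_Abs[where d = "d + e"]) (rule *, auto)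
qed

lemma mcoeff_mult: "mcoeff (x * y) M = (\<Sum>(A, B) | A + B = M. mcoeff x A * mcoeff y B)"
proof -
  obtain d e where de: "\<forall>M. mcoeff x M \<noteq> 0 \<longrightarrow> size M \<le> d" "\<forall>M. mcoeff y M \<noteq> 0 \<longrightarrow> size M \<le> e"
    using mcoeff_bounded_degree by metis
  have "size M \<le> d + e" if nz: "(\<Sum>(A, B) | A + B = M. mcoeff x A * mcoeff y B) \<noteq> 0" for M
  proof -
    obtain p where "p \<in> {(A, B). A + B = M}" "(case p of (A, B) \<Rightarrow> mcoeff x A * mcoeff y B) \<noteq> 0"
      using nz by (rule sum.not_neutral_contains_not_neutral)
    then obtain A B where AB: "A + B = M" "mcoeff x A \<noteq> 0" "mcoeff y B \<noteq> 0"
      by (cases p) auto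
    have "size M = size A + size B" using AB(1) by auto
    moreover have "size A \<le> d" "size B \<le> e" using de AB by blast+
    ultimately show ?thesis by linarith
  qed
  then show ?thesis
    unfolding times_phi_series_def by (subst mcoeff_Abs[where d = "d + e"]) auto
qed

instance
proof
  fix a b c :: phi_series
  show "a * b * c = a * (b * c)"
  proof (rule phi_series_eqI)
    fix M
    have "mcoeff (a * b * c) M =
        (\<Sum>p | fst p + snd p = M. \<Sum>q | fst q + snd q = fst p.
            mcoeff a (fst q) * mcoeff b (snd q) * mcoeff c (snd p))"
      by (simp add: mcoeff_mult case_prod_unfold sum_distrib_right)
    also have "\<dots> = (\<Sum>(p, q) \<in> (SIGMA p:{p. fst p + snd p = M}. {q. fst q + snd q = fst p}).
            mcoeff a (fst q) * mcoeff b (snd q) * mcoeff c (snd p))"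
      by (subst sum.Sigma) (auto simp: finite_mset_splits[unfolded case_prod_unfold])
    also have "\<dots> = (\<Sum>(p, q) \<in> (SIGMA p:{p. fst p + snd p = M}. {q. fst q + snd q = snd p}).
            mcoeff a (fst p) * (mcoeff b (fst q) * mcoeff c (snd q)))"
      by (rule sum.reindex_bij_witness[where
            i = "\<lambda>(p, q). ((fst p + fst q, snd q), (fst p, fst q))" and
            j = "\<lambda>(p, q). ((fst q, snd q + snd p), (snd q, snd p))"]) (auto simp: ac_simps)
    also have "\<dots> = (\<Sum>p | fst p + snd p = M. \<Sum>q | fst q + snd q = snd p.
            mcoeff a (fst p) * (mcoeff b (fst q) * mcoeff c (snd q)))"
      by (subst sum.Sigma) (auto simp: finite_mset_splits[unfolded case_prod_unfold])
    also have "\<dots> = mcoeff (a * (b * c)) M"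
      by (simp add: mcoeff_mult case_prod_unfold sum_distrib_left)
    finally show "mcoeff (a * b * c) M = mcoeff (a * (b * c)) M" .
  qed
  show "a * b = b * a"
    by (rule phi_series_eqI, unfold mcoeff_mult,
        rule sum.reindex_bij_witness[where i = "\<lambda>(A, B). (B, A)" and j = "\<lambda>(A, B). (B, A)"])
       (auto simp: ac_simps)
  show "1 * a = a"
  proof (rule phi_series_eqI)
    fix M
    have "mcoeff (1 * a) M = (\<Sum>(A, B) \<in> {({#}, M)}. mcoeff 1 A * mcoeff a B)"
      unfolding mcoeff_mult by (rule sum.mono_neutral_right) (auto simp: mcoeff_1 split: if_splits)
    then show "mcoeff (1 * a) M = mcoeff a M" by (simp add: mcoeff_1)
  qed
  show "(a + b) * c = a * c + b * c"
    by (rule phi_series_eqI)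
       (simp add: mcoeff_mult case_prod_beta distrib_right sum.distrib)
  show "(0 :: phi_series) \<noteq> 1"
    by (metis mcoeff_0 mcoeff_1 zero_neq_one)
qed (auto intro!: phi_series_eqI)

end

definition scale :: "complex \<Rightarrow> phi_series \<Rightarrow> phi_series" where
  "scale c x = Abs_phi_series (\<lambda>M. c * mcoeff x M)"

definition graded :: "nat \<Rightarrow> phi_series set" where
  "graded N = {x. \<forall>M. mcoeff x M \<noteq> 0 \<longrightarrow> size M = N}"

definition phi :: "int \<Rightarrow> phi_series" where
  "phi n = Abs_phi_series (\<lambda>M. if M = {#n#} then 1 else 0)"


section \<open>Signatures, the basis \<open>\<sigma>\<close>, the norm\<close>

definition sigs :: "nat \<Rightarrow> int list set" where
  "sigs N = {l. length l = N \<and> sorted_wrt (\<ge>) l}"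

definition all_sigs :: "int list set" where
  "all_sigs = (\<Union>N. sigs N)"

definition Dim :: "int list \<Rightarrow> real" where
  "Dim l = (\<Prod>j<length l. \<Prod>i<j.
     (real_of_int (l ! i) - real_of_int (l ! j) - real i + real j) / (real j - real i))"

definition jacobi_trudi_det :: "(int \<Rightarrow> 'a :: comm_ring_1) \<Rightarrow> int list \<Rightarrow> 'a" where
  "jacobi_trudi_det f l =
     Determinant.det (Matrix.mat (length l) (length l) (\<lambda>(i, j). f (l ! i - int i + int j)))"

definition sigma :: "int list \<Rightarrow> phi_series" where
  "sigma = jacobi_trudi_det phi"

text \<open>
  \<open>sigma_expansion x a\<close> says \<open>x = \<Sum>\<^sub>\<lambda> a\<^sub>\<lambda> \<sigma>\<^sub>\<lambda>\<close>, the formal sum running over signatures of all lengths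
  and being taken coefficientwise. Each monomial occurs in only finitely many \<open>\<sigma>\<^sub>\<lambda>\<close>, so the sums
  on the right are finite. As \<open>\<sigma>\<^sub>\<lambda>\<close> is homogeneous of degree the length of \<open>\<lambda>\<close>, the restriction of \<open>a\<close>
  to \<open>sigs N\<close> gives the expansion of the component of \<open>x\<close> of degree \<open>N\<close>.
\<close>

definition sigma_expansion :: "phi_series \<Rightarrow> (int list \<Rightarrow> complex) \<Rightarrow> bool" where
  "sigma_expansion x a \<longleftrightarrow>
     (\<forall>l. l \<notin> all_sigs \<longrightarrow> a l = 0) \<and>
     (\<forall>M. mcoeff x M = (\<Sum>l | l \<in> all_sigs \<and> mcoeff (sigma l) M \<noteq> 0. a l * mcoeff (sigma l) M))"

definition sigma_coeff :: "phi_series \<Rightarrow> int list \<Rightarrow> complex" where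
  "sigma_coeff x = (THE a. sigma_expansion x a)"

definition series_norm :: "phi_series \<Rightarrow> ennreal" where
  "series_norm x = (\<Sum>N. SUP l\<in>sigs N. ennreal (cmod (sigma_coeff x l) / Dim l))"

definition scrR :: "phi_series set" where
  "scrR = {x. series_norm x < \<infinity>}"

definition scrR0_graded :: "nat \<Rightarrow> phi_series set" where
  "scrR0_graded N =
     {x \<in> graded N. \<forall>\<epsilon>>0. finite {l \<in> sigs N. \<not> cmod (sigma_coeff x l) / Dim l \<le> \<epsilon>}}"

definition scrR0 :: "phi_series set" where
  "scrR0 = {\<Sum>N=1..d. y N | d y. \<forall>N\<in>{1..d}. y N \<in> scrR0_graded N}"


section \<open>The space \<open>\<Omega>\<close> and the functions on it\<close>

text \<open>
  A point is the tuple \<open>(\<alpha>\<^sup>+, \<beta>\<^sup>+, \<alpha>\<^sup>-, \<beta>\<^sup>-, \<delta>\<^sup>+, \<delta>\<^sup>-)\<close>, with sequences indexed from 0. The topology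
  of the type is the product topology, so that continuity on and compactness in \<open>Omega\<close> refer to
  the subspace topology.
\<close>

type_synonym point =
  "(nat \<Rightarrow> real) \<times> (nat \<Rightarrow> real) \<times> (nat \<Rightarrow> real) \<times> (nat \<Rightarrow> real) \<times> real \<times> real"

definition Omega :: "point set" where
  "Omega = {(\<alpha>p, \<beta>p, \<alpha>m, \<beta>m, \<delta>p, \<delta>m).
     decseq \<alpha>p \<and> decseq \<beta>p \<and> decseq \<alpha>m \<and> decseq \<beta>m \<and>
     (\<forall>i. 0 \<le> \<alpha>p i \<and> 0 \<le> \<beta>p i \<and> 0 \<le> \<alpha>m i \<and> 0 \<le> \<beta>m i) \<and>
     0 \<le> \<delta>p \<and> 0 \<le> \<delta>m \<and>
     summable (\<lambda>i. \<alpha>p i + \<beta>p i) \<and> (\<Sum>i. \<alpha>p i + \<beta>p i) \<le> \<delta>p \<and>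
     summable (\<lambda>i. \<alpha>m i + \<beta>m i) \<and> (\<Sum>i. \<alpha>m i + \<beta>m i) \<le> \<delta>m \<and>
     \<beta>p 0 + \<beta>m 0 \<le> 1}"

definition Phi :: "complex \<Rightarrow> point \<Rightarrow> complex" where
  "Phi u = (\<lambda>(\<alpha>p, \<beta>p, \<alpha>m, \<beta>m, \<delta>p, \<delta>m).
     (let \<gamma>p = \<delta>p - (\<Sum>i. \<alpha>p i + \<beta>p i);
          \<gamma>m = \<delta>m - (\<Sum>i. \<alpha>m i + \<beta>m i)
      in exp (of_real \<gamma>p * (u - 1) + of_real \<gamma>m * (inverse u - 1)) *
         (\<Prod>i. (1 + of_real (\<beta>p i) * (u - 1)) / (1 - of_real (\<alpha>p i) * (u - 1)) *
              ((1 + of_real (\<beta>m i) * (inverse u - 1)) / (1 - of_real (\<alpha>m i) * (inverse u - 1))))))"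

definition laurent_near_circle :: "(complex \<Rightarrow> complex) \<Rightarrow> (int \<Rightarrow> complex) \<Rightarrow> bool" where
  "laurent_near_circle f c \<longleftrightarrow>
     (\<exists>r R. 0 < r \<and> r < 1 \<and> 1 < R \<and>
        (\<forall>u. r < cmod u \<and> cmod u < R \<longrightarrow> ((\<lambda>n. c n * u powi n) has_sum f u) UNIV))"

definition phi_hat :: "point \<Rightarrow> int \<Rightarrow> complex" where
  "phi_hat \<omega> = (THE c. laurent_near_circle (\<lambda>u. Phi u \<omega>) c)"

definition sigma_hat :: "int list \<Rightarrow> point \<Rightarrow> complex" where
  "sigma_hat l \<omega> = jacobi_trudi_det (phi_hat \<omega>) l"

definition series_hat :: "phi_series \<Rightarrow> point \<Rightarrow> complex" where
  "series_hat x \<omega> = (\<Sum>\<^sub>\<infinity>l\<in>all_sigs. sigma_coeff x l * sigma_hat l \<omega>)"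

text \<open>Functions on \<open>Omega\<close> are total functions of which only the values on \<open>Omega\<close> matter.\<close>

definition C_Omega :: "(point \<Rightarrow> complex) set" where
  "C_Omega = {f. continuous_on Omega f \<and> bounded (f ` Omega)}"

definition C0_Omega :: "(point \<Rightarrow> complex) set" where
  "C0_Omega = {f \<in> C_Omega. \<forall>\<epsilon>>0. \<exists>K. compact K \<and> K \<subseteq> Omega \<and> (\<forall>\<omega>\<in>Omega - K. cmod (f \<omega>) < \<epsilon>)}"

text \<open>
  Homomorphisms of complex algebras, not assumed unital, from a subalgebra of \<open>R\<close> to an algebra of
  functions on \<open>Omega\<close>; that the two sets are subalgebras is not part of the predicate.
\<close>

definition algebra_hom_on ::
  "phi_series set \<Rightarrow> (point \<Rightarrow> complex) set \<Rightarrow> (phi_series \<Rightarrow> point \<Rightarrow> complex) \<Rightarrow> bool" where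
  "algebra_hom_on A B h \<longleftrightarrow>
     (\<forall>x\<in>A. h x \<in> B) \<and>
     (\<forall>x\<in>A. \<forall>y\<in>A. \<forall>\<omega>\<in>Omega. h (x + y) \<omega> = h x \<omega> + h y \<omega>) \<and>
     (\<forall>c. \<forall>x\<in>A. \<forall>\<omega>\<in>Omega. h (scale c x) \<omega> = c * h x \<omega>) \<and>
     (\<forall>x\<in>A. \<forall>y\<in>A. \<forall>\<omega>\<in>Omega. h (x * y) \<omega> = h x \<omega> * h y \<omega>)"

end

theory Submission
  imports Defs "HOL-Complex_Analysis.Complex_Analysis"
begin

text \<open>
  On the unit circle \<open>\<Phi>\<close> is a limit of products of factors \<open>1 + \<beta>(u\<^sup>\<plusminus> - 1)\<close> and \<open>1 / (1 - \<alpha>(u\<^sup>\<plusminus> - 1))\<close>,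
  and multiplication by such a factor preserves total positivity of the Fourier coefficients; hence
  \<open>\<sigma>\<^sub>\<lambda>(\<omega>) \<ge> 0\<close>. Cauchy-Binet against a Vandermonde determinant gives \<open>\<Sum>\<^sub>\<lambda> Dim \<lambda> \<cdot> \<sigma>\<^sub>\<lambda>(\<omega>) \<le> 1\<close> for \<open>\<lambda>\<close> of
  fixed length, so every image of \<open>R\<^sup>0\<close> is a uniform limit of combinations of the \<open>\<sigma>\<^sub>\<lambda>\<close>, and only
  \<open>\<phi>\<^sub>n\<close> is left. The \<open>\<phi>\<^sub>n(\<omega>)\<close> are the distribution of a sum of independent integer variables. If
  \<open>\<delta>\<^sup>+\<close> and \<open>\<delta>\<^sup>-\<close> are both large, then its variance is large, as \<open>\<beta>\<^sub>1\<^sup>+ + \<beta>\<^sub>1\<^sup>- \<le> 1\<close>, and \<open>|\<Phi>|\<close> is small away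
  from \<open>u = 1\<close>; if only one is, then it drifts, and \<open>\<phi>\<^sub>n x\<^sup>n \<le> \<Phi>(x)\<close> with a real \<open>x \<noteq> 1\<close> suffices.
\<close>

section \<open>Determinants of matrices given by functions\<close>

text \<open>\<open>phi_hat\<close> and \<open>sigma_coeff\<close> are given by uniqueness only, so
  both must first be made accessible. \<open>phi_hat\<close> becomes a Fourier integral, through
  which pointwise limits on the circle pass to coefficients by dominated convergence;
  \<open>sigma_coeff\<close> is found from the triangularity of the \<open>sigma l\<close> against
  monomials ordered by the sum of squares of their indices. A factor preserves total positivity
  because, after row operations, it replaces the rows of a minor by nonnegative mixtures of rows
  whose indices stay in order. The constant 1 in the dimension-weighted bound is the total mass: the
  matrix of shifted moments is unitriangular times Vandermonde, and the Vandermonde part cancels the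
  denominator of \<open>Dim\<close>. Continuity cannot be read off the formula for
  \<open>Phi\<close>: \<open>\<gamma>\<close> jumps in the product topology when mass escapes from
  the sequences, and only \<open>\<delta>\<close> is a coordinate. Hence the product is regularised.
  For smallness the obstacle is \<open>\<beta>\<close> close to 1, where a factor is nearly the
  shift \<open>u\<close> and adds no spread. The spread estimate therefore asks for
  \<open>\<beta> \<le> 1 / 2\<close> on one side, which the constraint on the \<open>\<beta>\<close>
  grants for at least one sign.\<close>

definition fdet :: "nat \<Rightarrow> (nat \<Rightarrow> nat \<Rightarrow> 'a) \<Rightarrow> 'a :: comm_ring_1" where
  "fdet n f = Determinant.det (Matrix.mat n n (\<lambda>(i, j). f i j))"

lemma fdet_leibniz:
  "fdet n f = (\<Sum>p | p permutes {0..<n}. signof p * (\<Prod>i = 0..<n. f i (p i)))"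
proof -
  have "(\<Prod>i = 0..<n. Matrix.mat n n (\<lambda>(i, j). f i j) $$ (i, p i)) = (\<Prod>i = 0..<n. f i (p i))"
    if "p permutes {0..<n}" for p
    using permutes_in_image[OF that] by (intro prod.cong) auto
  then show ?thesis
    unfolding fdet_def by (subst det_def'[of _ n]) (auto intro!: sum.cong)
qed

lemma fdet_cong:
  assumes "\<And>i j. i < n \<Longrightarrow> j < n \<Longrightarrow> f i j = g i j"
  shows "fdet n f = fdet n g"
  unfolding fdet_def by (rule arg_cong[of _ _ Determinant.det], rule eq_matI) (auto simp: assms)

lemma fdet_transpose: "fdet n (\<lambda>i j. f j i) = fdet n f"
proof -
  have "transpose_mat (Matrix.mat n n (\<lambda>(i, j). f i j)) = Matrix.mat n n (\<lambda>(i, j). f j i)"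
    by (rule eq_matI) auto
  then show ?thesis
    unfolding fdet_def using det_transpose[of "Matrix.mat n n (\<lambda>(i, j). f i j)" n] by simp
qed

lemma fdet_mult: "fdet n f * fdet n g = fdet n (\<lambda>i j. \<Sum>k<n. f i k * g k j)"
proof -
  have "Matrix.mat n n (\<lambda>(i, j). f i j) * Matrix.mat n n (\<lambda>(i, j). g i j)
      = Matrix.mat n n (\<lambda>(i, j). \<Sum>k<n. f i k * g k j)"
    by (rule eq_matI) (auto simp: scalar_prod_def atLeast0LessThan)
  then show ?thesis
    unfolding fdet_def by (subst det_mult[of _ n, symmetric]) auto
qed

lemma fdet_permute_rows:
  assumes "p permutes {0..<n}"
  shows "fdet n (\<lambda>i. f (p i)) = signof p * fdet n f"
proof -
  have "Matrix.mat n n (\<lambda>(i, j). Matrix.mat n n (\<lambda>(i, j). f i j) $$ (p i, j))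
      = Matrix.mat n n (\<lambda>(i, j). f (p i) j)"
    using permutes_in_image[OF assms] by (intro eq_matI) auto
  then show ?thesis
    unfolding fdet_def using det_permute_rows[of "Matrix.mat n n (\<lambda>(i, j). f i j)" n p] assms by simp
qed

lemma fdet_identical_rows:
  assumes "i \<noteq> j" "i < n" "j < n" "\<And>k. k < n \<Longrightarrow> f i k = f j k"
  shows "fdet n f = 0"
  unfolding fdet_def
  by (rule det_identical_rows[of _ n i j]) (use assms in \<open>auto simp: row_def\<close>)

lemma fdet_zero_row:
  assumes "i < n" "\<And>k. k < n \<Longrightarrow> f i k = 0"
  shows "fdet n f = 0"
proof -
  have "(\<Prod>i = 0..<n. f i (p i)) = 0" if p: "p permutes {0..<n}" for p
  proof (rule prod_zero)
    show "\<exists>a\<in>{0..<n}. f a (p a) = 0"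
      using assms permutes_in_image[OF p, of i] by (intro bexI[of _ i]) auto
  qed auto
  then show ?thesis unfolding fdet_leibniz by (intro sum.neutral) auto
qed

lemma fdet_triangular:
  assumes "\<And>i j. j < i \<Longrightarrow> i < n \<Longrightarrow> f i j = 0"
  shows "fdet n f = (\<Prod>i<n. f i i)"
proof -
  have "fdet n f = prod_list (diag_mat (Matrix.mat n n (\<lambda>(i, j). f i j)))"
    unfolding fdet_def by (rule det_upper_triangular[of _ n]) (auto simp: assms)
  also have "\<dots> = (\<Prod>i<n. f i i)"
    by (simp add: diag_mat_def prod.list_conv_set_nth atLeast0LessThan)
  finally show ?thesis .
qed

lemma fdet_scale_rows: "fdet n (\<lambda>i j. c i * f i j) = (\<Prod>i<n. c i) * fdet n f"
  unfolding fdet_leibniz by (simp add: prod.distrib sum_distrib_left atLeast0LessThan mult_ac)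

text \<open>Multilinearity in the rows: \<open>h\<close> picks one summand from each row. As the
  weights split off, the sign of each term is that of a determinant of picked rows, which is how
  positivity is deduced later.\<close>

lemma fdet_expand_rows:
  assumes "\<And>i. i < n \<Longrightarrow> finite (S i)"
  shows "fdet n (\<lambda>i j. \<Sum>e\<in>S i. w i e * g i e j) =
    (\<Sum>h\<in>PiE {0..<n} S. (\<Prod>i<n. w i (h i)) * fdet n (\<lambda>i. g i (h i)))"
proof -
  have "fdet n (\<lambda>i j. \<Sum>e\<in>S i. w i e * g i e j) =
      (\<Sum>p | p permutes {0..<n}. \<Sum>h\<in>PiE {0..<n} S.
         signof p * (\<Prod>i = 0..<n. w i (h i) * g i (h i) (p i)))"
    unfolding fdet_leibniz
    by (intro sum.cong refl) (subst prod_sum_PiE, use assms in \<open>auto simp: sum_distrib_left\<close>)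
  also have "\<dots> = (\<Sum>h\<in>PiE {0..<n} S. \<Sum>p | p permutes {0..<n}.
         signof p * (\<Prod>i = 0..<n. w i (h i) * g i (h i) (p i)))"
    by (rule sum.swap)
  also have "\<dots> = (\<Sum>h\<in>PiE {0..<n} S. (\<Prod>i<n. w i (h i)) * fdet n (\<lambda>i. g i (h i)))"
    unfolding fdet_leibniz
    by (intro sum.cong refl) (simp add: prod.distrib sum_distrib_left atLeast0LessThan mult_ac)
  finally show ?thesis .
qed

lemma fdet_hom:
  assumes "comm_ring_hom h"
  shows "fdet n (\<lambda>i j. h (f i j)) = h (fdet n f)"
proof -
  interpret comm_ring_hom h by fact
  have "map_mat h (Matrix.mat n n (\<lambda>(i, j). f i j)) = Matrix.mat n n (\<lambda>(i, j). h (f i j))"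
    by (rule eq_matI) auto
  then show ?thesis unfolding fdet_def by (metis hom_det)
qed

lemma tendsto_fdet:
  fixes f :: "'b \<Rightarrow> nat \<Rightarrow> nat \<Rightarrow> 'a :: {comm_ring_1, real_normed_algebra}"
  assumes "\<And>i j. i < n \<Longrightarrow> j < n \<Longrightarrow> ((\<lambda>m. f m i j) \<longlongrightarrow> g i j) F"
  shows "((\<lambda>m. fdet n (f m)) \<longlongrightarrow> fdet n g) F"
  unfolding fdet_leibniz
proof (intro tendsto_sum tendsto_mult tendsto_const tendsto_prod)
  fix p i assume "p \<in> {p. p permutes {0..<n}}" "i \<in> {0..<n}"
  then show "((\<lambda>m. f m i (p i)) \<longlongrightarrow> g i (p i)) F"
    using assms[of i "p i"] permutes_in_image[of p "{0..<n}" i] by auto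
qed

lemma vandermonde_det:
  fixes x :: "nat \<Rightarrow> 'a :: comm_ring_1"
  shows "fdet n (\<lambda>i j. x i ^ j) = (\<Prod>j<n. \<Prod>i<j. x j - x i)"
proof (induction n)
  case 0
  then show ?case by (simp add: fdet_leibniz)
next
  case (Suc n)
  \<comment> \<open>Multiplication by \<open>u\<close> on the right subtracts \<open>x n\<close>
    times column \<open>j - 1\<close> from column \<open>j\<close>. Row \<open>n\<close> becomes
    \<open>1, 0, ..., 0\<close>, and expansion along it leaves the smaller determinant with row
    \<open>i\<close> scaled by \<open>x i - x n\<close>.\<close>
  define u :: "nat \<Rightarrow> nat \<Rightarrow> 'a" where
    "u k j = (if k = j then 1 else if Suc k = j then - x n else 0)" for k j
  define g where "g i j = (if j = 0 then 1 else x i ^ (j - 1) * (x i - x n))" for i j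
  have "fdet (Suc n) u = 1"
    by (subst fdet_triangular) (auto simp: u_def)
  then have "fdet (Suc n) (\<lambda>i j. x i ^ j) = fdet (Suc n) (\<lambda>i j. x i ^ j) * fdet (Suc n) u"
    by simp
  also have "\<dots> = fdet (Suc n) g"
    unfolding fdet_mult
  proof (rule fdet_cong)
    fix i j assume j: "j < Suc n"
    have "(\<Sum>k<Suc n. x i ^ k * u k j) = (\<Sum>k\<in>(if j = 0 then {0} else {j - 1, j}). x i ^ k * u k j)"
      using j by (intro sum.mono_neutral_right) (auto simp: u_def)
    also have "\<dots> = g i j"
      by (cases j) (auto simp: u_def g_def algebra_simps)
    finally show "(\<Sum>k<Suc n. x i ^ k * u k j) = g i j" .
  qed
  also have "\<dots> = (-1) ^ n * fdet n (\<lambda>i j. (x i - x n) * x i ^ j)"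
  proof -
    let ?A = "Matrix.mat (Suc n) (Suc n) (\<lambda>(i, j). g i j)"
    have del: "mat_delete ?A n 0 = Matrix.mat n n (\<lambda>(i, j). (x i - x n) * x i ^ j)"
      by (rule eq_matI) (auto simp: mat_delete_def g_def mult_ac)
    have "fdet (Suc n) g = (\<Sum>j<Suc n. ?A $$ (n, j) * cofactor ?A n j)"
      unfolding fdet_def by (rule laplace_expansion_row) auto
    also have "\<dots> = (\<Sum>j\<in>{0}. ?A $$ (n, j) * cofactor ?A n j)"
      by (rule sum.mono_neutral_right) (auto simp: g_def)
    also have "\<dots> = (-1) ^ n * fdet n (\<lambda>i j. (x i - x n) * x i ^ j)"
      using del by (simp add: g_def cofactor_def fdet_def)
    finally show ?thesis .
  qed
  also have "\<dots> = ((-1) ^ n * (\<Prod>i<n. x i - x n)) * fdet n (\<lambda>i j. x i ^ j)"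
    by (subst fdet_scale_rows) (rule mult.assoc[symmetric])
  also have "(-1) ^ n * (\<Prod>i<n. x i - x n) = (\<Prod>i<n. x n - x i)"
    using prod.distrib[of "\<lambda>_. -1" "\<lambda>i. x i - x n" "{..<n}"] by simp
  finally show ?case using Suc by (simp add: mult.commute)
qed

section \<open>Cauchy-Binet with minors indexed by finite subsets, enumerated in decreasing
  order\<close>

definition dec_enum :: "'a :: linorder set \<Rightarrow> nat \<Rightarrow> 'a" where
  "dec_enum Y i = rev (sorted_list_of_set Y) ! i"

lemma dec_enum_bij:
  assumes "finite Y" "card Y = n"
  shows "bij_betw (dec_enum Y) {0..<n} Y"
proof -
  have "bij_betw ((!) (rev (sorted_list_of_set Y))) {..<length (rev (sorted_list_of_set Y))} (set (rev (sorted_list_of_set Y)))"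
    by (rule bij_betw_nth) auto
  then show ?thesis
    using assms by (simp add: dec_enum_def[abs_def] atLeast0LessThan)
qed

lemma dec_enum_image:
  assumes dec: "\<And>i j. i < j \<Longrightarrow> j < n \<Longrightarrow> x j < x i"
  shows "card (x ` {0..<n}) = n" "\<And>i. i < n \<Longrightarrow> dec_enum (x ` {0..<n}) i = x i"
proof -
  let ?l = "map x [0..<n]"
  have s: "sorted_wrt (<) (rev ?l)"
    unfolding sorted_wrt_rev by (auto simp: sorted_wrt_iff_nth_less dec)
  have "sorted_list_of_set (set (rev ?l)) = rev ?l"
    using s strict_sorted_equal[of "sorted_list_of_set (set (rev ?l))" "rev ?l"] by simp
  then have eq: "rev (sorted_list_of_set (x ` {0..<n})) = ?l" by simp
  show "dec_enum (x ` {0..<n}) i = x i" if "i < n" for i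
    using that unfolding dec_enum_def eq by simp
  have "length (sorted_list_of_set (x ` {0..<n})) = n"
    using arg_cong[OF eq, of length] by simp
  then show "card (x ` {0..<n}) = n" by simp
qed

text \<open>Row expansion gives a sum over all maps \<open>h\<close> into \<open>X\<close>. A
  repeated value means two equal rows; the injective maps are grouped by their image
  \<open>Y\<close>, and for fixed \<open>Y\<close> they are the rearrangements of
  \<open>dec_enum Y\<close>. Sorting the rows of \<open>b\<close> costs the sign of the
  rearrangement, and these signs turn the products of entries of \<open>a\<close> into the other
  determinant.\<close>

lemma cauchy_binet:
  fixes X :: "'b :: linorder set" and a :: "nat \<Rightarrow> 'b \<Rightarrow> 'a :: comm_ring_1"
  assumes fin: "finite X"
  shows "fdet n (\<lambda>i j. \<Sum>y\<in>X. a i y * b y j) =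
    (\<Sum>Y | Y \<subseteq> X \<and> card Y = n. fdet n (\<lambda>i j. a i (dec_enum Y j)) * fdet n (\<lambda>i j. b (dec_enum Y i) j))"
proof -
  define T where "T h = (\<Prod>i<n. a i (h i)) * fdet n (\<lambda>i. b (h i))" for h
  let ?P = "PiE {0..<n} (\<lambda>_. X)"
  have finP: "finite ?P" using fin by (intro finite_PiE) auto
  have "fdet n (\<lambda>i j. \<Sum>y\<in>X. a i y * b y j) = sum T ?P"
    unfolding T_def using fdet_expand_rows[of n "\<lambda>_. X" a "\<lambda>_. b"] fin by simp
  also have "\<dots> = sum T {h \<in> ?P. inj_on h {0..<n}}"
  proof (rule sum.mono_neutral_right[OF finP]; safe?)
    fix h assume "h \<in> ?P" and "T h \<noteq> 0"
    show "inj_on h {0..<n}"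
    proof (rule ccontr)
      assume "\<not> inj_on h {0..<n}"
      then obtain i j where "i < n" "j < n" "i \<noteq> j" "h i = h j"
        by (auto simp: inj_on_def)
      then have "fdet n (\<lambda>i. b (h i)) = 0" by (intro fdet_identical_rows[of i j]) auto
      then show False using \<open>T h \<noteq> 0\<close> by (simp add: T_def)
    qed
  qed
  also have "\<dots> = (\<Sum>Y | Y \<subseteq> X \<and> card Y = n. \<Sum>h | h \<in> {h \<in> ?P. inj_on h {0..<n}} \<and> h ` {0..<n} = Y. T h)"
  proof (rule sum.group[symmetric])
    show "(\<lambda>h. h ` {0..<n}) ` {h \<in> ?P. inj_on h {0..<n}} \<subseteq> {Y. Y \<subseteq> X \<and> card Y = n}"
      by (auto simp: card_image)
  qed (use finP fin in auto)
  also have "\<dots> = (\<Sum>Y | Y \<subseteq> X \<and> card Y = n. fdet n (\<lambda>i j. a i (dec_enum Y j)) * fdet n (\<lambda>i j. b (dec_enum Y i) j))"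
  proof (rule sum.cong[OF refl])
    fix Y assume "Y \<in> {Y. Y \<subseteq> X \<and> card Y = n}"
    then have Y: "Y \<subseteq> X" "card Y = n" "finite Y" using fin finite_subset by auto
    let ?e = "dec_enum Y" and ?I = "{0..<n}"
    have e: "bij_betw ?e ?I Y" using dec_enum_bij[OF Y(3,2)] .
    have "(\<Sum>h | h \<in> {h \<in> ?P. inj_on h ?I} \<and> h ` ?I = Y. T h) =
        (\<Sum>p | p permutes ?I. T (restrict (?e \<circ> p) ?I))"
    \<comment> \<open>\<open>permutes\<close> demands the identity off \<open>?I\<close> and
      \<open>PiE\<close> demands \<open>undefined\<close> there; hence the conditional in one
      direction and \<open>restrict\<close> in the other.\<close>
    proof (rule sum.reindex_bij_witness[where
          i = "\<lambda>p. restrict (?e \<circ> p) ?I" and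
          j = "\<lambda>h i. if i \<in> ?I then inv_into ?I ?e (h i) else i"])
      fix h assume h: "h \<in> {h. h \<in> {h \<in> ?P. inj_on h ?I} \<and> h ` ?I = Y}"
      let ?p = "\<lambda>i. if i \<in> ?I then inv_into ?I ?e (h i) else i"
      have eimg: "?e ` ?I = Y" using e by (simp add: bij_betw_def)
      have hY: "h i \<in> Y" if "i \<in> ?I" for i using h that by auto
      show r: "restrict (?e \<circ> ?p) ?I = h"
      proof
        fix i show "restrict (?e \<circ> ?p) ?I i = h i"
        proof (cases "i \<in> ?I")
          case True
          then show ?thesis using hY[OF True] f_inv_into_f[of "h i" ?e ?I] eimg by simp
        next
          case False
          then show ?thesis using h by (auto simp: PiE_def extensional_def)
        qed
      qed
      have "bij_betw h ?I Y" using h by (auto simp: bij_betw_def)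
      then have "bij_betw (inv_into ?I ?e \<circ> h) ?I ?I"
        using bij_betw_inv_into[OF e] by (rule bij_betw_trans)
      then have "bij_betw ?p ?I ?I"
        by (rule bij_betw_cong[THEN iffD1, rotated]) auto
      then show "?p \<in> {p. p permutes ?I}"
        by (auto intro!: bij_imp_permutes)
      show "T (restrict (?e \<circ> ?p) ?I) = T h"
        unfolding r ..
    next
      fix p assume "p \<in> {p. p permutes ?I}"
      then have p: "p permutes ?I" by simp
      note pI = permutes_in_image[OF p]
      show "(\<lambda>i. if i \<in> ?I then inv_into ?I ?e (restrict (?e \<circ> p) ?I i) else i) = p"
      proof
        fix i show "(if i \<in> ?I then inv_into ?I ?e (restrict (?e \<circ> p) ?I i) else i) = p i"
          using pI[of i] inv_into_f_f[of ?e ?I "p i"] e permutes_not_in[OF p, of i]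
          by (auto simp: bij_betw_def)
      qed
      have "bij_betw (?e \<circ> p) ?I Y"
        using permutes_imp_bij[OF p] e by (rule bij_betw_trans)
      then have "bij_betw (restrict (?e \<circ> p) ?I) ?I Y"
        by (rule bij_betw_cong[THEN iffD1, rotated]) auto
      then show "restrict (?e \<circ> p) ?I \<in> {h. h \<in> {h \<in> ?P. inj_on h ?I} \<and> h ` ?I = Y}"
        using Y by (auto simp: bij_betw_def)
    qed
    also have "\<dots> = (\<Sum>p | p permutes ?I. signof p * (\<Prod>i<n. a i (?e (p i))) * fdet n (\<lambda>i. b (?e i)))"
    proof (rule sum.cong[OF refl])
      fix p assume "p \<in> {p. p permutes ?I}"
      then have p: "p permutes ?I" by simp
      have "fdet n (\<lambda>i. b (restrict (?e \<circ> p) ?I i)) = fdet n (\<lambda>i. b (?e (p i)))"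
        by (rule fdet_cong) auto
      also have "\<dots> = signof p * fdet n (\<lambda>i. b (?e i))"
        by (rule fdet_permute_rows[OF p])
      finally show "T (restrict (?e \<circ> p) ?I) = signof p * (\<Prod>i<n. a i (?e (p i))) * fdet n (\<lambda>i. b (?e i))"
        by (simp add: T_def mult_ac)
    qed
    also have "\<dots> = fdet n (\<lambda>i j. a i (?e j)) * fdet n (\<lambda>i j. b (?e i) j)"
      by (subst (2) fdet_leibniz) (simp add: sum_distrib_right atLeast0LessThan)
    finally show "(\<Sum>h | h \<in> {h \<in> ?P. inj_on h ?I} \<and> h ` ?I = Y. T h) =
        fdet n (\<lambda>i j. a i (?e j)) * fdet n (\<lambda>i j. b (?e i) j)" .
  qed
  finally show ?thesis .
qed

section \<open>Totally positive sequences\<close>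

definition sdec :: "nat \<Rightarrow> (nat \<Rightarrow> int) \<Rightarrow> bool" where
  "sdec n x \<longleftrightarrow> (\<forall>i j. i < j \<longrightarrow> j < n \<longrightarrow> x j < x i)"

text \<open>These are the minors of the Toeplitz matrix of \<open>c\<close>. Reversing rows and
  columns together leaves a minor unchanged, so decreasing indices, which suit signatures, give the
  usual notion.\<close>

definition totally_positive :: "(int \<Rightarrow> real) \<Rightarrow> bool" where
  "totally_positive c \<longleftrightarrow>
     (\<forall>n x k. sdec n x \<longrightarrow> sdec n k \<longrightarrow> 0 \<le> fdet n (\<lambda>i j. c (x i - k j)))"

lemma totally_positiveD:
  "totally_positive c \<Longrightarrow> sdec n x \<Longrightarrow> sdec n k \<Longrightarrow> 0 \<le> fdet n (\<lambda>i j. c (x i - k j))"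
  by (simp add: totally_positive_def)

lemma totally_positive_nonneg:
  assumes "totally_positive c"
  shows "0 \<le> c n"
proof -
  have "0 \<le> fdet 1 (\<lambda>i j. c ((\<lambda>_. n) i - (\<lambda>_. 0) j))"
    by (rule totally_positiveD[OF assms]) (auto simp: sdec_def)
  then show ?thesis by (simp add: fdet_leibniz)
qed

text \<open>The Toeplitz matrix is the identity: a minor is that of an identity matrix if the index
  sets agree and has a zero row otherwise. This is the starting point for building up products of
  factors.\<close>

lemma totally_positive_delta: "totally_positive (\<lambda>n. if n = 0 then 1 else 0)"
  unfolding totally_positive_def
proof (intro allI impI)
  fix n x k assume x: "sdec n x" and k: "sdec n k"
  show "0 \<le> fdet n (\<lambda>i j. if x i - k j = 0 then 1 else 0 :: real)"
  proof (cases "x ` {0..<n} \<subseteq> k ` {0..<n}")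
    case True
    have "card (x ` {0..<n}) = card (k ` {0..<n})"
      using x k dec_enum_image(1)[of n x] dec_enum_image(1)[of n k] by (auto simp: sdec_def)
    then have "x ` {0..<n} = k ` {0..<n}" using True by (intro card_subset_eq) auto
    then have eq: "x i = k i" if "i < n" for i
      using x k dec_enum_image(2)[of n x i] dec_enum_image(2)[of n k i] that by (auto simp: sdec_def)
    have inj: "x i \<noteq> k j" if "i < n" "j < n" "i \<noteq> j" for i j
      using k eq[of i] that unfolding sdec_def by (metis less_irrefl linorder_neqE_nat)
    have "fdet n (\<lambda>i j. if x i - k j = 0 then 1 else 0 :: real) = (\<Prod>i<n. if x i - k i = 0 then 1 else 0)"
      by (rule fdet_triangular) (use inj in auto)
    then show ?thesis by (simp add: prod_nonneg)
  next
    case False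
    then obtain y where "y \<in> x ` {0..<n}" "y \<notin> k ` {0..<n}" by blast
    then obtain i where "i < n" "x i \<notin> k ` {0..<n}" by auto
    then have "fdet n (\<lambda>i j. if x i - k j = 0 then 1 else 0 :: real) = 0"
      by (intro fdet_zero_row[of i]) auto
    then show ?thesis by simp
  qed
qed

lemma totally_positive_reflect:
  assumes "totally_positive c"
  shows "totally_positive (\<lambda>n. c (- n))"
  unfolding totally_positive_def
proof (intro allI impI)
  fix n x k assume "sdec n x" "sdec n k"
  then have "0 \<le> fdet n (\<lambda>i j. c (k i - x j))" by (intro totally_positiveD[OF assms])
  also have "fdet n (\<lambda>i j. c (k i - x j)) = fdet n (\<lambda>i j. c (- (x i - k j)))"
    by (subst fdet_transpose[symmetric]) simp
  finally show "0 \<le> fdet n (\<lambda>i j. c (- (x i - k j)))" .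
qed

lemma totally_positive_limit:
  assumes "\<And>m. totally_positive (c m)" "\<And>n. (\<lambda>m. c m n) \<longlonglongrightarrow> d n"
  shows "totally_positive d"
  unfolding totally_positive_def
proof (intro allI impI)
  fix n x k assume *: "sdec n x" "sdec n k"
  have "(\<lambda>m. fdet n (\<lambda>i j. c m (x i - k j))) \<longlonglongrightarrow> fdet n (\<lambda>i j. d (x i - k j))"
    by (intro tendsto_fdet assms)
  then show "0 \<le> fdet n (\<lambda>i j. d (x i - k j))"
    by (rule LIMSEQ_le_const) (use totally_positiveD[OF assms(1) *] in auto)
qed

text \<open>Row \<open>x i\<close> of the new matrix mixes rows \<open>x i\<close> and
  \<open>x i - 1\<close> of the old one. Lowering some entries of a strictly decreasing integer
  sequence by 1 leaves it strictly decreasing or makes two entries equal, and then the minor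
  vanishes.\<close>

lemma totally_positive_bernoulli:
  assumes c: "totally_positive c" and b: "0 \<le> b" "b \<le> 1"
  shows "totally_positive (\<lambda>n. (1 - b) * c n + b * c (n - 1))"
  unfolding totally_positive_def
proof (intro allI impI)
  fix n x k assume x: "sdec n x" and k: "sdec n k"
  define w where "w i e = (if e = x i then 1 - b else b)" for i :: nat and e
  have "fdet n (\<lambda>i j. (1 - b) * c (x i - k j) + b * c (x i - k j - 1))
      = fdet n (\<lambda>i j. \<Sum>e\<in>{x i, x i - 1}. w i e * c (e - k j))"
    by (rule fdet_cong) (auto simp: w_def algebra_simps)
  also have "\<dots> = (\<Sum>h\<in>PiE {0..<n} (\<lambda>i. {x i, x i - 1}). (\<Prod>i<n. w i (h i)) * fdet n (\<lambda>i j. c (h i - k j)))"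
    by (rule fdet_expand_rows) auto
  also have "\<dots> \<ge> 0"
  proof (intro sum_nonneg mult_nonneg_nonneg prod_nonneg)
    fix h assume h: "h \<in> PiE {0..<n} (\<lambda>i. {x i, x i - 1})"
    show "0 \<le> fdet n (\<lambda>i j. c (h i - k j))"
    proof (cases "sdec n h")
      case True then show ?thesis using totally_positiveD[OF c True k] by simp
    next
      case False
      then obtain i j where ij: "i < j" "j < n" "h i \<le> h j" by (auto simp: sdec_def not_less)
      have "x j < x i" using x ij by (auto simp: sdec_def)
      moreover have "h i \<in> {x i, x i - 1}" "h j \<in> {x j, x j - 1}" using h ij by auto
      ultimately have "h i = h j" using ij by auto
      then have "fdet n (\<lambda>i j. c (h i - k j)) = 0" using ij by (intro fdet_identical_rows[of i j]) auto
      then show ?thesis by simp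
    qed
  qed (use b in \<open>auto simp: w_def\<close>)
  finally show "0 \<le> fdet n (\<lambda>i j. (1 - b) * c (x i - k j) + b * c (x i - k j - 1))" .
qed

lemma geometric_recursion_unroll:
  fixes c d :: "int \<Rightarrow> real"
  assumes rec: "\<And>n. c n = q * c (n - 1) + r * d n"
  shows "c (a - k) = (\<Sum>y\<in>{a - int m<..a}. r * q ^ nat (a - y) * d (y - k)) + q ^ m * c (a - int m - k)"
proof (induction m)
  case (Suc m)
  have set: "{a - int (Suc m)<..a} = insert (a - int m) {a - int m<..a}" by auto
  have "c (a - int m - k) = q * c (a - int (Suc m) - k) + r * d (a - int m - k)"
    using rec[of "a - int m - k"] by (simp add: algebra_simps)
  then show ?case
    unfolding set using Suc by (simp add: algebra_simps)
qed simp

text \<open>Subtracting from each row a multiple of the next one turns the rows of \<open>c\<close> into nonnegative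
  combinations of rows of \<open>d\<close> with interlacing indices; the last row needs a limit.\<close>

lemma totally_positive_geometric:
  assumes d: "totally_positive d" and q: "0 \<le> q" "q < 1" and r: "0 \<le> r"
    and rec: "\<And>n. c n = q * c (n - 1) + r * d n" and bdd: "\<And>n. \<bar>c n\<bar> \<le> B"
  shows "totally_positive c"
  unfolding totally_positive_def
proof (intro allI impI)
  fix n x k assume x: "sdec n x" and k: "sdec n k"
  show "0 \<le> fdet n (\<lambda>i j. c (x i - k j))"
  proof (cases n)
    case 0
    then show ?thesis by (simp add: fdet_leibniz)
  next
    case (Suc n')
    note unroll = geometric_recursion_unroll[of c q r d, OF rec]
    define l where "l i j = (if i = j then 1 else if j = Suc i then - (q ^ nat (x i - x j)) else 0)" for i j
    define R where "R i j = (if Suc i < n then \<Sum>y\<in>{x (Suc i)<..x i}. r * q ^ nat (x i - y) * d (y - k j)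
      else c (x i - k j))" for i j
    \<comment> \<open>The last row has no successor to subtract, so an artificial index
      \<open>m\<close> below \<open>x n'\<close> plays that part; the error is \<open>q ^ m\<close>
      times a bounded quantity.\<close>
    define x' where "x' m i = (if i < n then x i else x n' - int m)" for m i
    define R' where "R' m i j = (\<Sum>y\<in>{x' m (Suc i)<..x' m i}. r * q ^ nat (x' m i - y) * d (y - k j))" for m i j
    have "fdet n l = 1" by (subst fdet_triangular) (auto simp: l_def)
    then have "fdet n (\<lambda>i j. c (x i - k j)) = fdet n l * fdet n (\<lambda>i j. c (x i - k j))" by simp
    also have "\<dots> = fdet n R"
      unfolding fdet_mult
    proof (rule fdet_cong)
      fix i j assume i: "i < n"
      have "(\<Sum>m<n. l i m * c (x m - k j)) = (\<Sum>m\<in>(if Suc i < n then {i, Suc i} else {i}). l i m * c (x m - k j))"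
        using i by (intro sum.mono_neutral_right) (auto simp: l_def)
      also have "\<dots> = R i j"
      proof (cases "Suc i < n")
        case True
        then have "x (Suc i) < x i" using x by (auto simp: sdec_def)
        then have *: "x i - int (nat (x i - x (Suc i))) = x (Suc i)" by simp
        show ?thesis
          using unroll[of "x i" "k j" "nat (x i - x (Suc i))", unfolded *] True
          unfolding l_def R_def by simp
      qed (simp add: l_def R_def)
      finally show "(\<Sum>m<n. l i m * c (x m - k j)) = R i j" .
    qed
    finally have eq: "fdet n (\<lambda>i j. c (x i - k j)) = fdet n R" .
    have "(\<lambda>m. fdet n (R' m)) \<longlonglongrightarrow> fdet n R"
    proof (rule tendsto_fdet)
      fix i j assume i: "i < n"
      show "(\<lambda>m. R' m i j) \<longlonglongrightarrow> R i j"
      proof (cases "Suc i < n")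
        case True
        then show ?thesis by (simp add: R'_def R_def x'_def)
      next
        case False
        then have [simp]: "i = n'" using i Suc by auto
        have "(\<lambda>m. c (x n' - k j) - q ^ m * c (x n' - int m - k j)) \<longlonglongrightarrow> c (x n' - k j) - 0"
        proof (intro tendsto_diff tendsto_const)
          have "(\<lambda>m. q ^ m * B) \<longlonglongrightarrow> 0 * B"
            using q by (intro tendsto_mult tendsto_const LIMSEQ_power_zero) auto
          then have lim: "(\<lambda>m. q ^ m * B) \<longlonglongrightarrow> 0" by simp
          show "(\<lambda>m. q ^ m * c (x n' - int m - k j)) \<longlonglongrightarrow> 0"
          proof (rule Lim_null_comparison[rotated])
            have "norm (q ^ m * c (x n' - int m - k j)) \<le> q ^ m * B" for m
              using mult_left_mono[OF bdd[of "x n' - int m - k j"], of "q ^ m"] q by (simp add: abs_mult)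
            then show "\<forall>\<^sub>F m in sequentially. norm (q ^ m * c (x n' - int m - k j)) \<le> q ^ m * B"
              by simp
          qed (rule lim)
        qed
        moreover have "R' m i j = c (x n' - k j) - q ^ m * c (x n' - int m - k j)" for m
          using unroll[of "x n'" "k j" m] Suc unfolding R'_def x'_def by simp
        ultimately show ?thesis by (simp add: R_def Suc)
      qed
    qed
    moreover have "0 \<le> fdet n (R' m)" for m
    proof -
      have anti: "x' m j \<le> x' m i" if "i \<le> j" "j \<le> n" for i j
      proof -
        have mono: "x j \<le> x i" if "i \<le> j" "j < n" for i j
          using x that unfolding sdec_def by (cases "i = j") (auto intro: less_imp_le)
        show ?thesis
        proof (cases "j < n")
          case True
          then show ?thesis using mono[of i j] that by (simp add: x'_def)
        next
          case False
          then show ?thesis using mono[of i n'] that Suc by (cases "i < n") (auto simp: x'_def)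
        qed
      qed
      have "fdet n (R' m) = (\<Sum>h\<in>PiE {0..<n} (\<lambda>i. {x' m (Suc i)<..x' m i}).
          (\<Prod>i<n. r * q ^ nat (x' m i - h i)) * fdet n (\<lambda>i j. d (h i - k j)))"
        unfolding R'_def[abs_def] by (rule fdet_expand_rows) auto
      also have "\<dots> \<ge> 0"
      proof (intro sum_nonneg mult_nonneg_nonneg prod_nonneg)
        fix h assume h: "h \<in> PiE {0..<n} (\<lambda>i. {x' m (Suc i)<..x' m i})"
        have "sdec n h"
          unfolding sdec_def
        proof (intro allI impI)
          fix i j assume ij: "i < j" "j < n"
          have "h j \<le> x' m j" "x' m (Suc i) < h i" using h ij by auto
          with anti[of "Suc i" j] ij show "h j < h i" by linarith
        qed
        then show "0 \<le> fdet n (\<lambda>i j. d (h i - k j))" using totally_positiveD[OF d _ k] by blast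
      qed (use q r in auto)
      finally show ?thesis .
    qed
    ultimately have "0 \<le> fdet n R" by (intro LIMSEQ_le_const[of _ "fdet n R"]) auto
    then show ?thesis by (simp add: eq)
  qed
qed

section \<open>Fourier coefficients on the unit circle\<close>

text \<open>Given by an integral over the unit circle alone, so that it applies to the approximating
  products as well and passes to bounded pointwise limits.\<close>

definition fc :: "(complex \<Rightarrow> complex) \<Rightarrow> int \<Rightarrow> complex" where
  "fc F n = integral {0..2*pi} (\<lambda>t. F (cis t) * cis (- (real_of_int n * t))) / (2 * pi)"

lemma fc_integrable:
  assumes "continuous_on (sphere 0 1) F"
  shows "(\<lambda>t. F (cis t) * cis (- (real_of_int n * t))) integrable_on {0..2*pi}"
  by (intro integrable_continuous_interval continuous_intros continuous_on_compose2[OF assms]) auto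

lemma fc_cong:
  assumes "\<And>u. norm u = 1 \<Longrightarrow> F u = G u"
  shows "fc F n = fc G n"
  unfolding fc_def using assms by simp

lemma fc_add:
  assumes "continuous_on (sphere 0 1) F" "continuous_on (sphere 0 1) G"
  shows "fc (\<lambda>u. F u + G u) n = fc F n + fc G n"
  unfolding fc_def
  by (simp add: distrib_right add_divide_distrib integral_add fc_integrable assms)

lemma fc_cmult: "fc (\<lambda>u. c * F u) n = c * fc F n"
  unfolding fc_def by (simp add: mult.assoc)

lemma fc_sum:
  assumes "finite A" "\<And>k. k \<in> A \<Longrightarrow> continuous_on (sphere 0 1) (F k)"
  shows "fc (\<lambda>u. \<Sum>k\<in>A. F k u) n = (\<Sum>k\<in>A. fc (F k) n)"
  unfolding fc_def
  using assms by (simp add: sum_distrib_right sum_divide_distrib integral_sum fc_integrable)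

lemma fc_shift: "fc (\<lambda>u. u * F u) n = fc F (n - 1)"
proof -
  have "cis t * F (cis t) * cis (- (real_of_int n * t)) = F (cis t) * cis (- (real_of_int (n - 1) * t))" for t
  proof -
    have "cis t * F (cis t) * cis (- (real_of_int n * t)) = F (cis t) * (cis t * cis (- (real_of_int n * t)))"
      by simp
    also have "cis t * cis (- (real_of_int n * t)) = cis (- (real_of_int (n - 1) * t))"
      unfolding cis_mult by (simp add: algebra_simps)
    finally show ?thesis .
  qed
  then show ?thesis unfolding fc_def by (simp only:)
qed

lemma fc_reflect: "fc (\<lambda>u. F (inverse u)) n = fc F (- n)"
proof -
  have "integral {0..2*pi} (\<lambda>t. F (cis t) * cis (real_of_int n * t))
      = integral {- (2*pi)..-0} (\<lambda>t. F (cis (-t)) * cis (- (real_of_int n * t)))"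
    using Henstock_Kurzweil_Integration.integral_reflect_real[of "2*pi" 0 "\<lambda>t. F (cis t) * cis (real_of_int n * t)"] by simp
  also have "\<dots> = integral {0..2*pi} (\<lambda>t. F (cis (-(t - 2 * pi))) * cis (- (real_of_int n * (t - 2 * pi))))"
    using integral_shift_Icc_real[of 0 "2*pi" "\<lambda>t. F (cis (-t)) * cis (- (real_of_int n * t))" "- (2 * pi)"]
    by (simp add: o_def)
  also have "\<dots> = integral {0..2*pi} (\<lambda>t. F (inverse (cis t)) * cis (- (real_of_int n * t)))"
  proof -
    have "cis (-(t - 2 * pi)) = inverse (cis t)" for t
      unfolding cis_inverse minus_diff_eq by (simp add: complex_eq_iff)
    moreover have "cis (- (real_of_int n * (t - 2 * pi))) = cis (- (real_of_int n * t))" for t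
    proof -
      have "cis (- (real_of_int n * (t - 2 * pi))) = cis (- (real_of_int n * t)) * cis (2 * pi * real_of_int n)"
        unfolding cis_mult by (simp add: algebra_simps)
      then show ?thesis by (simp add: cis_multiple_2pi)
    qed
    ultimately show ?thesis by simp
  qed
  finally show ?thesis unfolding fc_def by simp
qed

lemma fc_bound:
  assumes "continuous_on (sphere 0 1) F" "\<And>u. norm u = 1 \<Longrightarrow> norm (F u) \<le> B"
  shows "norm (fc F n) \<le> B"
proof -
  have "norm (integral {0..2*pi} (\<lambda>t. F (cis t) * cis (- (real_of_int n * t)))) \<le> B * (2 * pi - 0)"
  proof (rule integral_bound)
    show "continuous_on {0..2 * pi} (\<lambda>t. F (cis t) * cis (- (real_of_int n * t)))"
      by (intro continuous_intros continuous_on_compose2[OF assms(1)]) auto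
    show "norm (F (cis t) * cis (- (real_of_int n * t))) \<le> B" for t
      using assms(2)[of "cis t"] by (simp add: norm_mult)
  qed simp
  then show ?thesis by (simp add: fc_def norm_divide field_simps)
qed

lemma fc_limit:
  assumes "\<And>m. continuous_on (sphere 0 1) (F m)" "\<And>m u. norm u = 1 \<Longrightarrow> norm (F m u) \<le> B"
    and "\<And>u. norm u = 1 \<Longrightarrow> (\<lambda>m. F m u) \<longlonglongrightarrow> G u"
  shows "(\<lambda>m. fc (F m) n) \<longlonglongrightarrow> fc G n"
  unfolding fc_def
proof (intro tendsto_divide tendsto_const dominated_convergence(2)[where h = "\<lambda>_. B"])
  show "(\<lambda>t. F k (cis t) * cis (- (real_of_int n * t))) integrable_on {0..2 * pi}" for k
    by (rule fc_integrable) fact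
  show "norm (F m (cis t) * cis (- (real_of_int n * t))) \<le> B" for m t
    using assms(2)[of "cis t"] by (simp add: norm_mult)
  show "(\<lambda>m. F m (cis t) * cis (- (real_of_int n * t))) \<longlonglongrightarrow> G (cis t) * cis (- (real_of_int n * t))" for t
    by (intro tendsto_mult tendsto_const assms(3)) simp
qed (auto intro: integrable_const_ivl)

lemma fc_one: "fc (\<lambda>_. 1) n = (if n = 0 then 1 else 0)"
proof (cases "n = 0")
  case True
  have "integral {0..2*pi} (\<lambda>t. 1 :: complex) = of_real (2 * pi)"
    by (subst integral_const_real) (simp add: complex_eq_iff)
  moreover have "fc (\<lambda>_. 1) n = integral {0..2*pi} (\<lambda>t. 1 :: complex) / of_real (2 * pi)"
    using True unfolding fc_def by (simp only: of_int_0 mult_zero_left minus_zero cis_zero mult_1_right)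
  ultimately have "fc (\<lambda>_. 1) n = of_real (2 * pi) / of_real (2 * pi)" by (simp only:)
  also have "\<dots> = 1" by (rule divide_self) (simp only: of_real_eq_0_iff, simp)
  finally show ?thesis using True by simp
next
  case False
  define g where "g t = cis (- (real_of_int n * t)) * (\<i> / of_int n)" for t
  have "((\<lambda>t. cis (- (real_of_int n * t))) has_integral (g (2 * pi) - g 0)) {0..2*pi}"
  proof (rule fundamental_theorem_of_calculus)
    fix t
    define k :: complex where "k = - (\<i> * of_int n)"
    have k: "k * (\<i> / of_int n) = 1" using False by (simp add: k_def)
    have "((\<lambda>x. exp (k * x) * (\<i> / of_int n)) has_field_derivative exp (k * x) * (k * (\<i> / of_int n))) (at x)" for x
    proof -
      have "((\<lambda>x. exp (k * x)) has_field_derivative exp (k * x) * k) (at x)"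
        by (auto intro!: derivative_eq_intros)
      from DERIV_cmult_right[OF this, of "\<i> / of_int n"] show ?thesis by (simp only: mult.assoc)
    qed
    then have "((\<lambda>x. exp (k * x) * (\<i> / of_int n)) has_field_derivative exp (k * x)) (at x)" for x
      unfolding k by simp
    then have "((\<lambda>t. exp (k * complex_of_real t) * (\<i> / of_int n)) has_vector_derivative
        exp (k * complex_of_real t)) (at t within {0..2*pi})"
      by (rule has_vector_derivative_real_field)
    moreover have "exp (k * complex_of_real t) = cis (- (real_of_int n * t))" for t
      by (simp add: k_def cis_conv_exp mult_ac)
    ultimately show "(g has_vector_derivative cis (- (real_of_int n * t))) (at t within {0..2*pi})"
      unfolding g_def[abs_def] by simp
  qed simp
  moreover have "g (2 * pi) = g 0"
    using cis_multiple_2pi[of "- real_of_int n"] by (simp add: g_def mult_ac)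
  ultimately show ?thesis using False by (simp add: fc_def integral_unique)
qed

lemma fc_powi: "fc (\<lambda>u. u powi k) n = (if n = k then 1 else 0)"
proof -
  have pos: "fc (\<lambda>u. u powi int m) n = (if n = int m then 1 else 0)" for m n
  proof (induction m arbitrary: n)
    case (Suc m)
    have "fc (\<lambda>u. u powi int (Suc m)) n = fc (\<lambda>u. u * u powi int m) n"
      by (rule fc_cong) (simp add: power_int_def nat_add_distrib)
    then show ?case using Suc by (simp add: fc_shift)
  qed (simp add: fc_one)
  show ?thesis
  proof (cases "k \<ge> 0")
    case True
    then show ?thesis using pos[of "nat k" n] by simp
  next
    case False
    have "fc (\<lambda>u. u powi k) n = fc (\<lambda>u. inverse u powi int (nat (- k))) n"
      using False by (intro fc_cong) (simp add: power_int_def)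
    also have "\<dots> = (if n = k then 1 else 0)"
      using False by (simp only: fc_reflect[of "\<lambda>u. u powi int (nat (- k))"] pos) auto
    finally show ?thesis .
  qed
qed

text \<open>Turns unordered sums over the integers into limits of sequences of symmetric partial
  sums.\<close>

lemma filterlim_int_box:
  "filterlim (\<lambda>m::nat. {- int m..int m}) (finite_subsets_at_top UNIV) sequentially"
  unfolding filterlim_finite_subsets_at_top
proof (intro allI impI)
  fix X :: "int set" assume "finite X \<and> X \<subseteq> UNIV"
  then have X: "finite ((\<lambda>x. nat \<bar>x\<bar>) ` X)" by simp
  show "\<forall>\<^sub>F y in sequentially. finite {- int y..int y} \<and> X \<subseteq> {- int y..int y} \<and> {- int y..int y} \<subseteq> UNIV"
  proof (rule eventually_sequentiallyI[of "Max (insert 0 ((\<lambda>x. nat \<bar>x\<bar>) ` X))"])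
    fix m assume m: "Max (insert 0 ((\<lambda>x. nat \<bar>x\<bar>) ` X)) \<le> m"
    have "nat \<bar>x\<bar> \<le> m" if "x \<in> X" for x
      using X that m by simp
    then have "X \<subseteq> {- int m..int m}" by force
    then show "finite {- int m..int m} \<and> X \<subseteq> {- int m..int m} \<and> {- int m..int m} \<subseteq> UNIV" by simp
  qed
qed

text \<open>Convergence at \<open>u = 1\<close> already makes \<open>c\<close> absolutely summable,
  and \<open>\<Sum>|c k|\<close> is a common bound on the circle for all partial sums, so that
  integration passes to the limit. Uniqueness of Laurent coefficients follows.\<close>

lemma fc_laurent:
  assumes F: "\<And>u. norm u = 1 \<Longrightarrow> ((\<lambda>k. c k * u powi k) has_sum F u) UNIV"
  shows "fc F n = c n"
proof -
  have "(c has_sum F 1) UNIV" using F[of 1] by simp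
  then have sm: "(\<lambda>k. norm (c k)) summable_on UNIV"
    using has_sum_imp_summable summable_on_iff_abs_summable_on_complex by blast
  define G where "G m u = (\<Sum>k\<in>{- int m..int m}. c k * u powi k)" for m u
  have cont: "continuous_on (sphere 0 1) (\<lambda>u. c k * u powi k)" for k
    by (intro continuous_intros) auto
  have "(\<lambda>m. fc (G m) n) \<longlonglongrightarrow> fc F n"
  proof (rule fc_limit)
    show "continuous_on (sphere 0 1) (G m)" for m
      unfolding G_def by (intro continuous_on_sum cont)
    fix u :: complex assume u: "norm u = 1"
    show "norm (G m u) \<le> infsum (\<lambda>k. norm (c k)) UNIV" for m
    proof -
      have "norm (G m u) \<le> (\<Sum>k\<in>{- int m..int m}. norm (c k))"
        unfolding G_def by (rule sum_norm_le) (simp add: norm_mult norm_power_int u)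
      also have "\<dots> \<le> infsum (\<lambda>k. norm (c k)) UNIV"
        by (rule finite_sum_le_infsum[OF sm]) auto
      finally show ?thesis .
    qed
    show "(\<lambda>m. G m u) \<longlonglongrightarrow> F u"
      using F[OF u] filterlim_int_box unfolding G_def has_sum_def by (rule filterlim_compose)
  qed
  moreover have "\<forall>\<^sub>F m in sequentially. fc (G m) n = c n"
  proof (rule eventually_sequentiallyI[of "nat \<bar>n\<bar>"])
    fix m assume m: "nat \<bar>n\<bar> \<le> m"
    have "fc (G m) n = (\<Sum>k\<in>{- int m..int m}. c k * (if n = k then 1 else 0))"
      unfolding G_def by (subst fc_sum) (auto intro!: cont simp: fc_cmult fc_powi)
    also have "\<dots> = c n"
    proof -
      have "- int m \<le> n" "n \<le> int m" using m by auto
      then show ?thesis by (simp add: if_distrib[of "\<lambda>x. _ * x"] cong: if_cong)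
    qed
    finally show "fc (G m) n = c n" .
  qed
  ultimately show ?thesis
    using tendsto_unique[OF _ _ tendsto_eventually] by (metis sequentially_bot)
qed

section \<open>Totally positive functions on the circle\<close>

text \<open>The bound by 1 is reproduced by every factor and is the dominating constant when
  coefficients are passed to the limit.\<close>

definition tp_function :: "(complex \<Rightarrow> complex) \<Rightarrow> bool" where
  "tp_function F \<longleftrightarrow> continuous_on (sphere 0 1) F \<and> (\<forall>u. norm u = 1 \<longrightarrow> norm (F u) \<le> 1) \<and>
     (\<exists>p. totally_positive p \<and> (\<forall>n. fc F n = of_real (p n)))"

lemma tp_function_one: "tp_function (\<lambda>_. 1)"
  unfolding tp_function_def
  by (auto intro!: exI[of _ "\<lambda>n. if n = 0 then 1 else 0"] totally_positive_delta simp: fc_one)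

lemma tp_function_reflect:
  assumes "tp_function F"
  shows "tp_function (\<lambda>u. F (inverse u))"
proof -
  obtain p where p: "totally_positive p" "\<And>n. fc F n = of_real (p n)"
    using assms by (auto simp: tp_function_def)
  have "continuous_on (sphere 0 1) F" using assms by (simp add: tp_function_def)
  then have "continuous_on (sphere 0 1) (\<lambda>u. F (inverse u))"
    by (rule continuous_on_compose2) (auto intro!: continuous_intros simp: norm_inverse)
  then show ?thesis
    using assms p totally_positive_reflect[OF p(1)] unfolding tp_function_def
    by (auto simp: fc_reflect norm_inverse intro!: exI[of _ "\<lambda>n. p (- n)"])
qed

lemma norm_bernoulli_le:
  assumes "norm u = 1" "0 \<le> b" "b \<le> 1"
  shows "norm (1 + complex_of_real b * (u - 1)) \<le> 1"
proof -
  have "1 + complex_of_real b * (u - 1) = of_real (1 - b) + of_real b * u" by (simp add: algebra_simps)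
  also have "norm \<dots> \<le> norm (complex_of_real (1 - b)) + norm (of_real b * u)" by (rule norm_triangle_ineq)
  also have "\<dots> = 1" using assms unfolding norm_mult norm_of_real by simp
  finally show ?thesis .
qed

lemma norm_geometric_ge:
  assumes "norm u \<le> r" "0 \<le> a"
  shows "1 - a * (r - 1) \<le> norm (1 - complex_of_real a * (u - 1))"
proof -
  have "Re u \<le> r" using assms complex_Re_le_cmod[of u] by linarith
  then have "1 - a * (r - 1) \<le> Re (1 - complex_of_real a * (u - 1))"
    using assms mult_left_mono[of "Re u" r a] by (simp add: algebra_simps)
  also have "\<dots> \<le> norm (1 - complex_of_real a * (u - 1))" by (rule complex_Re_le_cmod)
  finally show ?thesis .
qed

lemma tp_function_bernoulli:
  assumes F: "tp_function F" and b: "0 \<le> b" "b \<le> 1"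
  shows "tp_function (\<lambda>u. F u * (1 + of_real b * (u - 1)))"
proof -
  obtain p where p: "totally_positive p" "\<And>n. fc F n = of_real (p n)"
    using F by (auto simp: tp_function_def)
  have cont: "continuous_on (sphere 0 1) F" and le: "\<And>u. norm u = 1 \<Longrightarrow> norm (F u) \<le> 1"
    using F by (auto simp: tp_function_def)
  have "fc (\<lambda>u. F u * (1 + of_real b * (u - 1))) n = of_real ((1 - b) * p n + b * p (n - 1))" for n
  proof -
    have "fc (\<lambda>u. F u * (1 + of_real b * (u - 1))) n = fc (\<lambda>u. of_real (1 - b) * F u + of_real b * (u * F u)) n"
      by (rule fc_cong) (simp add: algebra_simps)
    also have "\<dots> = of_real (1 - b) * fc F n + of_real b * fc F (n - 1)"
      by (subst fc_add) (auto simp: fc_cmult fc_shift intro!: continuous_intros cont)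
    finally show ?thesis by (simp add: p)
  qed
  moreover have "norm (F u * (1 + of_real b * (u - 1))) \<le> 1" if "norm u = 1" for u
    using mult_mono[OF le[OF that] norm_bernoulli_le[OF that b]] by (simp add: norm_mult)
  ultimately show ?thesis
    unfolding tp_function_def using totally_positive_bernoulli[OF p(1) b]
    by (auto intro!: continuous_intros cont)
qed

text \<open>For the quotient \<open>G\<close>, comparing coefficients in
  \<open>F u = (1 + a) * G u - a * (u * G u)\<close> gives the recursion of
  \<open>totally_positive_geometric\<close> with \<open>q = a / (1 + a)\<close> and
  \<open>r = 1 / (1 + a)\<close>.\<close>

lemma tp_function_geometric:
  assumes F: "tp_function F" and a: "0 \<le> a"
  shows "tp_function (\<lambda>u. F u / (1 - of_real a * (u - 1)))"
proof -
  obtain p where p: "totally_positive p" "\<And>n. fc F n = of_real (p n)"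
    using F by (auto simp: tp_function_def)
  have cont: "continuous_on (sphere 0 1) F" and le: "\<And>u. norm u = 1 \<Longrightarrow> norm (F u) \<le> 1"
    using F by (auto simp: tp_function_def)
  define G where "G u = F u / (1 - of_real a * (u - 1))" for u
  have ge1: "1 \<le> norm (1 - complex_of_real a * (u - 1))" if "norm u = 1" for u
    using norm_geometric_ge[of u 1 a] that a by simp
  have nz: "1 - complex_of_real a * (u - 1) \<noteq> 0" if "norm u = 1" for u
    using ge1[OF that] by auto
  have contG: "continuous_on (sphere 0 1) G"
    unfolding G_def by (intro continuous_intros cont) (use nz in auto)
  have leG: "norm (G u) \<le> 1" if "norm u = 1" for u
    using le[OF that] ge1[OF that] unfolding G_def norm_divide by (simp add: divide_le_eq)
  define q where "q = a / (1 + a)"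
  define r where "r = 1 / (1 + a)"
  have q: "0 \<le> q" "q < 1" "0 \<le> r" using a by (auto simp: q_def r_def)
  have rec: "fc G n = of_real q * fc G (n - 1) + of_real r * of_real (p n)" for n
  proof -
    have "of_real (p n) = fc F n" by (simp add: p)
    also have "\<dots> = fc (\<lambda>u. of_real (1 + a) * G u + of_real (- a) * (u * G u)) n"
    proof (rule fc_cong)
      fix u :: complex assume "norm u = 1"
      then have "F u = G u * (1 - complex_of_real a * (u - 1))"
        unfolding G_def using nz[OF \<open>norm u = 1\<close>] by (metis nonzero_divide_eq_eq)
      also have "\<dots> = of_real (1 + a) * G u + of_real (- a) * (u * G u)" by (simp add: algebra_simps)
      finally show "F u = of_real (1 + a) * G u + of_real (- a) * (u * G u)" .
    qed
    also have "\<dots> = fc (\<lambda>u. of_real (1 + a) * G u) n + fc (\<lambda>u. of_real (- a) * (u * G u)) n"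
      by (rule fc_add) (intro continuous_intros contG)+
    also have "\<dots> = of_real (1 + a) * fc G n - of_real a * fc G (n - 1)"
      unfolding fc_cmult fc_shift by simp
    finally have "of_real (p n) = of_real (1 + a) * fc G n - of_real a * fc G (n - 1)" .
    then have "complex_of_real (1 + a) * fc G n = of_real a * fc G (n - 1) + of_real (p n)" by simp
    moreover have "complex_of_real (1 + a) \<noteq> 0"
      using a by (simp only: of_real_eq_0_iff)
    ultimately have "fc G n = (of_real a * fc G (n - 1) + of_real (p n)) / complex_of_real (1 + a)"
      by (metis nonzero_mult_div_cancel_left)
    then show ?thesis by (simp add: q_def r_def add_divide_distrib)
  qed
  have bd: "norm (fc G n) \<le> 1" for n
    by (rule fc_bound[OF contG leG])
  \<comment> \<open>The coefficients of \<open>F\<close> are real, so imaginary parts obey the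
    homogeneous recursion; iterating it puts \<open>q ^ m\<close> in front of a bounded
    term.\<close>
  have Im0: "Im (fc G n) = 0" for n
  proof -
    have "Im (fc G n) = q ^ m * Im (fc G (n - int m))" for m
    proof (induction m)
      case (Suc m)
      then show ?case using rec[of "n - int m"] by (simp add: algebra_simps)
    qed simp
    moreover have "(\<lambda>m. q ^ m * Im (fc G (n - int m))) \<longlonglongrightarrow> 0"
    proof (rule Lim_null_comparison)
      have "norm (q ^ m * Im (fc G (n - int m))) \<le> q ^ m" for m
        using mult_left_mono[OF order_trans[OF abs_Im_le_cmod bd], of "q ^ m" "n - int m"] q
        by (simp add: abs_mult)
      then show "\<forall>\<^sub>F m in sequentially. norm (q ^ m * Im (fc G (n - int m))) \<le> q ^ m" by simp
      show "(\<lambda>m. q ^ m) \<longlonglongrightarrow> 0" using q by (intro LIMSEQ_power_zero) auto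
    qed
    ultimately have "(\<lambda>m. Im (fc G n)) \<longlonglongrightarrow> 0" by simp
    then show ?thesis by (simp add: LIMSEQ_const_iff)
  qed
  have "totally_positive (\<lambda>n. Re (fc G n))"
  proof (rule totally_positive_geometric[OF p(1) q])
    show "Re (fc G n) = q * Re (fc G (n - 1)) + r * p n" for n
      by (subst rec) simp
    show "\<bar>Re (fc G n)\<bar> \<le> 1" for n using abs_Re_le_cmod bd order_trans by blast
  qed
  moreover have "fc G n = of_real (Re (fc G n))" for n
    using Im0 by (simp add: complex_eq_iff)
  ultimately have "tp_function G"
    unfolding tp_function_def using contG leG by blast
  then show ?thesis by (simp add: G_def[abs_def])
qed

lemma tp_coefficients_limit:
  assumes F: "\<And>m. tp_function (F m)" and lim: "\<And>u. norm u = 1 \<Longrightarrow> (\<lambda>m. F m u) \<longlonglongrightarrow> G u"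
  shows "\<exists>p. totally_positive p \<and> (\<forall>n. fc G n = of_real (p n))"
proof -
  obtain p where p: "\<And>m. totally_positive (p m)" "\<And>m n. fc (F m) n = of_real (p m n)"
    using F unfolding tp_function_def by metis
  have lim: "(\<lambda>m. fc (F m) n) \<longlonglongrightarrow> fc G n" for n
    by (rule fc_limit[of F 1 G]) (use F lim in \<open>auto simp: tp_function_def\<close>)
  then have *: "(\<lambda>m. complex_of_real (p m n)) \<longlonglongrightarrow> fc G n" for n by (simp add: p)
  have "(\<lambda>m. p m n) \<longlonglongrightarrow> Re (fc G n)" for n
    using tendsto_Re[OF *[of n]] by simp
  then have "totally_positive (\<lambda>n. Re (fc G n))"
    by (rule totally_positive_limit[OF p(1)])
  moreover have "Im (fc G n) = 0" for n
    using tendsto_Im[OF *[of n]] by (simp add: LIMSEQ_const_iff)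
  then have "fc G n = of_real (Re (fc G n))" for n
    by (simp add: complex_eq_iff)
  ultimately show ?thesis by blast
qed

lemma norm_tp_limit_le:
  assumes F: "\<And>m. tp_function (F m)" and lim: "\<And>u. norm u = 1 \<Longrightarrow> (\<lambda>m. F m u) \<longlonglongrightarrow> G u"
    and u: "norm u = 1"
  shows "norm (G u) \<le> 1"
  by (rule tendsto_upperbound[OF tendsto_norm[OF lim[OF u]]]) (use F u in \<open>auto simp: tp_function_def\<close>)

lemma norm_exp_minus_linear_le: "norm (exp z - (1 + z)) \<le> exp (norm z) * (norm z)\<^sup>2" for z :: complex
proof -
  have "norm (exp z - (\<Sum>k\<le>1. z ^ k / of_nat (fact k))) \<le> exp \<bar>Re z\<bar> * norm z ^ Suc 1 / fact 1"
    using Taylor_exp[of z 1] by simp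
  also have "\<dots> \<le> exp (norm z) * (norm z)\<^sup>2"
    using abs_Re_le_cmod[of z] by (simp add: power2_eq_square mult_right_mono)
  finally show ?thesis by simp
qed

text \<open>The Poisson limit: the exponential is approximated by powers of a Bernoulli factor. Both
  \<open>1 + z\<close> and \<open>exp z\<close> lie in the closed unit disc here, so their powers
  with exponent \<open>M\<close> differ by at most \<open>M\<close> times
  \<open>norm (1 + z - exp z)\<close>, which is of order \<open>1 / M\<close>.\<close>

lemma tp_function_exp:
  assumes F: "tp_function F" and g: "0 \<le> g"
  shows "tp_function (\<lambda>u. F u * exp (of_real g * (u - 1)))"
proof -
  \<comment> \<open>The offset \<open>k\<close> ensures \<open>b m \<le> 1\<close> for every
    \<open>m\<close>, so that each approximant is a product of genuine Bernoulli factors.\<close>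
  define k where "k = Suc (nat \<lceil>g\<rceil>)"
  define b where "b m = g / real (m + k)" for m
  define H where "H m u = F u * (1 + of_real (b m) * (u - 1)) ^ (m + k)" for m u
  have b: "0 \<le> b m" "b m \<le> 1" for m
    unfolding b_def k_def using g by (simp, simp add: divide_le_eq, linarith)
  have "tp_function (\<lambda>u. F u * (1 + of_real (b m) * (u - 1)) ^ j)" for m j
  proof (induction j)
    case (Suc j)
    show ?case using tp_function_bernoulli[OF Suc b, of m] by (simp add: mult_ac)
  qed (use F in simp)
  then have H: "tp_function (H m)" for m by (simp add: H_def[abs_def])
  have lim: "(\<lambda>m. H m u) \<longlonglongrightarrow> F u * exp (of_real g * (u - 1))" if u: "norm u = 1" for u
  proof -
    have Re: "Re (of_real b * (u - 1)) \<le> 0" if "0 \<le> b" for b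
      using complex_Re_le_cmod[of u] u that by (simp add: mult_nonneg_nonpos)
    let ?z = "\<lambda>m. complex_of_real (b m) * (u - 1)"
    have "norm ((1 + ?z m) ^ (m + k) - exp (of_real g * (u - 1))) \<le> exp (2 * g) * (4 * g\<^sup>2) / real (m + k)" for m
    proof -
      have mk: "0 < real (m + k)" by (simp add: k_def)
      have "real (m + k) * b m = g" using mk by (simp add: b_def)
      then have "of_nat (m + k) * complex_of_real (b m) = of_real g"
        by (metis of_real_mult of_real_of_nat_eq)
      then have "exp (of_real g * (u - 1)) = exp (of_nat (m + k) * ?z m)"
        by (simp only: mult.assoc[symmetric])
      also have "\<dots> = exp (?z m) ^ (m + k)" by (rule exp_of_nat_mult)
      finally have "norm ((1 + ?z m) ^ (m + k) - exp (of_real g * (u - 1)))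
          = norm ((1 + ?z m) ^ (m + k) - exp (?z m) ^ (m + k))" by simp
      also have "\<dots> \<le> real (m + k) * norm ((1 + ?z m) - exp (?z m))"
        using norm_bernoulli_le[OF u b] Re[OF b(1)] by (intro norm_power_diff) auto
      also have "norm ((1 + ?z m) - exp (?z m)) \<le> exp (norm (?z m)) * (norm (?z m))\<^sup>2"
        using norm_exp_minus_linear_le[of "?z m"] by (simp add: norm_minus_commute)
      also have "\<dots> \<le> exp (2 * g) * (2 * b m)\<^sup>2"
      proof -
        have "norm (u - 1) \<le> 2" using norm_triangle_ineq4[of u 1] u by simp
        then have *: "norm (?z m) \<le> 2 * b m"
          using b[of m] mult_left_mono[of "norm (u - 1)" 2 "b m"] by (simp add: norm_mult)
        moreover have "b m \<le> g"
        proof -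
          have "g * 1 \<le> g * real (m + k)" using g by (intro mult_left_mono) (auto simp: k_def)
          then show ?thesis unfolding b_def using mk by (simp only: pos_divide_le_eq mult_1_right)
        qed
        ultimately have "norm (?z m) \<le> 2 * g" by linarith
        then have "exp (norm (?z m)) \<le> exp (2 * g)" by simp
        moreover have "(norm (?z m))\<^sup>2 \<le> (2 * b m)\<^sup>2" using * by (intro power_mono) auto
        ultimately show ?thesis by (intro mult_mono) auto
      qed
      also have "real (m + k) * (exp (2 * g) * (2 * b m)\<^sup>2) = exp (2 * g) * (4 * g\<^sup>2) / real (m + k)"
      proof -
        have "M * (E * (2 * (g / M))\<^sup>2) = E * (4 * g\<^sup>2) / M" if "0 < M" for M E :: real
          using that by (simp add: power2_eq_square field_simps)
        from this[OF mk] show ?thesis unfolding b_def .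
      qed
      finally show ?thesis using mk by simp
    qed
    moreover have "(\<lambda>m. exp (2 * g) * (4 * g\<^sup>2) / real (m + k)) \<longlonglongrightarrow> 0"
      using LIMSEQ_ignore_initial_segment[OF lim_const_over_n, of "exp (2 * g) * (4 * g\<^sup>2)" k] by simp
    ultimately have "(\<lambda>m. (1 + ?z m) ^ (m + k) - exp (of_real g * (u - 1))) \<longlonglongrightarrow> 0"
      by (rule Lim_null_comparison[OF always_eventually[OF allI]])
    then have "(\<lambda>m. (1 + ?z m) ^ (m + k)) \<longlonglongrightarrow> exp (of_real g * (u - 1))"
      by (simp only: LIM_zero_iff)
    then show ?thesis
      unfolding H_def by (intro tendsto_mult tendsto_const)
  qed
  show ?thesis
    unfolding tp_function_def
  proof (intro conjI allI impI)
    show "continuous_on (sphere 0 1) (\<lambda>u. F u * exp (of_real g * (u - 1)))"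
      using F by (intro continuous_intros) (simp add: tp_function_def)
  qed (rule norm_tp_limit_le[of H, OF H lim] tp_coefficients_limit[of H, OF H lim] | assumption)+
qed

section \<open>Laurent expansion of the generating function\<close>

lemma has_sum_product_abs:
  fixes a b :: "nat \<Rightarrow> complex"
  assumes a: "(\<lambda>n. norm (a n)) summable_on UNIV" "(a has_sum x) UNIV"
    and b: "(\<lambda>n. norm (b n)) summable_on UNIV" "(b has_sum y) UNIV"
  shows "((\<lambda>(m, n). a m * b n) has_sum (x * y)) (UNIV \<times> UNIV)"
proof -
  have "(\<lambda>p. norm (a (fst p) * b (snd p))) summable_on UNIV \<times> UNIV"
  proof (rule summable_on_SigmaI)
    show "((\<lambda>n. norm (a (fst (m, n)) * b (snd (m, n)))) has_sum norm (a m) * infsum (\<lambda>n. norm (b n)) UNIV) UNIV" for m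
      unfolding norm_mult fst_conv snd_conv by (intro has_sum_cmult_right has_sum_infsum b)
    show "(\<lambda>m. norm (a m) * infsum (\<lambda>n. norm (b n)) UNIV) summable_on UNIV"
      by (intro summable_on_cmult_left a)
  qed auto
  then have "(\<lambda>p. norm (case p of (m, n) \<Rightarrow> a m * b n)) summable_on UNIV \<times> UNIV"
    by (simp add: case_prod_unfold)
  then have "(\<lambda>(m, n). a m * b n) summable_on UNIV \<times> UNIV"
    using summable_on_iff_abs_summable_on_complex by blast
  then obtain S where S: "((\<lambda>(m, n). a m * b n) has_sum S) (UNIV \<times> UNIV)"
    by (auto simp: summable_on_def)
  have "((\<lambda>m. a m * y) has_sum S) UNIV"
    by (rule has_sum_SigmaD[OF S]) (auto intro: has_sum_cmult_right b)
  moreover have "((\<lambda>m. a m * y) has_sum (x * y)) UNIV"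
    by (intro has_sum_cmult_left a)
  ultimately show ?thesis using S has_sum_unique by blast
qed

lemma power_series_has_sum:
  fixes a :: "nat \<Rightarrow> complex"
  assumes "\<And>u. norm u < R \<Longrightarrow> (\<lambda>n. a n * u ^ n) sums f u" and u: "norm u < R"
  shows "(\<lambda>n. norm (a n * u ^ n)) summable_on UNIV" "((\<lambda>n. a n * u ^ n) has_sum f u) UNIV"
proof -
  obtain r where r: "norm u < r" "r < R" using dense u by blast
  then have "0 < r" using norm_ge_zero[of u] by linarith
  then have "summable (\<lambda>n. a n * (of_real r) ^ n)"
    using assms(1)[of "of_real r"] r by (auto simp: sums_iff)
  then have s: "summable (\<lambda>n. norm (a n * u ^ n))"
    by (rule powser_insidea) (use r \<open>0 < r\<close> in auto)
  then show "((\<lambda>n. a n * u ^ n) has_sum f u) UNIV"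
    using assms by (intro norm_summable_imp_has_sum) auto
  show "(\<lambda>n. norm (a n * u ^ n)) summable_on UNIV"
    using s by (intro norm_summable_imp_summable_on) simp
qed

text \<open>The Taylor series of \<open>f\<close> at \<open>u\<close> and of \<open>g\<close> at
  \<open>inverse u\<close> are multiplied, and the absolutely convergent double series is regrouped
  along the diagonals \<open>m - n = k\<close>.\<close>

lemma laurent_product:
  fixes f g :: "complex \<Rightarrow> complex"
  assumes f: "f holomorphic_on ball 0 R" and g: "g holomorphic_on ball 0 S" and RS: "1 < R" "1 < S"
  shows "\<exists>c. \<forall>u. u \<noteq> 0 \<and> norm u < R \<and> norm (inverse u) < S \<longrightarrow>
    ((\<lambda>k. c k * u powi k) has_sum f u * g (inverse u)) UNIV"
proof -
  define a where "a n = (deriv ^^ n) f 0 / fact n" for n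
  define b where "b n = (deriv ^^ n) g 0 / fact n" for n
  have a: "(\<lambda>n. a n * u ^ n) sums f u" if "norm u < R" for u
    using holomorphic_power_series[OF f, of u] that by (simp add: a_def)
  have b: "(\<lambda>n. b n * u ^ n) sums g u" if "norm u < S" for u
    using holomorphic_power_series[OF g, of u] that by (simp add: b_def)
  define D where "D k = {(m, n). int m - int n = k}" for k
  have bij: "bij_betw snd (Sigma UNIV D) (UNIV \<times> UNIV)"
    by (rule bij_betwI[where g = "\<lambda>(m, n). (int m - int n, (m, n))"]) (auto simp: D_def)
  have prod: "((\<lambda>p. (\<lambda>(m, n). a m * u ^ m * (b n * inverse u ^ n)) (snd p)) has_sum (f u * g (inverse u))) (Sigma UNIV D)"
    if "norm u < R" "norm (inverse u) < S" for u
    unfolding has_sum_reindex_bij_betw[OF bij]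
    by (intro has_sum_product_abs power_series_has_sum[of R a f] power_series_has_sum[of S b g] a b that)
  \<comment> \<open>The point 1 lies in both discs, so the diagonal sums exist without any power of
    \<open>u\<close>; the coefficients \<open>c k\<close> are thus the same for all
    \<open>u\<close>.\<close>
  have one: "(\<lambda>(m, n). a m * b n) summable_on D k" for k
  proof -
    have "((\<lambda>p. (\<lambda>(m, n). a m * b n) (snd p)) has_sum (f 1 * g 1)) (Sigma UNIV D)"
      using prod[of 1] RS by simp
    then have "((\<lambda>(m, n). a m * b n) has_sum (f 1 * g 1)) (UNIV \<times> UNIV)"
      unfolding has_sum_reindex_bij_betw[OF bij] .
    then have "(\<lambda>(m, n). a m * b n) summable_on (UNIV \<times> UNIV)" by (rule has_sum_imp_summable)
    then show ?thesis by (rule summable_on_subset_banach) auto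
  qed
  define c where "c k = infsum (\<lambda>(m, n). a m * b n) (D k)" for k
  have "((\<lambda>k. c k * u powi k) has_sum f u * g (inverse u)) UNIV"
    if u: "u \<noteq> 0" "norm u < R" "norm (inverse u) < S" for u
  proof (rule has_sum_SigmaD[OF prod[OF u(2,3)]])
    fix k
    have "((\<lambda>(m, n). a m * b n) has_sum c k) (D k)"
      unfolding c_def by (rule has_sum_infsum[OF one])
    then have "((\<lambda>p. (\<lambda>(m, n). a m * b n) p * u powi k) has_sum c k * u powi k) (D k)"
      by (rule has_sum_cmult_left)
    moreover have "(\<lambda>(m, n). a m * u ^ m * (b n * inverse u ^ n)) p = (\<lambda>(m, n). a m * b n) p * u powi k"
      if "p \<in> D k" for p
    proof -
      obtain m n where p: "p = (m, n)" "k = int m - int n" using \<open>p \<in> D k\<close> by (auto simp: D_def)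
      have "u powi k = u ^ m * inverse u ^ n"
        unfolding p(2) using u(1) by (subst power_int_diff) (auto simp: divide_inverse power_inverse)
      then show ?thesis by (simp add: p(1))
    qed
    ultimately show "((\<lambda>y. (\<lambda>(m, n). a m * u ^ m * (b n * inverse u ^ n)) (snd (k, y))) has_sum c k * u powi k) (D k)"
      unfolding snd_conv by (subst has_sum_cong) auto
  qed
  then show ?thesis by blast
qed

section \<open>One half of the generating function: convergence, holomorphy and Laurent
  expansion\<close>

definition ab_factor :: "(nat \<Rightarrow> real) \<Rightarrow> (nat \<Rightarrow> real) \<Rightarrow> complex \<Rightarrow> nat \<Rightarrow> complex" where
  "ab_factor \<alpha> \<beta> u i = (1 + of_real (\<beta> i) * (u - 1)) / (1 - of_real (\<alpha> i) * (u - 1))"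

definition ab_seqs :: "(nat \<Rightarrow> real) \<Rightarrow> (nat \<Rightarrow> real) \<Rightarrow> bool" where
  "ab_seqs \<alpha> \<beta> \<longleftrightarrow> decseq \<alpha> \<and> decseq \<beta> \<and> (\<forall>i. 0 \<le> \<alpha> i \<and> 0 \<le> \<beta> i) \<and> summable (\<lambda>i. \<alpha> i + \<beta> i)"

lemma ab_denominator_ge:
  assumes "ab_seqs \<alpha> \<beta>" "norm u \<le> r" "1 \<le> r"
  shows "1 - \<alpha> 0 * (r - 1) \<le> norm (1 - complex_of_real (\<alpha> i) * (u - 1))"
proof -
  have "\<alpha> i \<le> \<alpha> 0" "0 \<le> \<alpha> i" using assms(1) by (auto simp: ab_seqs_def decseq_def)
  then have "1 - \<alpha> 0 * (r - 1) \<le> 1 - \<alpha> i * (r - 1)"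
    using assms(3) by (simp add: mult_right_mono)
  also have "\<dots> \<le> norm (1 - complex_of_real (\<alpha> i) * (u - 1))"
    by (rule norm_geometric_ge) fact+
  finally show ?thesis .
qed

lemma norm_ab_factor_le:
  assumes ab: "ab_seqs \<alpha> \<beta>" and u: "norm u \<le> r" "1 \<le> r" and r: "\<alpha> 0 * (r - 1) < 1"
  shows "norm (ab_factor \<alpha> \<beta> u i - 1) \<le> (\<alpha> i + \<beta> i) * ((r + 1) / (1 - \<alpha> 0 * (r - 1)))"
proof -
  note D = ab_denominator_ge[OF ab u, of i]
  have nz: "1 - complex_of_real (\<alpha> i) * (u - 1) \<noteq> 0" using D r by auto
  have pos: "0 \<le> \<alpha> i" "0 \<le> \<beta> i" using ab by (auto simp: ab_seqs_def)
  have "ab_factor \<alpha> \<beta> u i - 1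
      = ((1 + of_real (\<beta> i) * (u - 1)) - (1 - of_real (\<alpha> i) * (u - 1))) / (1 - of_real (\<alpha> i) * (u - 1))"
    unfolding ab_factor_def by (simp only: diff_divide_distrib[of _ "1 - of_real (\<alpha> i) * (u - 1)"] divide_self[OF nz])
  also have "\<dots> = of_real (\<alpha> i + \<beta> i) * (u - 1) / (1 - of_real (\<alpha> i) * (u - 1))"
    by (simp add: algebra_simps)
  also have "norm \<dots> = (\<alpha> i + \<beta> i) * norm (u - 1) / norm (1 - complex_of_real (\<alpha> i) * (u - 1))"
    using pos unfolding norm_divide norm_mult norm_of_real by simp
  also have "\<dots> \<le> (\<alpha> i + \<beta> i) * (r + 1) / (1 - \<alpha> 0 * (r - 1))"
  proof (rule frac_le)
    have "norm (u - 1) \<le> r + 1" using norm_triangle_ineq4[of u 1] u by simp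
    then show "(\<alpha> i + \<beta> i) * norm (u - 1) \<le> (\<alpha> i + \<beta> i) * (r + 1)"
      using pos by (intro mult_left_mono) auto
  qed (use pos u r D in auto)
  finally show ?thesis by simp
qed

lemma ab_product_converges:
  assumes ab: "ab_seqs \<alpha> \<beta>" and r: "\<alpha> 0 * (norm u - 1) < 1"
  shows "convergent_prod (ab_factor \<alpha> \<beta> u)"
proof -
  define r where "r = max 1 (norm u)"
  have "norm u \<le> r" "1 \<le> r" "\<alpha> 0 * (r - 1) < 1" using r by (auto simp: r_def max_def)
  note le = norm_ab_factor_le[OF ab this]
  have "summable (\<lambda>i. norm (ab_factor \<alpha> \<beta> u i - 1))"
  proof (rule summable_comparison_test)
    show "\<exists>N. \<forall>n\<ge>N. norm (norm (ab_factor \<alpha> \<beta> u n - 1)) \<le> (\<alpha> n + \<beta> n) * ((r + 1) / (1 - \<alpha> 0 * (r - 1)))"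
      using le by simp
    show "summable (\<lambda>n. (\<alpha> n + \<beta> n) * ((r + 1) / (1 - \<alpha> 0 * (r - 1))))"
      using ab by (intro summable_mult2) (simp add: ab_seqs_def)
  qed
  then show ?thesis
    by (intro abs_convergent_prod_imp_convergent_prod summable_imp_abs_convergent_prod)
qed

text \<open>The zero of a denominator nearest to the origin is \<open>1 + 1 / \<alpha> 0\<close>.
  The condition on \<open>R\<close> keeps the closed disc away from it, so a multiple of
  \<open>\<alpha> i + \<beta> i\<close> dominates the distance of the factors from 1, and
  convergence is uniform.\<close>

lemma ab_product_holomorphic:
  assumes ab: "ab_seqs \<alpha> \<beta>" and R: "1 \<le> R" "\<alpha> 0 * (R - 1) < 1"
  shows "(\<lambda>u. prodinf (ab_factor \<alpha> \<beta> u)) holomorphic_on ball 0 R"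
proof -
  have nz: "1 - complex_of_real (\<alpha> i) * (u - 1) \<noteq> 0" if "norm u \<le> R" for u i
    using ab_denominator_ge[OF ab that R(1), of i] R by auto
  have hol: "(\<lambda>u. ab_factor \<alpha> \<beta> u i) holomorphic_on cball 0 R" for i
    unfolding ab_factor_def by (intro holomorphic_intros) (use nz in auto)
  have "uniformly_convergent_on (cball 0 R) (\<lambda>N u. \<Sum>n<N. norm (ab_factor \<alpha> \<beta> u n - 1))"
  proof (rule Weierstrass_m_test')
    show "norm (norm (ab_factor \<alpha> \<beta> u n - 1)) \<le> (\<alpha> n + \<beta> n) * ((R + 1) / (1 - \<alpha> 0 * (R - 1)))"
      if "u \<in> cball 0 R" for n u
      using norm_ab_factor_le[OF ab _ R, of u n] that by simp
    show "summable (\<lambda>n. (\<alpha> n + \<beta> n) * ((R + 1) / (1 - \<alpha> 0 * (R - 1))))"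
      using ab by (intro summable_mult2) (simp add: ab_seqs_def)
  qed
  then have "uniformly_convergent_on (cball 0 R) (\<lambda>N u. \<Prod>n<N. ab_factor \<alpha> \<beta> u n)"
    by (intro uniformly_convergent_on_prod' holomorphic_on_imp_continuous_on hol) auto
  then obtain g where g: "uniform_limit (cball 0 R) (\<lambda>N u. \<Prod>n<N. ab_factor \<alpha> \<beta> u n) g sequentially"
    by (auto simp: uniformly_convergent_on_def)
  have "g holomorphic_on ball 0 R"
  proof (rule holomorphic_uniform_limit[OF _ g])
    have "(\<lambda>u. \<Prod>n<N. ab_factor \<alpha> \<beta> u n) holomorphic_on cball 0 R" for N
      by (intro holomorphic_on_prod hol)
    then show "\<forall>\<^sub>F N in sequentially. continuous_on (cball 0 R) (\<lambda>u. \<Prod>n<N. ab_factor \<alpha> \<beta> u n) \<and>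
        (\<lambda>u. \<Prod>n<N. ab_factor \<alpha> \<beta> u n) holomorphic_on ball 0 R"
      by (intro always_eventually allI conjI holomorphic_on_imp_continuous_on)
         (auto intro: holomorphic_on_subset[OF _ ball_subset_cball])
  qed auto
  moreover have "g u = prodinf (ab_factor \<alpha> \<beta> u)" if "u \<in> ball 0 R" for u
  proof (rule LIMSEQ_unique)
    show "(\<lambda>N. \<Prod>n<N. ab_factor \<alpha> \<beta> u n) \<longlonglongrightarrow> g u"
      using tendsto_uniform_limitI[OF g] that by simp
    have "\<alpha> 0 * (norm u - 1) \<le> \<alpha> 0 * (R - 1)"
      using that ab by (intro mult_left_mono) (auto simp: ab_seqs_def)
    then have "convergent_prod (ab_factor \<alpha> \<beta> u)"
      using R by (intro ab_product_converges[OF ab]) auto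
    then show "(\<lambda>N. \<Prod>n<N. ab_factor \<alpha> \<beta> u n) \<longlonglongrightarrow> prodinf (ab_factor \<alpha> \<beta> u)"
      using convergent_prod_LIMSEQ LIMSEQ_lessThan_iff_atMost by blast
  qed
  ultimately show ?thesis by (subst holomorphic_cong[OF refl]) auto
qed

text \<open>The parameter \<open>\<gamma>\<close> of either sign.\<close>

definition gap :: "real \<Rightarrow> (nat \<Rightarrow> real) \<Rightarrow> (nat \<Rightarrow> real) \<Rightarrow> real" where
  "gap \<delta> \<alpha> \<beta> = \<delta> - (\<Sum>i. \<alpha> i + \<beta> i)"

text \<open>\<open>Phi\<close> is the product of this function for the plus parameters at
  \<open>u\<close> and for the minus parameters at \<open>inverse u\<close>, so every estimate is
  made for one sign only.\<close>

definition Psi :: "real \<Rightarrow> (nat \<Rightarrow> real) \<Rightarrow> (nat \<Rightarrow> real) \<Rightarrow> complex \<Rightarrow> complex" where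
  "Psi \<delta> \<alpha> \<beta> u = exp (of_real (gap \<delta> \<alpha> \<beta>) * (u - 1)) * prodinf (ab_factor \<alpha> \<beta> u)"

lemma Phi_eq_Psi:
  assumes "ab_seqs \<alpha>p \<beta>p" "ab_seqs \<alpha>m \<beta>m"
    and "\<alpha>p 0 * (norm u - 1) < 1" "\<alpha>m 0 * (norm (inverse u) - 1) < 1"
  shows "Phi u (\<alpha>p, \<beta>p, \<alpha>m, \<beta>m, \<delta>p, \<delta>m) =
    Psi \<delta>p \<alpha>p \<beta>p u * Psi \<delta>m \<alpha>m \<beta>m (inverse u)"
proof -
  have "prodinf (ab_factor \<alpha>p \<beta>p u) * prodinf (ab_factor \<alpha>m \<beta>m (inverse u)) =
      (\<Prod>i. ab_factor \<alpha>p \<beta>p u i * ab_factor \<alpha>m \<beta>m (inverse u) i)"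
    by (intro prodinf_mult ab_product_converges assms)
  then show ?thesis
    unfolding Phi_def Psi_def gap_def ab_factor_def[abs_def] Let_def
    by (simp add: exp_add mult_ac)
qed

lemma Omega_ab:
  assumes "(\<alpha>p, \<beta>p, \<alpha>m, \<beta>m, \<delta>p, \<delta>m) \<in> Omega"
  shows "ab_seqs \<alpha>p \<beta>p" "ab_seqs \<alpha>m \<beta>m" "0 \<le> gap \<delta>p \<alpha>p \<beta>p" "0 \<le> gap \<delta>m \<alpha>m \<beta>m"
    "0 \<le> \<beta>p i" "0 \<le> \<beta>m i" "\<beta>p i + \<beta>m j \<le> 1" "\<beta>p i \<le> 1" "\<beta>m i \<le> 1" "0 \<le> \<delta>p" "0 \<le> \<delta>m"
proof -
  show "ab_seqs \<alpha>p \<beta>p" "ab_seqs \<alpha>m \<beta>m" "0 \<le> gap \<delta>p \<alpha>p \<beta>p" "0 \<le> gap \<delta>m \<alpha>m \<beta>m"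
    "0 \<le> \<beta>p i" "0 \<le> \<beta>m i" "0 \<le> \<delta>p" "0 \<le> \<delta>m"
    using assms by (auto simp: Omega_def ab_seqs_def gap_def)
  have "decseq \<beta>p" "decseq \<beta>m" "\<beta>p 0 + \<beta>m 0 \<le> 1" and pos: "\<And>i. 0 \<le> \<beta>p i" "\<And>i. 0 \<le> \<beta>m i"
    using assms by (auto simp: Omega_def)
  moreover have "\<beta>p i \<le> \<beta>p 0" "\<beta>m j \<le> \<beta>m 0" for i j
    using \<open>decseq \<beta>p\<close> \<open>decseq \<beta>m\<close> by (auto simp: decseq_def)
  ultimately show "\<beta>p i + \<beta>m j \<le> 1" "\<beta>p i \<le> 1" "\<beta>m i \<le> 1"
    using pos by (smt (verit))+
qed

lemma exists_radius:
  assumes "0 \<le> (a::real)" "a * (x - 1) < 1"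
  shows "\<exists>R. 1 < R \<and> x < R \<and> a * (R - 1) < 1"
proof -
  define y where "y = max 1 x"
  have y: "a * (y - 1) < 1" using assms by (auto simp: y_def max_def)
  define e where "e = (1 - a * (y - 1)) / (2 * (a + 1))"
  have e: "0 < e" using y assms(1) by (simp add: e_def)
  have "a * e \<le> (a + 1) * e" using e by simp
  also have "\<dots> = (1 - a * (y - 1)) / 2" using assms(1) by (simp add: e_def field_simps)
  finally have "a * ((y + e) - 1) < 1" using y by (simp add: algebra_simps)
  then show ?thesis using e by (intro exI[of _ "y + e"]) (auto simp: y_def)
qed

lemma Phi_laurent_aux:
  assumes \<omega>: "(\<alpha>p, \<beta>p, \<alpha>m, \<beta>m, \<delta>p, \<delta>m) \<in> Omega"
    and R: "1 < R" "\<alpha>p 0 * (R - 1) < 1" and S: "1 < S" "\<alpha>m 0 * (S - 1) < 1"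
  shows "\<exists>c. \<forall>u. u \<noteq> 0 \<and> norm u < R \<and> norm (inverse u) < S \<longrightarrow>
    ((\<lambda>k. c k * u powi k) has_sum Phi u (\<alpha>p, \<beta>p, \<alpha>m, \<beta>m, \<delta>p, \<delta>m)) UNIV"
proof -
  note ab = Omega_ab[OF \<omega>]
  have *: "\<exists>c. \<forall>u. u \<noteq> 0 \<and> norm u < R \<and> norm (inverse u) < S \<longrightarrow>
    ((\<lambda>k. c k * u powi k) has_sum
       Psi \<delta>p \<alpha>p \<beta>p u * Psi \<delta>m \<alpha>m \<beta>m (inverse u)) UNIV"
    unfolding Psi_def
    by (intro laurent_product holomorphic_intros ab_product_holomorphic) (use ab R S in auto)
  have le: "a 0 * (x - 1) < 1" if "ab_seqs a b" "x < y" "a 0 * (y - 1) < 1" for a b :: "nat \<Rightarrow> real" and x y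
    using mult_left_mono[of "x - 1" "y - 1" "a 0"] that by (auto simp: ab_seqs_def)
  have "Phi u (\<alpha>p, \<beta>p, \<alpha>m, \<beta>m, \<delta>p, \<delta>m) =
      Psi \<delta>p \<alpha>p \<beta>p u * Psi \<delta>m \<alpha>m \<beta>m (inverse u)"
    if "norm u < R" "norm (inverse u) < S" for u
    by (intro Phi_eq_Psi ab le[OF ab(1) that(1) R(2)] le[OF ab(2) that(2) S(2)])
  with * show ?thesis by auto
qed

lemma laurent_near_circle_fc:
  assumes "laurent_near_circle F c"
  shows "c = fc F"
proof
  fix n
  have "((\<lambda>k. c k * u powi k) has_sum F u) UNIV" if "norm u = 1" for u
    using assms that by (auto simp: laurent_near_circle_def)
  then show "c n = fc F n" by (rule fc_laurent[symmetric])
qed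

text \<open>The expansion is claimed on the whole annulus between the poles and not merely near the
  circle, because it is evaluated at real points whose distance from 1 is prescribed. Expansions on
  different annuli have the same coefficients, all being equal to \<open>fc\<close>.\<close>

theorem phi_hat_has_sum:
  assumes \<omega>: "(\<alpha>p, \<beta>p, \<alpha>m, \<beta>m, \<delta>p, \<delta>m) \<in> Omega" (is "?\<omega> \<in> _")
  shows "phi_hat ?\<omega> = fc (\<lambda>u. Phi u ?\<omega>)"
    and "u \<noteq> 0 \<Longrightarrow> \<alpha>p 0 * (norm u - 1) < 1 \<Longrightarrow> \<alpha>m 0 * (norm (inverse u) - 1) < 1 \<Longrightarrow>
      ((\<lambda>k. phi_hat ?\<omega> k * u powi k) has_sum Phi u ?\<omega>) UNIV"
proof -
  note ab = Omega_ab[OF \<omega>]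
  have pos: "0 \<le> \<alpha>p 0" "0 \<le> \<alpha>m 0" using ab by (auto simp: ab_seqs_def)
  have laurent: "laurent_near_circle (\<lambda>u. Phi u ?\<omega>) c"
    if R: "1 < R" "1 < S" and c: "\<forall>u. u \<noteq> 0 \<and> norm u < R \<and> norm (inverse u) < S \<longrightarrow>
      ((\<lambda>k. c k * u powi k) has_sum Phi u ?\<omega>) UNIV" for c R S
    unfolding laurent_near_circle_def
  proof (rule exI[of _ "1 / S"], rule exI[of _ R], intro conjI allI impI)
    fix u :: complex assume u: "1 / S < norm u \<and> norm u < R"
    then have "0 < norm u" using R zero_less_divide_1_iff[of S] by linarith
    moreover have "norm (inverse u) < S"
      using u R \<open>0 < norm u\<close> by (simp only: norm_inverse) (simp add: field_simps)
    ultimately show "((\<lambda>k. c k * u powi k) has_sum Phi u ?\<omega>) UNIV" using c u by auto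
  qed (use R in auto)
  have eq: "phi_hat ?\<omega> = fc (\<lambda>u. Phi u ?\<omega>)" if "laurent_near_circle (\<lambda>u. Phi u ?\<omega>) c" for c
    unfolding phi_hat_def
    by (rule the_equality) (use that laurent_near_circle_fc in auto)
  obtain R S where RS: "1 < R" "\<alpha>p 0 * (R - 1) < 1" "1 < S" "\<alpha>m 0 * (S - 1) < 1"
    using exists_radius[OF pos(1), of 1] exists_radius[OF pos(2), of 1] by auto
  then obtain c where "\<forall>u. u \<noteq> 0 \<and> norm u < R \<and> norm (inverse u) < S \<longrightarrow>
      ((\<lambda>k. c k * u powi k) has_sum Phi u ?\<omega>) UNIV"
    using Phi_laurent_aux[OF \<omega>, of R S] by auto
  then show "phi_hat ?\<omega> = fc (\<lambda>u. Phi u ?\<omega>)" using eq laurent RS by blast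
  assume u: "u \<noteq> 0" "\<alpha>p 0 * (norm u - 1) < 1" "\<alpha>m 0 * (norm (inverse u) - 1) < 1"
  obtain R where R: "1 < R" "norm u < R" "\<alpha>p 0 * (R - 1) < 1"
    using exists_radius[OF pos(1) u(2)] by auto
  obtain S where S: "1 < S" "norm (inverse u) < S" "\<alpha>m 0 * (S - 1) < 1"
    using exists_radius[OF pos(2) u(3)] by auto
  obtain c where c: "\<forall>u. u \<noteq> 0 \<and> norm u < R \<and> norm (inverse u) < S \<longrightarrow>
      ((\<lambda>k. c k * u powi k) has_sum Phi u ?\<omega>) UNIV"
    using Phi_laurent_aux[OF \<omega> R(1,3) S(1,3)] by auto
  have "c = phi_hat ?\<omega>"
    using laurent[OF R(1) S(1) c] laurent_near_circle_fc eq by metis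
  then show "((\<lambda>k. phi_hat ?\<omega> k * u powi k) has_sum Phi u ?\<omega>) UNIV"
    using c u R S by auto
qed

lemma phi_hat_eq_fc: "\<omega> \<in> Omega \<Longrightarrow> phi_hat \<omega> = fc (\<lambda>u. Phi u \<omega>)"
  using phi_hat_has_sum(1) by (cases \<omega>) auto

section \<open>Total positivity of the coefficients\<close>

lemma tp_function_ab_products:
  assumes F: "tp_function F" and ab: "ab_seqs \<alpha> \<beta>" and le: "\<And>i. \<beta> i \<le> 1"
  shows "tp_function (\<lambda>u. F u * (\<Prod>i<n. ab_factor \<alpha> \<beta> u i))"
proof (induction n)
  case (Suc n)
  have "0 \<le> \<alpha> n" "0 \<le> \<beta> n" using ab by (auto simp: ab_seqs_def)
  from tp_function_geometric[OF tp_function_bernoulli[OF Suc this(2) le] this(1)]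
  show ?case by (simp add: ab_factor_def mult_ac)
qed (use F in simp)

lemma prodinf_lessThan_LIMSEQ: "convergent_prod f \<Longrightarrow> (\<lambda>n. \<Prod>i<n. f i) \<longlonglongrightarrow> prodinf f"
  for f :: "nat \<Rightarrow> complex"
  using convergent_prod_LIMSEQ LIMSEQ_lessThan_iff_atMost by blast

lemma Phi_tp_approximation:
  assumes "\<omega> \<in> Omega"
  shows "\<exists>H. (\<forall>n. tp_function (H n)) \<and> (\<forall>u. norm u = 1 \<longrightarrow> (\<lambda>n. H n u) \<longlonglongrightarrow> Phi u \<omega>)"
proof -
  obtain \<alpha>p \<beta>p \<alpha>m \<beta>m \<delta>p \<delta>m where \<omega>: "\<omega> = (\<alpha>p, \<beta>p, \<alpha>m, \<beta>m, \<delta>p, \<delta>m)" by (cases \<omega>)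
  note ab = Omega_ab[OF assms[unfolded \<omega>]]
  \<comment> \<open>The closure properties append factors in \<open>u\<close> only. So the minus
    half is built first as a function of \<open>u\<close>, then reflected, and the plus half is
    appended.\<close>
  define G where "G n u = 1 * exp (of_real (gap \<delta>m \<alpha>m \<beta>m) * (u - 1)) * (\<Prod>i<n. ab_factor \<alpha>m \<beta>m u i)" for n u
  define H where "H n u = G n (inverse u) * exp (of_real (gap \<delta>p \<alpha>p \<beta>p) * (u - 1)) * (\<Prod>i<n. ab_factor \<alpha>p \<beta>p u i)" for n u
  have "tp_function (G n)" for n
    unfolding G_def by (intro tp_function_ab_products tp_function_exp tp_function_one ab)
  then have "tp_function (H n)" for n
    unfolding H_def by (intro tp_function_ab_products tp_function_exp tp_function_reflect ab)
  moreover have "(\<lambda>n. H n u) \<longlonglongrightarrow> Phi u \<omega>" if "norm u = 1" for u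
  proof -
    have cp: "convergent_prod (ab_factor \<alpha>p \<beta>p u)" and cm: "convergent_prod (ab_factor \<alpha>m \<beta>m (inverse u))"
      using that by (auto intro!: ab_product_converges ab simp: norm_inverse)
    have "Phi u \<omega> = Psi \<delta>p \<alpha>p \<beta>p u * Psi \<delta>m \<alpha>m \<beta>m (inverse u)"
      unfolding \<omega> using that by (intro Phi_eq_Psi ab) (auto simp: norm_inverse)
    also have "\<dots> = 1 * exp (of_real (gap \<delta>m \<alpha>m \<beta>m) * (inverse u - 1)) * prodinf (ab_factor \<alpha>m \<beta>m (inverse u)) *
        exp (of_real (gap \<delta>p \<alpha>p \<beta>p) * (u - 1)) * prodinf (ab_factor \<alpha>p \<beta>p u)"
      by (simp add: Psi_def mult_ac)
    finally show ?thesis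
      unfolding H_def G_def
      using prodinf_lessThan_LIMSEQ[OF cp] prodinf_lessThan_LIMSEQ[OF cm]
      by (auto intro!: tendsto_intros)
  qed
  ultimately show ?thesis by blast
qed

theorem phi_hat_totally_positive:
  assumes "\<omega> \<in> Omega"
  shows "\<exists>p. totally_positive p \<and> (\<forall>n. phi_hat \<omega> n = of_real (p n))"
proof -
  obtain H where H: "\<And>n. tp_function (H n)" "\<And>u. norm u = 1 \<Longrightarrow> (\<lambda>n. H n u) \<longlonglongrightarrow> Phi u \<omega>"
    using Phi_tp_approximation assms by blast
  show ?thesis
    using tp_coefficients_limit[of H, OF H] by (simp add: phi_hat_eq_fc[OF assms])
qed

lemma norm_Phi_le:
  assumes "\<omega> \<in> Omega" "norm u = 1"
  shows "norm (Phi u \<omega>) \<le> 1"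
proof -
  obtain H where H: "\<And>n. tp_function (H n)" "\<And>u. norm u = 1 \<Longrightarrow> (\<lambda>n. H n u) \<longlonglongrightarrow> Phi u \<omega>"
    using Phi_tp_approximation assms by blast
  show ?thesis by (rule norm_tp_limit_le[of H, OF H assms(2)])
qed

lemma Phi_one: "Phi 1 \<omega> = 1"
  by (cases \<omega>) (simp add: Phi_def Let_def)

section \<open>Dimension-weighted sums of minors\<close>

lemma has_sum_finite_sum:
  fixes f :: "'a \<Rightarrow> 'b \<Rightarrow> 'c :: topological_comm_monoid_add"
  assumes "finite A" "\<And>a. a \<in> A \<Longrightarrow> (f a has_sum s a) X"
  shows "((\<lambda>x. \<Sum>a\<in>A. f a x) has_sum (\<Sum>a\<in>A. s a)) X"
  using assms by (induction A rule: finite_induct) (auto intro: has_sum_add)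

lemma jacobi_trudi_det_fdet:
  assumes "length l = N"
  shows "jacobi_trudi_det f l = fdet N (\<lambda>i j. f (l ! i - int i + int j))"
  unfolding jacobi_trudi_det_def fdet_def assms ..

text \<open>Strictly decreasing for a signature; the Jacobi-Trudi determinant is the Toeplitz minor
  with rows \<open>shifted l\<close> and columns \<open>0, -1, -2, ...\<close>.\<close>

definition shifted :: "int list \<Rightarrow> nat \<Rightarrow> int" where
  "shifted l i = l ! i - int i"

lemma sigs_antimono:
  assumes "l \<in> sigs N" "i \<le> j" "j < N"
  shows "l ! j \<le> l ! i"
  using assms by (cases "i = j") (auto simp: sigs_def sorted_wrt_iff_nth_less)

lemma sdec_shifted: "l \<in> sigs N \<Longrightarrow> sdec N (shifted l)"
  unfolding sdec_def shifted_def using sigs_antimono[of l N] by (auto intro!: diff_strict_left_mono order.strict_trans2[of "l ! j - int j" "l ! j - int i" "l ! i - int i" for i j] diff_right_mono)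

lemma sdec_uminus: "sdec N (\<lambda>j. - int j)"
  by (simp add: sdec_def)

lemma jacobi_trudi_det_nonneg:
  assumes "totally_positive p" "l \<in> sigs N"
  shows "0 \<le> jacobi_trudi_det p l"
proof -
  have "length l = N" using assms by (simp add: sigs_def)
  then show ?thesis
    using totally_positiveD[OF assms(1) sdec_shifted[OF assms(2)] sdec_uminus]
    by (simp add: jacobi_trudi_det_fdet shifted_def)
qed

lemma Dim_pos:
  assumes "l \<in> sigs N"
  shows "0 < Dim l"
  unfolding Dim_def
proof (intro prod_pos ballI divide_pos_pos)
  fix j i assume "j \<in> {..<length l}" "i \<in> {..<j}"
  then have ij: "i < j" "j < N" using assms by (auto simp: sigs_def)
  then have "shifted l j < shifted l i" using sdec_shifted[OF assms] by (auto simp: sdec_def)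
  then have "real_of_int (shifted l j) < real_of_int (shifted l i)" by simp
  then show "0 < real_of_int (l ! i) - real_of_int (l ! j) - real i + real j"
    by (simp add: shifted_def)
  show "0 < real j - real i" using ij by simp
qed

text \<open>The Vandermonde product with the sign that makes it positive on decreasing sequences.
  \<open>Dim l\<close> is its value at \<open>shifted l\<close> divided by its value at
  \<open>0, -1, -2, ...\<close>.\<close>

definition diff_product :: "nat \<Rightarrow> (nat \<Rightarrow> int) \<Rightarrow> real" where
  "diff_product N x = (\<Prod>j<N. \<Prod>i<j. real_of_int (x i) - real_of_int (x j))"

lemma diff_product_pos: "sdec N x \<Longrightarrow> 0 < diff_product N x"
  unfolding diff_product_def by (intro prod_pos ballI) (auto simp: sdec_def)

lemma Dim_diff_product:
  assumes "length l = N"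
  shows "Dim l * diff_product N (\<lambda>j. - int j) = diff_product N (shifted l)"
proof -
  have "Dim l * diff_product N (\<lambda>j. - int j) =
      (\<Prod>j<N. \<Prod>i<j. (real_of_int (l ! i) - real_of_int (l ! j) - real i + real j) / (real j - real i) *
         (real j - real i))"
    unfolding Dim_def diff_product_def assms by (simp add: prod.distrib[symmetric])
  also have "\<dots> = diff_product N (shifted l)"
    unfolding diff_product_def shifted_def by (intro prod.cong refl) auto
  finally show ?thesis .
qed

lemma vandermonde_uminus:
  "fdet N (\<lambda>i j. (- real_of_int (x j)) ^ i) = diff_product N x"
proof -
  have "fdet N (\<lambda>i j. (- real_of_int (x j)) ^ i) = fdet N (\<lambda>i j. (- real_of_int (x i)) ^ j)"
    by (rule fdet_transpose[symmetric])
  also have "\<dots> = diff_product N x"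
    unfolding vandermonde_det diff_product_def by simp
  finally show ?thesis .
qed

text \<open>Cauchy-Binet for the matrices \<open>A i y = (- y) ^ i\<close> and
  \<open>C y j = p (y + j)\<close>: the subset \<open>shifted l\<close> contributes
  \<open>?V * Dim l * jacobi_trudi_det p l\<close>, and every subset contributes a nonnegative
  amount. The entries of the product, \<open>\<Sum>n. (j - n) ^ i * p n\<close>, are polynomials in
  \<open>j\<close> of degree \<open>i\<close> with leading coefficient \<open>\<mu> 0 = 1\<close>,
  so its determinant is \<open>?V\<close> again. With \<open>y\<close> truncated to boxes the
  determinants tend to \<open>?V\<close>, and any finite family of signatures is eventually covered
  by the box.\<close>

theorem sum_Dim_jacobi_trudi_le_one:
  fixes p :: "int \<Rightarrow> real"
  assumes tp: "totally_positive p" and one: "(p has_sum 1) UNIV"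
    and moments: "\<And>s. (\<lambda>n. p n * (- real_of_int n) ^ s) summable_on UNIV"
    and F: "finite F" "F \<subseteq> sigs N"
  shows "(\<Sum>l\<in>F. Dim l * jacobi_trudi_det p l) \<le> 1"
proof -
  define \<mu> where "\<mu> s = infsum (\<lambda>n. p n * (- real_of_int n) ^ s) UNIV" for s
  have \<mu>0: "\<mu> 0 = 1" using infsumI[OF one] by (simp add: \<mu>_def)
  \<comment> \<open>The binomial theorem for \<open>(j - n) ^ i\<close> factors the limit matrix
    into \<open>L\<close> and \<open>K\<close>; \<open>L\<close> is lower triangular with diagonal
    \<open>\<mu> 0\<close>.\<close>
  define L where "L i r = (if r \<le> i then of_nat (i choose r) * \<mu> (i - r) else 0)" for i r
  define K where "K r j = real j ^ r" for r j :: nat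
  let ?V = "diff_product N (\<lambda>j. - int j)"
  define A where "A i y = (- real_of_int y) ^ i" for i :: nat and y
  define C where "C y j = p (y + int j)" for y and j :: nat
  have entry: "((\<lambda>y. A i y * C y j) has_sum (\<Sum>r<N. L i r * K r j)) UNIV" if i: "i < N" for i j
  proof -
    have "((\<lambda>n. \<Sum>r\<le>i. (of_nat (i choose r) * real j ^ r) * (p n * (- real_of_int n) ^ (i - r))) has_sum
        (\<Sum>r\<le>i. (of_nat (i choose r) * real j ^ r) * \<mu> (i - r))) UNIV"
      unfolding \<mu>_def by (intro has_sum_finite_sum has_sum_cmult_right has_sum_infsum moments) auto
    also have "(\<lambda>n. \<Sum>r\<le>i. (of_nat (i choose r) * real j ^ r) * (p n * (- real_of_int n) ^ (i - r)))
        = (\<lambda>n. (real j - real_of_int n) ^ i * p n)"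
    proof
      fix n
      have "(real j + - real_of_int n) ^ i = (\<Sum>r\<le>i. of_nat (i choose r) * real j ^ r * (- real_of_int n) ^ (i - r))"
        by (rule binomial_ring)
      then show "(\<Sum>r\<le>i. (of_nat (i choose r) * real j ^ r) * (p n * (- real_of_int n) ^ (i - r)))
        = (real j - real_of_int n) ^ i * p n"
        by (simp add: sum_distrib_left sum_distrib_right mult_ac)
    qed
    also have "((\<lambda>n. (real j - real_of_int n) ^ i * p n) has_sum (\<Sum>r\<le>i. (of_nat (i choose r) * real j ^ r) * \<mu> (i - r))) UNIV
      \<longleftrightarrow> ((\<lambda>y. A i y * C y j) has_sum (\<Sum>r<N. L i r * K r j)) UNIV"
    proof (rule has_sum_reindex_bij_witness[where i = "\<lambda>y. y + int j" and j = "\<lambda>n. n - int j"])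
      have "(\<Sum>r\<le>i. (of_nat (i choose r) * real j ^ r) * \<mu> (i - r)) = (\<Sum>r\<le>i. L i r * K r j)"
        by (intro sum.cong) (auto simp: L_def K_def mult_ac)
      also have "\<dots> = (\<Sum>r<N. L i r * K r j)"
        using i by (intro sum.mono_neutral_left) (auto simp: L_def)
      finally show "(\<Sum>r\<le>i. (of_nat (i choose r) * real j ^ r) * \<mu> (i - r)) = (\<Sum>r<N. L i r * K r j)" .
    qed (auto simp: A_def C_def)
    finally show ?thesis .
  qed
  define S where "S B = fdet N (\<lambda>i j. \<Sum>y\<in>{- int B..int B}. A i y * C y j)" for B
  have "S \<longlonglongrightarrow> fdet N (\<lambda>i j. \<Sum>r<N. L i r * K r j)"
    unfolding S_def
  proof (rule tendsto_fdet)
    fix i j assume "i < N"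
    then show "(\<lambda>B. \<Sum>y\<in>{- int B..int B}. A i y * C y j) \<longlonglongrightarrow> (\<Sum>r<N. L i r * K r j)"
      using filterlim_compose[OF entry[of i j, unfolded has_sum_def] filterlim_int_box] by simp
  qed
  also have "fdet N (\<lambda>i j. \<Sum>r<N. L i r * K r j) = fdet N L * fdet N K"
    by (rule fdet_mult[symmetric])
  also have "fdet N L = 1"
  proof -
    have "fdet N L = fdet N (\<lambda>i j. L j i)" by (rule fdet_transpose[symmetric])
    also have "\<dots> = (\<Prod>i<N. L i i)" by (rule fdet_triangular) (simp add: L_def)
    finally show ?thesis by (simp add: L_def \<mu>0)
  qed
  also have "fdet N K = ?V"
    using vandermonde_uminus[of N "\<lambda>j. - int j"] by (simp add: K_def[abs_def])
  finally have lim: "S \<longlonglongrightarrow> ?V" by simp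
  let ?X = "\<lambda>l. shifted l ` {0..<N}"
  have len: "length l = N" if "l \<in> F" for l using that F by (auto simp: sigs_def)
  have enum: "card (?X l) = N" "\<And>i. i < N \<Longrightarrow> dec_enum (?X l) i = shifted l i" if "l \<in> F" for l
    using dec_enum_image[of N "shifted l"] sdec_shifted[of l N] that F by (auto simp: sdec_def)
  have inj: "inj_on ?X F"
  proof (rule inj_onI)
    fix l l' assume l: "l \<in> F" "l' \<in> F" "?X l = ?X l'"
    have "l ! i = l' ! i" if "i < N" for i
      using enum(2)[OF l(1) that] enum(2)[OF l(2) that] l(3) by (simp add: shifted_def)
    then show "l = l'" using len l by (intro nth_equalityI) auto
  qed
  define W where "W Y = fdet N (\<lambda>i j. A i (dec_enum Y j)) * fdet N (\<lambda>i j. C (dec_enum Y i) j)" for Y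
  have W_nonneg: "0 \<le> W Y" if "finite Y" "card Y = N" for Y
  proof -
    have dec: "sdec N (dec_enum Y)"
      unfolding sdec_def
    proof (intro allI impI)
      fix i j assume ij: "i < j" "j < N"
      have "sorted_wrt (>) (rev (sorted_list_of_set Y))" by (simp add: sorted_wrt_rev)
      then show "dec_enum Y j < dec_enum Y i"
        using that ij by (auto simp: dec_enum_def sorted_wrt_iff_nth_less)
    qed
    have "fdet N (\<lambda>i j. C (dec_enum Y i) j) = fdet N (\<lambda>i j. p (dec_enum Y i - - int j))"
      by (simp add: C_def)
    also have "\<dots> \<ge> 0" by (rule totally_positiveD[OF tp dec sdec_uminus])
    finally have "0 \<le> fdet N (\<lambda>i j. C (dec_enum Y i) j)" .
    then show ?thesis
      unfolding W_def A_def vandermonde_uminus using diff_product_pos[OF dec] by simp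
  qed
  have W_eq: "W (?X l) = ?V * (Dim l * jacobi_trudi_det p l)" if l: "l \<in> F" for l
  proof -
    have "fdet N (\<lambda>i j. C (dec_enum (?X l) i) j) = jacobi_trudi_det p l"
      unfolding jacobi_trudi_det_fdet[OF len[OF l]]
      by (rule fdet_cong) (simp only: enum(2)[OF l] C_def, simp only: shifted_def)
    moreover have "fdet N (\<lambda>i j. A i (dec_enum (?X l) j)) = diff_product N (shifted l)"
      unfolding vandermonde_uminus[symmetric] by (rule fdet_cong) (simp add: enum[OF l] A_def)
    ultimately show ?thesis
      using Dim_diff_product[OF len[OF l]] by (simp add: W_def mult_ac)
  qed
  \<comment> \<open>A crude common bound for all entries of all \<open>shifted l\<close> with
    \<open>l \<in> F\<close>.\<close>
  define B where "B = (\<Sum>l\<in>F. \<Sum>i<N. nat \<bar>shifted l i\<bar>)"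
  have le: "?V * (\<Sum>l\<in>F. Dim l * jacobi_trudi_det p l) \<le> S b" if b: "B \<le> b" for b
  proof -
    have "?X l \<subseteq> {- int b..int b}" if l: "l \<in> F" for l
    proof
      fix y assume "y \<in> ?X l"
      then obtain i where i: "i < N" "y = shifted l i" by auto
      have "nat \<bar>shifted l i\<bar> \<le> (\<Sum>i<N. nat \<bar>shifted l i\<bar>)"
        using i by (intro member_le_sum) auto
      also have "\<dots> \<le> B" unfolding B_def by (rule member_le_sum[OF l]) (use F in auto)
      finally show "y \<in> {- int b..int b}" using b i by auto
    qed
    then have sub: "?X ` F \<subseteq> {Y. Y \<subseteq> {- int b..int b} \<and> card Y = N}"
      using enum(1) by auto
    have "?V * (\<Sum>l\<in>F. Dim l * jacobi_trudi_det p l) = (\<Sum>l\<in>F. W (?X l))"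
      by (simp add: W_eq sum_distrib_left)
    also have "\<dots> = sum W (?X ` F)" by (simp add: sum.reindex[OF inj])
    also have "\<dots> \<le> sum W {Y. Y \<subseteq> {- int b..int b} \<and> card Y = N}"
    proof (rule sum_mono2[OF _ sub])
      show "finite {Y. Y \<subseteq> {- int b..int b} \<and> card Y = N}" by simp
      show "0 \<le> W Y" if "Y \<in> {Y. Y \<subseteq> {- int b..int b} \<and> card Y = N} - ?X ` F" for Y
        using that finite_subset[of Y "{- int b..int b}"] by (intro W_nonneg) auto
    qed
    also have "\<dots> = S b" unfolding S_def W_def by (rule cauchy_binet[symmetric]) simp
    finally show ?thesis .
  qed
  have "?V * (\<Sum>l\<in>F. Dim l * jacobi_trudi_det p l) \<le> ?V"
    by (rule LIMSEQ_le_const[OF lim]) (use le in blast)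
  then show ?thesis using diff_product_pos[OF sdec_uminus, of N] by simp
qed

lemma power_le_exp_abs:
  fixes x s :: real
  assumes "0 < s"
  shows "\<bar>x\<bar> ^ n \<le> (real n / s) ^ n * (exp (s * x) + exp (- s * x))"
proof -
  have "\<bar>x\<bar> ^ n \<le> (real n / s) ^ n * exp (s * \<bar>x\<bar>)"
  proof (cases "n = 0")
    case True
    then show ?thesis using assms by simp
  next
    case False
    have "\<bar>x\<bar> ^ n = (real n / s) ^ n * (s * \<bar>x\<bar> / real n) ^ n"
      using False assms by (simp add: power_mult_distrib[symmetric])
    also have "(s * \<bar>x\<bar> / real n) ^ n \<le> (1 + s * \<bar>x\<bar> / real n) ^ n"
      using assms by (intro power_mono) auto
    also have "\<dots> \<le> exp (s * \<bar>x\<bar>)"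
    proof (rule exp_ge_one_plus_x_over_n_power_n)
      have "0 \<le> s * \<bar>x\<bar>" using assms by simp
      then show "- real n \<le> s * \<bar>x\<bar>" by linarith
    qed (use False in simp)
    finally show ?thesis using assms by (simp add: mult_left_mono)
  qed
  also have "exp (s * \<bar>x\<bar>) \<le> exp (s * x) + exp (- s * x)"
    by (cases "x \<ge> 0") auto
  finally show ?thesis using assms by (simp add: mult_left_mono)
qed

lemma phi_hat_real_has_sum:
  assumes \<omega>: "(\<alpha>p, \<beta>p, \<alpha>m, \<beta>m, \<delta>p, \<delta>m) \<in> Omega" (is "?\<omega> \<in> _")
    and p: "\<And>n. phi_hat (\<alpha>p, \<beta>p, \<alpha>m, \<beta>m, \<delta>p, \<delta>m) n = of_real (p n)"
    and x: "0 < x" "\<alpha>p 0 * (x - 1) < 1" "\<alpha>m 0 * (inverse x - 1) < 1"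
  shows "((\<lambda>k. p k * x powi k) has_sum Re (Phi (of_real x) ?\<omega>)) UNIV"
proof -
  have "((\<lambda>k. phi_hat ?\<omega> k * of_real x powi k) has_sum Phi (of_real x) ?\<omega>) UNIV"
    by (rule phi_hat_has_sum(2)[OF \<omega>]) (use x in \<open>auto simp: norm_inverse\<close>)
  from has_sum_Re[OF this] show ?thesis
    by (simp add: p of_real_power_int[symmetric] del: of_real_power_int)
qed

text \<open>Some \<open>x > 1\<close> lies in the annulus of convergence together with its inverse,
  so the distribution has exponential moments on both sides, and these dominate every power.\<close>

lemma phi_hat_moments:
  assumes "\<omega> \<in> Omega" and p: "\<And>n. phi_hat \<omega> n = of_real (p n)" "totally_positive p"
  shows "(\<lambda>n. p n * (- real_of_int n) ^ j) summable_on UNIV"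
proof -
  obtain \<alpha>p \<beta>p \<alpha>m \<beta>m \<delta>p \<delta>m where \<omega>: "\<omega> = (\<alpha>p, \<beta>p, \<alpha>m, \<beta>m, \<delta>p, \<delta>m)" by (cases \<omega>)
  note \<omega>' = assms(1)[unfolded \<omega>] and p' = p(1)[unfolded \<omega>]
  have pos: "0 \<le> \<alpha>p 0" "0 \<le> \<alpha>m 0" using Omega_ab[OF \<omega>'] by (auto simp: ab_seqs_def)
  obtain R S where RS: "1 < R" "\<alpha>p 0 * (R - 1) < 1" "1 < S" "\<alpha>m 0 * (S - 1) < 1"
    using exists_radius[OF pos(1), of 1] exists_radius[OF pos(2), of 1] by auto
  define x where "x = min R S"
  have x: "1 < x" "\<alpha>p 0 * (x - 1) < 1" "\<alpha>m 0 * (x - 1) < 1"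
    using RS pos mult_left_mono[of "x - 1" "R - 1" "\<alpha>p 0"] mult_left_mono[of "x - 1" "S - 1" "\<alpha>m 0"]
    by (auto simp: x_def)
  define s where "s = ln x"
  have s: "0 < s" "exp s = x" using x by (auto simp: s_def)
  have neg: "a * (inverse x - 1) < 1" if "0 \<le> a" for a
    using that x mult_nonneg_nonpos[of a "inverse x - 1"] by (simp add: inverse_le_1_iff)
  have "(\<lambda>k. p k * x powi k) summable_on UNIV" "(\<lambda>k. p k * inverse x powi k) summable_on UNIV"
    using phi_hat_real_has_sum[OF \<omega>' p', of x] phi_hat_real_has_sum[OF \<omega>' p', of "inverse x"] x pos neg
    by (auto intro: has_sum_imp_summable)
  then have "(\<lambda>k. (real j / s) ^ j * (p k * x powi k + p k * inverse x powi k)) summable_on UNIV"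
    by (intro summable_on_cmult_right summable_on_add)
  moreover have "p k * \<bar>real_of_int k\<bar> ^ j \<le> (real j / s) ^ j * (p k * x powi k + p k * inverse x powi k)" for k
  proof -
    have "x powi k = exp (s * real_of_int k)"
      using exp_power_int[of s k] s by (simp add: mult.commute)
    moreover have "inverse x powi k = exp (- s * real_of_int k)"
      using exp_power_int[of "- s" k] s by (simp add: mult.commute exp_minus)
    ultimately show ?thesis
      using mult_left_mono[OF power_le_exp_abs[OF s(1), of "real_of_int k" j] totally_positive_nonneg[OF p(2), of k]]
      by (simp add: algebra_simps)
  qed
  ultimately have "(\<lambda>k. p k * \<bar>real_of_int k\<bar> ^ j) summable_on UNIV"
    by (rule summable_on_comparison_test) (use totally_positive_nonneg[OF p(2)] in auto)
  then have "(\<lambda>k. norm (p k * (- real_of_int k) ^ j)) summable_on UNIV"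
    using totally_positive_nonneg[OF p(2)] by (simp add: abs_mult power_abs)
  then show ?thesis by (rule abs_summable_summable)
qed

theorem sigma_hat_nonneg_and_sum_le_one:
  assumes "\<omega> \<in> Omega"
  shows "l \<in> sigs N \<Longrightarrow> sigma_hat l \<omega> = of_real (norm (sigma_hat l \<omega>))"
    and "finite F \<Longrightarrow> F \<subseteq> sigs N \<Longrightarrow> (\<Sum>l\<in>F. Dim l * norm (sigma_hat l \<omega>)) \<le> 1"
proof -
  obtain p where p: "totally_positive p" "\<And>n. phi_hat \<omega> n = of_real (p n)"
    using phi_hat_totally_positive[OF assms] by blast
  have eq: "sigma_hat l \<omega> = of_real (jacobi_trudi_det p l)" for l
  proof -
    have "sigma_hat l \<omega> = fdet (length l) (\<lambda>i j. complex_of_real (p (l ! i - int i + int j)))"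
      unfolding sigma_hat_def jacobi_trudi_det_fdet[OF refl] p ..
    also have "\<dots> = of_real (fdet (length l) (\<lambda>i j. p (l ! i - int i + int j)))"
      by (rule fdet_hom) (unfold_locales, auto)
    finally show ?thesis by (simp add: jacobi_trudi_det_fdet)
  qed
  have eq': "norm (sigma_hat l \<omega>) = jacobi_trudi_det p l" if "l \<in> sigs N" for l
    using jacobi_trudi_det_nonneg[OF p(1) that] unfolding eq by simp
  then show "l \<in> sigs N \<Longrightarrow> sigma_hat l \<omega> = of_real (norm (sigma_hat l \<omega>))"
    using eq by simp
  assume F: "finite F" "F \<subseteq> sigs N"
  obtain \<alpha>p \<beta>p \<alpha>m \<beta>m \<delta>p \<delta>m where \<omega>: "\<omega> = (\<alpha>p, \<beta>p, \<alpha>m, \<beta>m, \<delta>p, \<delta>m)" by (cases \<omega>)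
  have "(p has_sum 1) UNIV"
    using phi_hat_real_has_sum[of \<alpha>p \<beta>p \<alpha>m \<beta>m \<delta>p \<delta>m p 1] assms p(2) Phi_one
    unfolding \<omega> by simp
  then have "(\<Sum>l\<in>F. Dim l * jacobi_trudi_det p l) \<le> 1"
    by (intro sum_Dim_jacobi_trudi_le_one[OF p(1) _ phi_hat_moments[OF assms p(2,1)] F])
  also have "(\<Sum>l\<in>F. Dim l * jacobi_trudi_det p l) = (\<Sum>l\<in>F. Dim l * norm (sigma_hat l \<omega>))"
    using F eq' by (intro sum.cong) auto
  finally show "(\<Sum>l\<in>F. Dim l * norm (sigma_hat l \<omega>)) \<le> 1" .
qed

section \<open>Compact subsets of the parameter space\<close>

text \<open>The compact sets that witness vanishing at infinity: bounding the two
  \<open>\<delta>\<close> bounds every other coordinate.\<close>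

definition Omega_le :: "real \<Rightarrow> point set" where
  "Omega_le C = {(\<alpha>p, \<beta>p, \<alpha>m, \<beta>m, \<delta>p, \<delta>m) \<in> Omega. \<delta>p \<le> C \<and> \<delta>m \<le> C}"

lemma compact_box_functions: "compact {f :: nat \<Rightarrow> real. \<forall>i. 0 \<le> f i \<and> f i \<le> C}"
proof -
  have "compactin (product_topology (\<lambda>i. euclidean) UNIV) (PiE UNIV (\<lambda>i::nat. {0..C}))"
    unfolding compactin_PiE by (auto simp: compactin_euclidean_iff)
  then have "compact (PiE UNIV (\<lambda>i::nat. {0..C}))"
    by (simp add: euclidean_product_topology compactin_euclidean_iff)
  also have "PiE UNIV (\<lambda>i::nat. {0..C}) = {f. \<forall>i. 0 \<le> f i \<and> f i \<le> C}"
    by (auto simp: PiE_def Pi_def)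
  finally show ?thesis .
qed

lemma summable_suminf_le_iff:
  fixes f :: "nat \<Rightarrow> real"
  assumes "\<And>i. 0 \<le> f i"
  shows "(summable f \<and> suminf f \<le> d) \<longleftrightarrow> (\<forall>n. (\<Sum>i<n. f i) \<le> d)"
proof
  assume "summable f \<and> suminf f \<le> d"
  then show "\<forall>n. (\<Sum>i<n. f i) \<le> d"
    using sum_le_suminf[of f] assms by (meson finite_lessThan order_trans)
next
  assume *: "\<forall>n. (\<Sum>i<n. f i) \<le> d"
  then have "summable f" using assms by (intro summableI_nonneg_bounded) auto
  then show "summable f \<and> suminf f \<le> d" using * suminf_le_const by blast
qed

text \<open>For a decreasing sequence, \<open>i + 1\<close> times the entry \<open>i\<close> is at
  most the sum of the first \<open>i + 1\<close> entries. The resulting decay is uniform in the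
  point once \<open>\<delta>\<close> is bounded, and its square is summable.\<close>

lemma ab_sequence_le:
  assumes ab: "ab_seqs \<alpha> \<beta>" and le: "0 \<le> gap \<delta> \<alpha> \<beta>"
  shows "\<alpha> i \<le> \<delta> / (real i + 1)" "\<beta> i \<le> \<delta> / (real i + 1)"
proof -
  have pos: "0 \<le> \<alpha> i" "0 \<le> \<beta> i" for i using ab by (auto simp: ab_seqs_def)
  have "(\<Sum>j<n. \<alpha> j + \<beta> j) \<le> \<delta>" for n
    using summable_suminf_le_iff[of "\<lambda>j. \<alpha> j + \<beta> j" \<delta>] ab le pos
    by (auto simp: ab_seqs_def gap_def)
  note sum = this[of "Suc i"]
  have *: "x i \<le> \<delta> / (real i + 1)" if x: "decseq x" "\<And>j. x j \<le> \<alpha> j + \<beta> j" for x :: "nat \<Rightarrow> real"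
  proof -
    have "real (Suc i) * x i = (\<Sum>j<Suc i. x i)" by simp
    also have "\<dots> \<le> (\<Sum>j<Suc i. x j)" using x(1) by (intro sum_mono) (auto simp: decseq_def)
    also have "\<dots> \<le> (\<Sum>j<Suc i. \<alpha> j + \<beta> j)" by (intro sum_mono x(2))
    also note sum
    finally show ?thesis by (simp add: field_simps)
  qed
  show "\<alpha> i \<le> \<delta> / (real i + 1)" "\<beta> i \<le> \<delta> / (real i + 1)"
    using *[of \<alpha>] *[of \<beta>] ab pos by (auto simp: ab_seqs_def)
qed

text \<open>An infinite sum is not continuous in the product topology. For nonnegative terms,
  summability with sum at most \<open>\<delta>\<close> amounts to a bound on all partial sums, each
  a closed condition on finitely many coordinates.\<close>

lemma Omega_closed_form:
  "Omega = {\<omega>. (\<forall>i. fst \<omega> (Suc i) \<le> fst \<omega> i) \<and> (\<forall>i. fst (snd \<omega>) (Suc i) \<le> fst (snd \<omega>) i) \<and>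
     (\<forall>i. fst (snd (snd \<omega>)) (Suc i) \<le> fst (snd (snd \<omega>)) i) \<and>
     (\<forall>i. fst (snd (snd (snd \<omega>))) (Suc i) \<le> fst (snd (snd (snd \<omega>))) i) \<and>
     (\<forall>i. 0 \<le> fst \<omega> i) \<and> (\<forall>i. 0 \<le> fst (snd \<omega>) i) \<and>
     (\<forall>i. 0 \<le> fst (snd (snd \<omega>)) i) \<and> (\<forall>i. 0 \<le> fst (snd (snd (snd \<omega>))) i) \<and>
     0 \<le> fst (snd (snd (snd (snd \<omega>)))) \<and> 0 \<le> snd (snd (snd (snd (snd \<omega>)))) \<and>
     (\<forall>n. (\<Sum>i<n. fst \<omega> i + fst (snd \<omega>) i) \<le> fst (snd (snd (snd (snd \<omega>))))) \<and>
     (\<forall>n. (\<Sum>i<n. fst (snd (snd \<omega>)) i + fst (snd (snd (snd \<omega>))) i) \<le> snd (snd (snd (snd (snd \<omega>))))) \<and>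
     fst (snd \<omega>) 0 + fst (snd (snd (snd \<omega>))) 0 \<le> 1}" (is "_ = ?R")
proof (rule Set.set_eqI)
  fix \<omega> :: point
  obtain \<alpha>p \<beta>p \<alpha>m \<beta>m \<delta>p \<delta>m where \<omega>: "\<omega> = (\<alpha>p, \<beta>p, \<alpha>m, \<beta>m, \<delta>p, \<delta>m)" by (cases \<omega>)
  show "\<omega> \<in> Omega \<longleftrightarrow> \<omega> \<in> ?R"
  proof (cases "\<forall>i. 0 \<le> \<alpha>p i \<and> 0 \<le> \<beta>p i \<and> 0 \<le> \<alpha>m i \<and> 0 \<le> \<beta>m i")
    case True
    then have "(summable (\<lambda>i. \<alpha>p i + \<beta>p i) \<and> (\<Sum>i. \<alpha>p i + \<beta>p i) \<le> \<delta>p) = (\<forall>n. (\<Sum>i<n. \<alpha>p i + \<beta>p i) \<le> \<delta>p)"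
      "(summable (\<lambda>i. \<alpha>m i + \<beta>m i) \<and> (\<Sum>i. \<alpha>m i + \<beta>m i) \<le> \<delta>m) = (\<forall>n. (\<Sum>i<n. \<alpha>m i + \<beta>m i) \<le> \<delta>m)"
      by (intro summable_suminf_le_iff; simp)+
    then show ?thesis
      unfolding Omega_def \<omega> decseq_Suc_iff by auto
  qed (auto simp: Omega_def \<omega>)
qed

lemma closed_Omega: "closed Omega"
  unfolding Omega_closed_form
  by (intro closed_Collect_conj closed_Collect_all closed_Collect_le continuous_intros
        continuous_on_product_then_coordinatewise)

lemma Omega_le_subset: "Omega_le C \<subseteq> Omega"
  by (auto simp: Omega_le_def)

lemma compact_Omega_le: "compact (Omega_le C)"
proof -
  let ?B = "{f :: nat \<Rightarrow> real. \<forall>i. 0 \<le> f i \<and> f i \<le> C}"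
  let ?box = "?B \<times> ?B \<times> ?B \<times> ?B \<times> {0..C} \<times> {0..C}"
  have "compact ?box"
    by (intro compact_Times compact_box_functions) auto
  then have "compact (?box \<inter> Omega)"
    using closed_Omega by (rule compact_Int_closed)
  moreover have "Omega_le C = ?box \<inter> Omega"
  proof (rule Set.set_eqI)
    fix \<omega> :: point
    obtain \<alpha>p \<beta>p \<alpha>m \<beta>m \<delta>p \<delta>m where \<omega>: "\<omega> = (\<alpha>p, \<beta>p, \<alpha>m, \<beta>m, \<delta>p, \<delta>m)" by (cases \<omega>)
    have le: "0 \<le> \<alpha> i \<and> \<alpha> i \<le> C" "0 \<le> \<beta> i \<and> \<beta> i \<le> C"
      if "ab_seqs \<alpha> \<beta>" "0 \<le> gap \<delta> \<alpha> \<beta>" "0 \<le> \<delta>" "\<delta> \<le> C" for \<alpha> \<beta> \<delta> i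
    proof -
      have "\<delta> / (real i + 1) \<le> \<delta> / 1" using that by (intro divide_left_mono) auto
      then show "0 \<le> \<alpha> i \<and> \<alpha> i \<le> C" "0 \<le> \<beta> i \<and> \<beta> i \<le> C"
        using ab_sequence_le[OF that(1,2), of i] that by (auto simp: ab_seqs_def)
    qed
    show "\<omega> \<in> Omega_le C \<longleftrightarrow> \<omega> \<in> ?box \<inter> Omega"
    proof (cases "\<omega> \<in> Omega")
      case True
      note ab = Omega_ab[OF True[unfolded \<omega>]]
      have "\<omega> \<in> ?box" if "\<delta>p \<le> C" "\<delta>m \<le> C"
        using le[OF ab(1,3,10) that(1)] le[OF ab(2,4,11) that(2)] that ab unfolding \<omega> by simp
      then show ?thesis using True unfolding \<omega> Omega_le_def by auto
    qed (auto simp: Omega_le_def \<omega>)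
  qed
  ultimately show ?thesis by simp
qed

section \<open>Continuity of the coefficients\<close>

text \<open>The coordinates decay uniformly only like \<open>1 / (i + 1)\<close>, which is not
  summable. A factor \<open>g\<close> that is 1 up to second order has distance from 1 of order
  \<open>1 / (i + 1)\<^sup>2\<close>, and then the product converges uniformly on
  \<open>A\<close>.\<close>

lemma continuous_on_prodinf_coordinates:
  fixes a :: "'b :: topological_space \<Rightarrow> nat \<Rightarrow> real" and g :: "complex \<Rightarrow> complex"
  assumes A: "compact A" and cont: "\<And>i. continuous_on A (\<lambda>x. a x i)"
    and a: "\<And>x i. x \<in> A \<Longrightarrow> 0 \<le> a x i \<and> a x i \<le> C / (real i + 1)"
    and g: "continuous_on {z. Re z \<le> 0} g"
      "\<And>z. Re z \<le> 0 \<Longrightarrow> norm (g z - 1) \<le> exp (2 * norm z) * (norm z)\<^sup>2"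
    and t: "Re t \<le> 0"
  shows "continuous_on A (\<lambda>x. \<Prod>i. g (of_real (a x i) * t))"
    and "x \<in> A \<Longrightarrow> convergent_prod (\<lambda>i. g (of_real (a x i) * t))"
proof -
  define M where "M i = exp (2 * (C * norm t)) * (C * norm t)\<^sup>2 * (1 / (real i + 1)\<^sup>2)" for i :: nat
  have Re: "Re (of_real (a x i) * t) \<le> 0" if "x \<in> A" for x i
    using a[OF that, of i] t by (simp add: mult_nonneg_nonpos)
  have bound: "norm (g (of_real (a x i) * t) - 1) \<le> M i" if x: "x \<in> A" for x i
  proof -
    have C: "0 \<le> C" using a[OF x, of 0] by simp
    have n: "norm (of_real (a x i) * t) = a x i * norm t" using a[OF x, of i] by (simp add: norm_mult)
    have le: "a x i * norm t \<le> (C * norm t) / (real i + 1)"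
      using mult_right_mono[of "a x i" "C / (real i + 1)" "norm t"] a[OF x, of i] by (simp add: add.commute)
    also have "\<dots> \<le> (C * norm t) / 1"
      using C by (intro divide_left_mono) auto
    finally have le': "a x i * norm t \<le> C * norm t" by simp
    have "norm (g (of_real (a x i) * t) - 1) \<le> exp (2 * (a x i * norm t)) * (a x i * norm t)\<^sup>2"
      using g(2)[OF Re[OF x, of i]] by (simp only: n)
    also have "\<dots> \<le> exp (2 * (C * norm t)) * ((C * norm t) / (real i + 1))\<^sup>2"
      using le le' a[OF x, of i] by (intro mult_mono power_mono) auto
    also have "\<dots> = M i" by (simp add: M_def power_divide)
    finally show ?thesis .
  qed
  have "summable (\<lambda>i. 1 / (real i + 1)\<^sup>2)"
    using inverse_squares_sums by (auto simp: sums_iff add.commute)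
  then have M: "summable M" unfolding M_def by (rule summable_mult)
  have conv: "convergent_prod (\<lambda>i. g (of_real (a x i) * t))" if x: "x \<in> A" for x
    by (intro abs_convergent_prod_imp_convergent_prod summable_imp_abs_convergent_prod
          summable_comparison_test'[OF M, of 0]) (use bound[OF x] in simp)
  then show "x \<in> A \<Longrightarrow> convergent_prod (\<lambda>i. g (of_real (a x i) * t))" .
  have cont': "continuous_on A (\<lambda>x. g (of_real (a x i) * t))" for i
    by (intro continuous_on_compose2[OF g(1)] continuous_intros cont) (use Re in auto)
  have "uniformly_convergent_on A (\<lambda>N x. \<Prod>n<N. g (of_real (a x n) * t))"
    by (intro uniformly_convergent_on_prod' cont' A Weierstrass_m_test'[OF _ M]) (use bound in simp)
  then obtain h where h: "uniform_limit A (\<lambda>N x. \<Prod>n<N. g (of_real (a x n) * t)) h sequentially"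
    by (auto simp: uniformly_convergent_on_def)
  have "continuous_on A h"
    by (rule uniform_limit_theorem[OF _ h]) (auto intro!: always_eventually continuous_on_prod cont')
  moreover have "h x = (\<Prod>i. g (of_real (a x i) * t))" if x: "x \<in> A" for x
    using tendsto_uniform_limitI[OF h x] prodinf_lessThan_LIMSEQ[OF conv[OF x]] LIMSEQ_unique by blast
  ultimately show "continuous_on A (\<lambda>x. \<Prod>i. g (of_real (a x i) * t))"
    by (subst continuous_on_cong[OF refl]) auto
qed

text \<open>The Weierstrass factor of genus 1, up to sign of the argument: the exponential removes
  the linear term. \<open>den_factor\<close> does the same for the denominators.\<close>

definition num_factor :: "complex \<Rightarrow> complex" where
  "num_factor z = (1 + z) * exp (- z)"

definition den_factor :: "complex \<Rightarrow> complex" where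
  "den_factor z = exp (- z) / (1 - z)"

lemma norm_one_minus_ge_one: "Re z \<le> 0 \<Longrightarrow> 1 \<le> norm (1 - z)"
  using complex_Re_le_cmod[of "1 - z"] by simp

lemma num_factor_bound: "norm (num_factor z - 1) \<le> exp (2 * norm z) * (norm z)\<^sup>2"
proof -
  have "num_factor z - 1 = exp (- z) * ((1 + z) - exp z)"
    by (simp add: num_factor_def right_diff_distrib mult.commute flip: exp_add)
  then have "norm (num_factor z - 1) = norm (exp (- z)) * norm (exp z - (1 + z))"
    by (simp add: norm_mult norm_minus_commute)
  also have "\<dots> \<le> exp (norm z) * (exp (norm z) * (norm z)\<^sup>2)"
    using norm_exp[of "- z"] by (intro mult_mono norm_exp_minus_linear_le) auto
  also have "\<dots> = exp (2 * norm z) * (norm z)\<^sup>2"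
    by (simp only: mult.assoc[symmetric] exp_add[symmetric] mult_2)
  finally show ?thesis .
qed

lemma den_factor_bound:
  assumes "Re z \<le> 0"
  shows "norm (den_factor z - 1) \<le> exp (2 * norm z) * (norm z)\<^sup>2"
proof -
  have ge: "1 \<le> norm (1 - z)" using norm_one_minus_ge_one[OF assms] .
  then have nz: "1 - z \<noteq> 0" by auto
  have "den_factor z - 1 = (exp (- z) - (1 + - z)) / (1 - z)"
    unfolding den_factor_def using nz by (simp add: diff_divide_distrib)
  then have "norm (den_factor z - 1) = norm (exp (- z) - (1 + - z)) / norm (1 - z)"
    by (simp only: norm_divide)
  also have "\<dots> \<le> norm (exp (- z) - (1 + - z)) / 1"
    using ge by (intro divide_left_mono) auto
  also have "\<dots> \<le> exp (norm z) * (norm z)\<^sup>2"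
    using norm_exp_minus_linear_le[of "- z"] by simp
  also have "\<dots> \<le> exp (2 * norm z) * (norm z)\<^sup>2"
    by (intro mult_right_mono) auto
  finally show ?thesis .
qed

lemma continuous_on_num_factor: "continuous_on {z. Re z \<le> 0} num_factor"
  unfolding num_factor_def[abs_def] by (intro continuous_intros)

lemma continuous_on_den_factor: "continuous_on {z. Re z \<le> 0} den_factor"
  unfolding den_factor_def[abs_def]
  by (intro continuous_intros) (use norm_one_minus_ge_one in force)

text \<open>\<open>gap\<close> is not a continuous function of the coordinates. The exponentials
  compensating the linear terms of the factors multiply to
  \<open>exp ((\<Sum>i. \<alpha> i + \<beta> i) * t)\<close>, which combines with the
  \<open>gap\<close> exponential to \<open>exp (\<delta> * t)\<close>; what remains is a product of
  regularised factors.\<close>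

lemma continuous_on_Psi:
  fixes \<alpha> \<beta> :: "'b :: topological_space \<Rightarrow> nat \<Rightarrow> real"
  assumes A: "compact A" and cont: "\<And>i. continuous_on A (\<lambda>x. \<alpha> x i)" "\<And>i. continuous_on A (\<lambda>x. \<beta> x i)"
      "continuous_on A \<delta>"
    and ab: "\<And>x. x \<in> A \<Longrightarrow> ab_seqs (\<alpha> x) (\<beta> x)" "\<And>x. x \<in> A \<Longrightarrow> 0 \<le> gap (\<delta> x) (\<alpha> x) (\<beta> x)"
      "\<And>x. x \<in> A \<Longrightarrow> \<delta> x \<le> C"
    and u: "norm u = 1"
  shows "continuous_on A (\<lambda>x. Psi (\<delta> x) (\<alpha> x) (\<beta> x) u)"
proof -
  define t where "t = u - 1"
  have t: "Re t \<le> 0" using complex_Re_le_cmod[of u] u by (simp add: t_def)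
  have le: "\<alpha> x i \<le> C / (real i + 1)" "\<beta> x i \<le> C / (real i + 1)" "0 \<le> \<alpha> x i" "0 \<le> \<beta> x i" if "x \<in> A" for x i
    using ab_sequence_le[OF ab(1,2)[OF that], of i] divide_right_mono[OF ab(3)[OF that], of "real i + 1"]
      ab(1)[OF that]
    by (auto simp: ab_seqs_def add.commute)
  have a: "0 \<le> \<alpha> x i \<and> \<alpha> x i \<le> C / (real i + 1)" and b: "0 \<le> \<beta> x i \<and> \<beta> x i \<le> C / (real i + 1)" if "x \<in> A" for x i
    using le[OF that] by auto
  note N = continuous_on_prodinf_coordinates[where a = \<beta> and g = num_factor and t = t,
      OF A cont(2) b continuous_on_num_factor num_factor_bound t]
  note D = continuous_on_prodinf_coordinates[where a = \<alpha> and g = den_factor and t = t,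
      OF A cont(1) a continuous_on_den_factor den_factor_bound t]
  have eq: "Psi (\<delta> x) (\<alpha> x) (\<beta> x) u = exp (of_real (\<delta> x) * t) *
      ((\<Prod>i. num_factor (of_real (\<beta> x i) * t)) * (\<Prod>i. den_factor (of_real (\<alpha> x i) * t)))" if x: "x \<in> A" for x
  proof -
    define s where "s i = \<alpha> x i + \<beta> x i" for i
    have s: "summable s" using ab(1)[OF x] by (simp add: s_def[abs_def] ab_seqs_def)
    then have s': "(\<lambda>i. of_real (s i) * t) sums (of_real (suminf s) * t)"
      by (intro sums_mult2 sums_of_real) auto
    have "ab_factor (\<alpha> x) (\<beta> x) u i =
        (num_factor (of_real (\<beta> x i) * t) * den_factor (of_real (\<alpha> x i) * t)) * exp (of_real (s i) * t)" for i
    proof -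
      have "exp (- (of_real (\<beta> x i) * t)) * exp (- (of_real (\<alpha> x i) * t)) * exp (of_real (s i) * t) = 1"
        unfolding exp_add[symmetric] by (simp add: s_def algebra_simps)
      then show ?thesis
        unfolding ab_factor_def num_factor_def den_factor_def t_def[symmetric]
        by (simp add: mult_ac)
    qed
    then have "prodinf (ab_factor (\<alpha> x) (\<beta> x) u) =
        (\<Prod>i. (num_factor (of_real (\<beta> x i) * t) * den_factor (of_real (\<alpha> x i) * t)) * exp (of_real (s i) * t))"
      by (intro prodinf_cong) auto
    also have "\<dots> = (\<Prod>i. num_factor (of_real (\<beta> x i) * t)) * (\<Prod>i. den_factor (of_real (\<alpha> x i) * t)) *
        (\<Prod>i. exp (of_real (s i) * t))"
    proof -
      have "convergent_prod (\<lambda>i. num_factor (of_real (\<beta> x i) * t))" by (rule N(2)) (use x in auto)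
      moreover have "convergent_prod (\<lambda>i. den_factor (of_real (\<alpha> x i) * t))" by (rule D(2)) (use x in auto)
      moreover have "convergent_prod (\<lambda>i. exp (of_real (s i) * t))"
        by (rule convergent_prod_exp[OF sums_summable[OF s']])
      ultimately show ?thesis by (simp add: prodinf_mult convergent_prod_mult)
    qed
    also have "(\<Prod>i. exp (of_real (s i) * t)) = exp (of_real (suminf s) * t)"
      using s' by (simp add: prodinf_exp sums_iff)
    finally have "Psi (\<delta> x) (\<alpha> x) (\<beta> x) u =
        (exp (of_real (gap (\<delta> x) (\<alpha> x) (\<beta> x)) * t) * exp (of_real (suminf s) * t)) *
        ((\<Prod>i. num_factor (of_real (\<beta> x i) * t)) * (\<Prod>i. den_factor (of_real (\<alpha> x i) * t)))"
      by (simp add: Psi_def t_def mult_ac)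
    also have "exp (of_real (gap (\<delta> x) (\<alpha> x) (\<beta> x)) * t) * exp (of_real (suminf s) * t) = exp (of_real (\<delta> x) * t)"
      unfolding exp_add[symmetric] by (simp add: gap_def s_def[abs_def] algebra_simps)
    finally show ?thesis .
  qed
  have "continuous_on A (\<lambda>x. exp (of_real (\<delta> x) * t) *
      ((\<Prod>i. num_factor (of_real (\<beta> x i) * t)) * (\<Prod>i. den_factor (of_real (\<alpha> x i) * t))))"
    by (intro continuous_intros cont N(1) D(1))
  then show ?thesis using eq by (subst continuous_on_cong[OF refl]) auto
qed

lemma continuous_on_Phi_Omega_le:
  assumes u: "norm u = 1"
  shows "continuous_on (Omega_le C) (Phi u)"
proof -
  let ?ap = "\<lambda>\<omega>::point. fst \<omega>" and ?bp = "\<lambda>\<omega>::point. fst (snd \<omega>)"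
    and ?am = "\<lambda>\<omega>::point. fst (snd (snd \<omega>))" and ?bm = "\<lambda>\<omega>::point. fst (snd (snd (snd \<omega>)))"
    and ?dp = "\<lambda>\<omega>::point. fst (snd (snd (snd (snd \<omega>))))" and ?dm = "\<lambda>\<omega>::point. snd (snd (snd (snd (snd \<omega>))))"
  have in_Omega: "(?ap \<omega>, ?bp \<omega>, ?am \<omega>, ?bm \<omega>, ?dp \<omega>, ?dm \<omega>) \<in> Omega" "?dp \<omega> \<le> C" "?dm \<omega> \<le> C"
    if "\<omega> \<in> Omega_le C" for \<omega>
    using that by (auto simp: Omega_le_def)
  note ab = Omega_ab[OF in_Omega(1)]
  have "continuous_on (Omega_le C) (\<lambda>\<omega>. Psi (?dp \<omega>) (?ap \<omega>) (?bp \<omega>) u)"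
    by (rule continuous_on_Psi[where C = C, OF compact_Omega_le _ _ _ ab(1,3) in_Omega(2) u])
       (assumption | rule continuous_on_id continuous_on_fst continuous_on_snd continuous_on_product_then_coordinatewise)+
  moreover have "continuous_on (Omega_le C) (\<lambda>\<omega>. Psi (?dm \<omega>) (?am \<omega>) (?bm \<omega>) (inverse u))"
    by (rule continuous_on_Psi[where C = C, OF compact_Omega_le _ _ _ ab(2,4) in_Omega(3)])
       (assumption | rule continuous_on_id continuous_on_fst continuous_on_snd continuous_on_product_then_coordinatewise
         | simp add: u norm_inverse)+
  ultimately have "continuous_on (Omega_le C) (\<lambda>\<omega>. Psi (?dp \<omega>) (?ap \<omega>) (?bp \<omega>) u *
      Psi (?dm \<omega>) (?am \<omega>) (?bm \<omega>) (inverse u))"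
    by (rule continuous_on_mult)
  moreover have "Phi u \<omega> = Psi (?dp \<omega>) (?ap \<omega>) (?bp \<omega>) u *
      Psi (?dm \<omega>) (?am \<omega>) (?bm \<omega>) (inverse u)" if "\<omega> \<in> Omega_le C" for \<omega>
    using Phi_eq_Psi[OF ab(1,2)[OF that], of u "?dp \<omega>" "?dm \<omega>"] u by (simp add: norm_inverse)
  ultimately show ?thesis by (subst continuous_on_cong[OF refl]) auto
qed

lemma continuous_on_circle_Phi:
  assumes "\<omega> \<in> Omega"
  shows "continuous_on (sphere 0 1) (\<lambda>u. Phi u \<omega>)"
proof -
  obtain \<alpha>p \<beta>p \<alpha>m \<beta>m \<delta>p \<delta>m where \<omega>: "\<omega> = (\<alpha>p, \<beta>p, \<alpha>m, \<beta>m, \<delta>p, \<delta>m)" by (cases \<omega>)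
  note ab = Omega_ab[OF assms[unfolded \<omega>]]
  have Psi: "continuous_on (sphere 0 1) (Psi \<delta> \<alpha> \<beta>)" if ab: "ab_seqs \<alpha> \<beta>" for \<delta> \<alpha> \<beta>
  proof -
    obtain R where R: "1 < R" "\<alpha> 0 * (R - 1) < 1"
      using exists_radius[of "\<alpha> 0" 1] ab by (auto simp: ab_seqs_def)
    then have "Psi \<delta> \<alpha> \<beta> holomorphic_on ball 0 R"
      unfolding Psi_def[abs_def] by (intro holomorphic_intros ab_product_holomorphic ab) auto
    then show ?thesis
      by (rule continuous_on_subset[OF holomorphic_on_imp_continuous_on]) (use R in auto)
  qed
  have "continuous_on (sphere 0 1) (\<lambda>u. Psi \<delta>p \<alpha>p \<beta>p u * Psi \<delta>m \<alpha>m \<beta>m (inverse u))"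
    by (intro continuous_intros Psi continuous_on_compose2[OF Psi] ab) (auto simp: norm_inverse)
  then show ?thesis
    unfolding \<omega> using Phi_eq_Psi[OF ab(1,2)]
    by (subst continuous_on_cong[OF refl]) (auto simp: norm_inverse)
qed

text \<open>Along a convergent sequence the two \<open>\<delta>\<close> are bounded, so the sequence
  and its limit lie in one \<open>Omega_le C\<close>, where continuity is known.\<close>

lemma continuous_on_Phi:
  assumes u: "norm u = 1"
  shows "continuous_on Omega (Phi u)"
  unfolding continuous_on_sequentially
proof (intro allI ballI impI)
  fix x :: "nat \<Rightarrow> point" and a
  assume a: "a \<in> Omega" and x: "(\<forall>n. x n \<in> Omega) \<and> x \<longlonglongrightarrow> a"
  let ?dp = "\<lambda>\<omega>::point. fst (snd (snd (snd (snd \<omega>))))" and ?dm = "\<lambda>\<omega>::point. snd (snd (snd (snd (snd \<omega>))))"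
  have "(\<lambda>n. ?dp (x n)) \<longlonglongrightarrow> ?dp a" "(\<lambda>n. ?dm (x n)) \<longlonglongrightarrow> ?dm a"
    using x by (auto intro!: tendsto_fst tendsto_snd)
  then have "Bseq (\<lambda>n. ?dp (x n))" "Bseq (\<lambda>n. ?dm (x n))"
    by (auto intro!: convergent_imp_Bseq convergentI)
  then obtain C1 C2 where C: "\<And>n. \<bar>?dp (x n)\<bar> \<le> C1" "\<And>n. \<bar>?dm (x n)\<bar> \<le> C2"
    unfolding Bseq_def by (auto simp del: split_paired_All)
  define C where "C = max (max C1 C2) (max (?dp a) (?dm a))"
  have "x n \<in> Omega_le C" for n
    using x C[of n] by (auto simp: Omega_le_def C_def case_prod_unfold abs_le_iff)
  moreover have "a \<in> Omega_le C" using a by (auto simp: Omega_le_def C_def case_prod_unfold)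
  ultimately show "(Phi u \<circ> x) \<longlonglongrightarrow> Phi u a"
    using continuous_on_Phi_Omega_le[OF u, of C] x unfolding continuous_on_sequentially by blast
qed

theorem continuous_on_phi_hat: "continuous_on Omega (\<lambda>\<omega>. phi_hat \<omega> n)"
  unfolding continuous_on_sequentially
proof (intro allI ballI impI)
  fix x :: "nat \<Rightarrow> point" and a
  assume a: "a \<in> Omega" and x: "(\<forall>n. x n \<in> Omega) \<and> x \<longlonglongrightarrow> a"
  have "(\<lambda>m. fc (\<lambda>u. Phi u (x m)) n) \<longlonglongrightarrow> fc (\<lambda>u. Phi u a) n"
  proof (rule fc_limit)
    show "continuous_on (sphere 0 1) (\<lambda>u. Phi u (x m))" for m
      using x by (intro continuous_on_circle_Phi) auto
    show "norm (Phi u (x m)) \<le> 1" if "norm u = 1" for m u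
      using x that by (intro norm_Phi_le) auto
    show "(\<lambda>m. Phi u (x m)) \<longlonglongrightarrow> Phi u a" if "norm u = 1" for u
      using continuous_on_Phi[OF that] a x unfolding continuous_on_sequentially by (auto simp: o_def)
  qed
  then show "((\<lambda>\<omega>. phi_hat \<omega> n) \<circ> x) \<longlonglongrightarrow> phi_hat a n"
    using x a by (simp add: o_def phi_hat_eq_fc)
qed

lemma norm_phi_hat_le_one: "\<omega> \<in> Omega \<Longrightarrow> norm (phi_hat \<omega> n) \<le> 1"
  unfolding phi_hat_eq_fc by (rule fc_bound[OF continuous_on_circle_Phi norm_Phi_le])

section \<open>Vanishing of the coefficients at infinity\<close>

lemma one_plus_sum_le_prod:
  fixes a :: "'b \<Rightarrow> real"
  assumes "finite A" "\<And>i. i \<in> A \<Longrightarrow> 0 \<le> a i"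
  shows "1 + sum a A \<le> (\<Prod>i\<in>A. 1 + a i)"
  using assms
proof (induction A rule: finite_induct)
  case (insert i A)
  have "1 + sum a (insert i A) \<le> (1 + a i) * (1 + sum a A)"
    using insert by (simp add: algebra_simps sum_nonneg)
  also have "\<dots> \<le> (1 + a i) * (\<Prod>i\<in>A. 1 + a i)"
    using insert by (intro mult_left_mono) auto
  finally show ?case using insert by simp
qed simp

section \<open>Bounds for \<open>Psi\<close> from bounds for its factors\<close>

lemma Psi_partial_LIMSEQ:
  assumes "ab_seqs \<alpha> \<beta>" "\<alpha> 0 * (norm u - 1) < 1"
  shows "(\<lambda>n. exp (of_real (gap \<delta> \<alpha> \<beta>) * (u - 1)) * (\<Prod>i<n. ab_factor \<alpha> \<beta> u i)) \<longlonglongrightarrow> Psi \<delta> \<alpha> \<beta> u"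
  unfolding Psi_def by (intro tendsto_mult tendsto_const prodinf_lessThan_LIMSEQ ab_product_converges assms)

lemma sum_ab_LIMSEQ:
  assumes "ab_seqs \<alpha> \<beta>"
  shows "(\<lambda>n. gap \<delta> \<alpha> \<beta> + (\<Sum>i<n. \<alpha> i + \<beta> i)) \<longlonglongrightarrow> \<delta>"
proof -
  have "(\<lambda>n. gap \<delta> \<alpha> \<beta> + (\<Sum>i<n. \<alpha> i + \<beta> i)) \<longlonglongrightarrow> gap \<delta> \<alpha> \<beta> + (\<Sum>i. \<alpha> i + \<beta> i)"
    using assms by (intro tendsto_add tendsto_const summable_LIMSEQ) (simp add: ab_seqs_def)
  then show ?thesis by (simp add: gap_def)
qed

text \<open>Since \<open>\<Prod>(1 + a i) \<ge> 1 + \<Sum>a i\<close>, the bounds for single factors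
  and for the exponential multiply to one in which all parameters add up to \<open>\<delta>\<close>.
  The exponent \<open>k\<close> is 2 on the circle, where squared moduli are explicit, and 1 at real
  points.\<close>

lemma norm_Psi_power_le:
  assumes ab: "ab_seqs \<alpha> \<beta>" "0 \<le> gap \<delta> \<alpha> \<beta>" and u: "\<alpha> 0 * (norm u - 1) < 1" and s: "0 \<le> s"
    and fac: "\<And>i. norm (ab_factor \<alpha> \<beta> u i) ^ k \<le> 1 / (1 + (\<alpha> i + \<beta> i) * s)"
    and ex: "norm (exp (of_real (gap \<delta> \<alpha> \<beta>) * (u - 1))) ^ k \<le> 1 / (1 + gap \<delta> \<alpha> \<beta> * s)"
  shows "norm (Psi \<delta> \<alpha> \<beta> u) ^ k \<le> 1 / (1 + \<delta> * s)"
proof (rule LIMSEQ_le)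
  let ?g = "gap \<delta> \<alpha> \<beta>" and ?x = "\<lambda>i. \<alpha> i + \<beta> i"
  have pos: "0 \<le> ?x i" for i using ab by (simp add: ab_seqs_def)
  show "(\<lambda>n. norm (exp (of_real ?g * (u - 1)) * (\<Prod>i<n. ab_factor \<alpha> \<beta> u i)) ^ k) \<longlonglongrightarrow> norm (Psi \<delta> \<alpha> \<beta> u) ^ k"
    by (intro tendsto_power tendsto_norm Psi_partial_LIMSEQ ab u)
  have "0 \<le> \<delta>"
    using ab suminf_nonneg[of ?x] pos by (auto simp: gap_def ab_seqs_def)
  then have "0 \<le> \<delta> * s" using s by simp
  then have "1 + \<delta> * s \<noteq> 0" by linarith
  then show "(\<lambda>n. 1 / (1 + (?g + (\<Sum>i<n. ?x i)) * s)) \<longlonglongrightarrow> 1 / (1 + \<delta> * s)"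
    by (intro tendsto_divide tendsto_add tendsto_mult tendsto_const sum_ab_LIMSEQ ab)
  show "\<exists>N. \<forall>n\<ge>N. norm (exp (of_real ?g * (u - 1)) * (\<Prod>i<n. ab_factor \<alpha> \<beta> u i)) ^ k
      \<le> 1 / (1 + (?g + (\<Sum>i<n. ?x i)) * s)"
  proof (intro exI allI impI)
    fix n
    have gs: "0 \<le> ?g * s" and xs: "0 \<le> ?x i * s" for i using ab s pos by auto
    have "norm (exp (of_real ?g * (u - 1)) * (\<Prod>i<n. ab_factor \<alpha> \<beta> u i)) ^ k
        = norm (exp (of_real ?g * (u - 1))) ^ k * (\<Prod>i<n. norm (ab_factor \<alpha> \<beta> u i) ^ k)"
      by (simp only: norm_mult prod_norm[symmetric] power_mult_distrib prod_power_distrib)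
    also have "\<dots> \<le> 1 / (1 + ?g * s) * (\<Prod>i<n. 1 / (1 + ?x i * s))"
      using gs by (intro mult_mono ex prod_mono conjI fac zero_le_power prod_nonneg) auto
    also have "\<dots> = 1 / ((1 + ?g * s) * (\<Prod>i<n. 1 + ?x i * s))"
      by (simp add: prod_dividef)
    also have "\<dots> \<le> 1 / (1 + (?g + (\<Sum>i<n. ?x i)) * s)"
    proof (rule divide_left_mono)
      have S: "0 \<le> (\<Sum>i<n. ?x i * s)" using xs by (intro sum_nonneg) auto
      have "1 + (?g + (\<Sum>i<n. ?x i)) * s = 1 + ?g * s + (\<Sum>i<n. ?x i * s)"
        by (simp add: distrib_right sum_distrib_right)
      also have "\<dots> \<le> (1 + ?g * s) * (1 + (\<Sum>i<n. ?x i * s))"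
        using gs S mult_nonneg_nonneg[OF gs S] by (simp add: algebra_simps)
      also have "\<dots> \<le> (1 + ?g * s) * (\<Prod>i<n. 1 + ?x i * s)"
        using gs xs by (intro mult_left_mono one_plus_sum_le_prod) auto
      finally show "1 + (?g + (\<Sum>i<n. ?x i)) * s \<le> (1 + ?g * s) * (\<Prod>i<n. 1 + ?x i * s)" .
      have "0 < 1 + (?g + (\<Sum>i<n. ?x i)) * s"
        using gs S by (simp add: distrib_right sum_distrib_right)
      moreover have "0 < (1 + ?g * s) * (\<Prod>i<n. 1 + ?x i * s)"
        using gs xs by (intro mult_pos_pos prod_pos) (auto intro: add_pos_nonneg)
      ultimately show "0 < (1 + ?g * s) * (\<Prod>i<n. 1 + ?x i * s) * (1 + (?g + (\<Sum>i<n. ?x i)) * s)"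
        by (rule mult_pos_pos[rotated])
    qed simp
    finally show "norm (exp (of_real ?g * (u - 1)) * (\<Prod>i<n. ab_factor \<alpha> \<beta> u i)) ^ k
        \<le> 1 / (1 + (?g + (\<Sum>i<n. ?x i)) * s)" .
  qed
qed

lemma norm_Psi_le_one:
  assumes ab: "ab_seqs \<alpha> \<beta>" and g: "0 \<le> gap \<delta> \<alpha> \<beta>" and b: "\<And>i. \<beta> i \<le> 1" and u: "norm u = 1"
  shows "norm (Psi \<delta> \<alpha> \<beta> u) \<le> 1"
proof (rule tendsto_upperbound[OF tendsto_norm[OF Psi_partial_LIMSEQ[OF ab]]])
  show "\<forall>\<^sub>F n in sequentially. norm (exp (of_real (gap \<delta> \<alpha> \<beta>) * (u - 1)) * (\<Prod>i<n. ab_factor \<alpha> \<beta> u i)) \<le> 1"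
  proof (intro always_eventually allI)
    fix n
    have "tp_function (\<lambda>u. 1 * exp (of_real (gap \<delta> \<alpha> \<beta>) * (u - 1)) * (\<Prod>i<n. ab_factor \<alpha> \<beta> u i))"
      by (intro tp_function_ab_products tp_function_exp tp_function_one ab g b)
    then show "norm (exp (of_real (gap \<delta> \<alpha> \<beta>) * (u - 1)) * (\<Prod>i<n. ab_factor \<alpha> \<beta> u i)) \<le> 1"
      using u by (simp add: tp_function_def)
  qed
qed (use u in auto)

lemma quotient_le_inverse_sum:
  fixes a b s :: real
  assumes "0 \<le> a" "0 \<le> b" "0 \<le> s" "P \<le> 1 - b * s" "1 + a * s \<le> Q"
  shows "P / Q \<le> 1 / (1 + (a + b) * s)"
proof -
  have as: "0 \<le> a * s" and bs: "0 \<le> b * s" using assms by auto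
  have "P * (1 + (a + b) * s) \<le> (1 - b * s) * (1 + (a + b) * s)"
    using assms as bs by (intro mult_right_mono) (auto simp: distrib_right)
  also have "\<dots> = 1 + a * s - (b * s) * (a * s + b * s)" by (simp add: algebra_simps)
  also have "\<dots> \<le> 1 + a * s" using as bs by simp
  also have "\<dots> \<le> Q" by fact
  finally have le: "P * (1 + (a + b) * s) \<le> Q" .
  have Q: "0 < Q" using as assms(5) by linarith
  have T: "0 < 1 + (a + b) * s" unfolding distrib_right using as bs by linarith
  have "P \<le> Q / (1 + (a + b) * s)" using le by (simp only: pos_le_divide_eq[OF T])
  then show ?thesis by (simp only: pos_divide_le_eq[OF Q] times_divide_eq_left mult_1_left)
qed

text \<open>With \<open>s = 1 - Re u\<close>, the squared modulus of \<open>1 + x * (u - 1)\<close>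
  is \<open>1 - 2 * x * (1 - x) * s\<close>. For \<open>x = \<beta> i \<le> 1 / 2\<close> this is at
  most \<open>1 - \<beta> i * s\<close>; for \<open>x = - \<alpha> i\<close> it is at least
  \<open>1 + \<alpha> i * s\<close>.\<close>

lemma norm_Psi_circle_le:
  assumes ab: "ab_seqs \<alpha> \<beta>" "0 \<le> gap \<delta> \<alpha> \<beta>" and b: "\<And>i. \<beta> i \<le> 1 / 2" and u: "norm u = 1"
  shows "norm (Psi \<delta> \<alpha> \<beta> u) ^ 2 \<le> 1 / (1 + \<delta> * (1 - Re u))"
proof -
  define s where "s = 1 - Re u"
  have s: "0 \<le> s" using complex_Re_le_cmod[of u] u by (simp add: s_def)
  have u2: "(Re u)\<^sup>2 + (Im u)\<^sup>2 = 1" using cmod_power2[of u] u by simp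
  have sq: "norm (1 + complex_of_real x * (u - 1)) ^ 2 = 1 - 2 * x * (1 - x) * s" for x
  proof -
    have "norm (1 + complex_of_real x * (u - 1)) ^ 2 = (1 + x * (Re u - 1))\<^sup>2 + (x * Im u)\<^sup>2"
      by (simp add: cmod_power2)
    also have "\<dots> = 1 + 2 * x * (Re u - 1) + x\<^sup>2 * (((Re u)\<^sup>2 + (Im u)\<^sup>2) + 1 - 2 * Re u)"
      by (simp add: power2_eq_square algebra_simps)
    also have "\<dots> = 1 - 2 * x * (1 - x) * s"
      unfolding u2 s_def by (simp add: power2_eq_square algebra_simps)
    finally show ?thesis .
  qed
  show ?thesis
    unfolding s_def[symmetric]
  proof (rule norm_Psi_power_le[OF ab _ s])
    fix i
    have pos: "0 \<le> \<alpha> i" "0 \<le> \<beta> i" using ab by (auto simp: ab_seqs_def)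
    have "norm (ab_factor \<alpha> \<beta> u i) ^ 2 =
        norm (1 + complex_of_real (\<beta> i) * (u - 1)) ^ 2 / norm (1 + complex_of_real (- \<alpha> i) * (u - 1)) ^ 2"
      by (simp add: ab_factor_def norm_divide power_divide)
    also have "\<dots> \<le> 1 / (1 + (\<alpha> i + \<beta> i) * s)"
      unfolding sq
    proof (rule quotient_le_inverse_sum[OF pos s])
      have "0 \<le> \<beta> i * (1 - 2 * \<beta> i) * s" using pos s b[of i] by (intro mult_nonneg_nonneg) auto
      then show "1 - 2 * \<beta> i * (1 - \<beta> i) * s \<le> 1 - \<beta> i * s" by (simp add: algebra_simps)
      have "0 \<le> \<alpha> i * (1 + 2 * \<alpha> i) * s" using pos s by (intro mult_nonneg_nonneg) auto
      then show "1 + \<alpha> i * s \<le> 1 - 2 * (- \<alpha> i) * (1 - - \<alpha> i) * s" by (simp add: algebra_simps)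
    qed
    finally show "norm (ab_factor \<alpha> \<beta> u i) ^ 2 \<le> 1 / (1 + (\<alpha> i + \<beta> i) * s)" .
  next
    let ?g = "gap \<delta> \<alpha> \<beta>"
    have gs: "0 \<le> ?g * s" using ab s by simp
    have "norm (exp (of_real ?g * (u - 1))) ^ 2 = exp (- (?g * s)) ^ 2"
      by (simp add: s_def algebra_simps)
    also have "\<dots> \<le> exp (- (?g * s)) ^ 1"
      using gs by (intro power_decreasing) auto
    also have "\<dots> = 1 / exp (?g * s)" by (simp add: exp_minus field_simps)
    also have "\<dots> \<le> 1 / (1 + ?g * s)"
      using gs by (intro divide_left_mono exp_ge_add_one_self mult_pos_pos) auto
    finally show "norm (exp (of_real ?g * (u - 1))) ^ 2 \<le> 1 / (1 + ?g * s)" .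
  qed (use u in simp)
qed

text \<open>Below 1 on the real axis the factors are
  \<open>(1 - \<beta> i * y) / (1 + \<alpha> i * y)\<close>, which decay even for
  \<open>\<beta> i = 1\<close>: a shift is visible here although it is not on the circle.\<close>

lemma norm_Psi_real_le:
  assumes ab: "ab_seqs \<alpha> \<beta>" "0 \<le> gap \<delta> \<alpha> \<beta>" and b: "\<And>i. \<beta> i \<le> 1" and y: "0 < y" "y < 1"
  shows "norm (Psi \<delta> \<alpha> \<beta> (of_real (1 - y))) \<le> 1 / (1 + \<delta> * y)"
proof -
  let ?g = "gap \<delta> \<alpha> \<beta>"
  have "norm (Psi \<delta> \<alpha> \<beta> (of_real (1 - y))) ^ 1 \<le> 1 / (1 + \<delta> * y)"
  proof (rule norm_Psi_power_le[OF ab])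
    have "0 \<le> \<alpha> 0 * y" using ab y by (simp add: ab_seqs_def)
    then show "\<alpha> 0 * (norm (complex_of_real (1 - y)) - 1) < 1"
      using y unfolding norm_of_real by simp
    fix i
    have pos: "0 \<le> \<alpha> i" "0 \<le> \<beta> i" using ab by (auto simp: ab_seqs_def)
    have by1: "\<beta> i * y \<le> 1" using pos b[of i] y mult_mono[of "\<beta> i" 1 y 1] by simp
    have "ab_factor \<alpha> \<beta> (of_real (1 - y)) i = of_real ((1 - \<beta> i * y) / (1 + \<alpha> i * y))"
      by (simp add: ab_factor_def)
    then have "norm (ab_factor \<alpha> \<beta> (of_real (1 - y)) i) ^ 1 = \<bar>(1 - \<beta> i * y) / (1 + \<alpha> i * y)\<bar>"
      by (simp only: norm_of_real power_one_right)
    also have "\<dots> = (1 - \<beta> i * y) / (1 + \<alpha> i * y)"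
      using pos y by1 by (intro abs_of_nonneg divide_nonneg_nonneg) auto
    also have "\<dots> \<le> 1 / (1 + (\<alpha> i + \<beta> i) * y)"
      using pos y by (intro quotient_le_inverse_sum) auto
    finally show "norm (ab_factor \<alpha> \<beta> (of_real (1 - y)) i) ^ 1 \<le> 1 / (1 + (\<alpha> i + \<beta> i) * y)" .
  next
    have gs: "0 \<le> ?g * y" using ab y by simp
    have "of_real ?g * (complex_of_real (1 - y) - 1) = of_real (- (?g * y))" by simp
    then have "norm (exp (of_real ?g * (complex_of_real (1 - y) - 1))) ^ 1 = 1 / exp (?g * y)"
      by (simp only: norm_exp_eq_Re Re_complex_of_real exp_minus inverse_eq_divide power_one_right)
    also have "\<dots> \<le> 1 / (1 + ?g * y)"
      using gs by (intro divide_left_mono exp_ge_add_one_self mult_pos_pos) auto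
    finally show "norm (exp (of_real ?g * (complex_of_real (1 - y) - 1))) ^ 1 \<le> 1 / (1 + ?g * y)" .
  qed (use y in simp)
  then show ?thesis by simp
qed

text \<open>Beyond 1 the function grows, but the growth is controlled by \<open>\<delta>\<close> at
  distance from the poles. The factor 2 in the exponent comes from
  \<open>1 / (1 - z) \<le> 1 + 2 * z\<close> for \<open>0 \<le> z \<le> 1 / 2\<close>.\<close>

lemma norm_Psi_real_ge_one_le:
  assumes ab: "ab_seqs \<alpha> \<beta>" "0 \<le> gap \<delta> \<alpha> \<beta>" and w: "0 \<le> w" "\<And>i. \<alpha> i * w \<le> 1 / 2"
  shows "norm (Psi \<delta> \<alpha> \<beta> (of_real (1 + w))) \<le> exp (2 * w * \<delta>)"
proof (rule tendsto_le[OF _ _ tendsto_norm[OF Psi_partial_LIMSEQ[OF ab(1)]]])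
  let ?g = "gap \<delta> \<alpha> \<beta>" and ?x = "\<lambda>i. \<alpha> i + \<beta> i"
  show "(\<lambda>n. exp (2 * w * (?g + (\<Sum>i<n. ?x i)))) \<longlonglongrightarrow> exp (2 * w * \<delta>)"
    by (intro tendsto_exp tendsto_mult tendsto_const sum_ab_LIMSEQ ab)
  show "\<alpha> 0 * (norm (complex_of_real (1 + w)) - 1) < 1"
    using w(1) w(2)[of 0] unfolding norm_of_real by simp
  show "\<forall>\<^sub>F n in sequentially. norm (exp (of_real ?g * (complex_of_real (1 + w) - 1)) *
      (\<Prod>i<n. ab_factor \<alpha> \<beta> (of_real (1 + w)) i)) \<le> exp (2 * w * (?g + (\<Sum>i<n. ?x i)))"
  proof (intro always_eventually allI)
    fix n
    have fac: "norm (ab_factor \<alpha> \<beta> (of_real (1 + w)) i) \<le> exp (2 * w * ?x i)" for i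
    proof -
      have pos: "0 \<le> \<alpha> i * w" "0 \<le> \<beta> i * w" using ab w by (auto simp: ab_seqs_def)
      have "ab_factor \<alpha> \<beta> (of_real (1 + w)) i = of_real ((1 + \<beta> i * w) * (1 / (1 - \<alpha> i * w)))"
        by (simp add: ab_factor_def)
      then have "norm (ab_factor \<alpha> \<beta> (of_real (1 + w)) i) = \<bar>(1 + \<beta> i * w) * (1 / (1 - \<alpha> i * w))\<bar>"
        by (simp only: norm_of_real)
      also have "\<dots> = (1 + \<beta> i * w) * (1 / (1 - \<alpha> i * w))"
        using pos w(2)[of i] by (intro abs_of_nonneg mult_nonneg_nonneg divide_nonneg_nonneg) auto
      also have "\<dots> \<le> exp (2 * (\<beta> i * w)) * exp (2 * (\<alpha> i * w))"
      proof (rule mult_mono)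
        show "1 + \<beta> i * w \<le> exp (2 * (\<beta> i * w))"
          using exp_ge_add_one_self[of "2 * (\<beta> i * w)"] pos by linarith
        have "(\<alpha> i * w) * (2 * (\<alpha> i * w)) \<le> (\<alpha> i * w) * 1"
          using pos w(2)[of i] by (intro mult_left_mono) auto
        then have "1 \<le> (1 + 2 * (\<alpha> i * w)) * (1 - \<alpha> i * w)"
          by (simp add: algebra_simps)
        then have "1 / (1 - \<alpha> i * w) \<le> 1 + 2 * (\<alpha> i * w)"
          using w(2)[of i] by (simp add: pos_divide_le_eq)
        also have "\<dots> \<le> exp (2 * (\<alpha> i * w))" by (rule exp_ge_add_one_self)
        finally show "1 / (1 - \<alpha> i * w) \<le> exp (2 * (\<alpha> i * w))" .
      qed (use w(2)[of i] in auto)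
      also have "\<dots> = exp (2 * w * ?x i)"
        unfolding exp_add[symmetric] by (simp add: algebra_simps)
      finally show ?thesis .
    qed
    have "norm (exp (of_real ?g * (complex_of_real (1 + w) - 1)) * (\<Prod>i<n. ab_factor \<alpha> \<beta> (of_real (1 + w)) i))
        = exp (?g * w) * (\<Prod>i<n. norm (ab_factor \<alpha> \<beta> (of_real (1 + w)) i))"
      by (simp add: norm_mult prod_norm[symmetric])
    also have "\<dots> \<le> exp (2 * w * ?g) * (\<Prod>i<n. exp (2 * w * ?x i))"
    proof (intro mult_mono prod_mono conjI fac prod_nonneg)
      have "0 \<le> ?g * w" using ab w by simp
      then show "exp (?g * w) \<le> exp (2 * w * ?g)" by (simp add: mult.commute)
    qed auto
    also have "\<dots> = exp (2 * w * (?g + (\<Sum>i<n. ?x i)))"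
      by (simp add: exp_sum[symmetric] exp_add[symmetric] sum_distrib_left distrib_left)
    finally show "norm (exp (of_real ?g * (complex_of_real (1 + w) - 1)) *
      (\<Prod>i<n. ab_factor \<alpha> \<beta> (of_real (1 + w)) i)) \<le> exp (2 * w * (?g + (\<Sum>i<n. ?x i)))" .
  qed
qed simp

text \<open>Majorant for \<open>2 * pi\<close> times the modulus of a coefficient when
  \<open>\<delta>\<close> is at least \<open>m\<close> and the \<open>\<beta>\<close> of that sign
  are at most \<open>1 / 2\<close>.\<close>

definition circle_mass :: "nat \<Rightarrow> real" where
  "circle_mass m = integral {0..2*pi} (\<lambda>t. 1 / sqrt (1 + real m * (1 - cos t)))"

lemma circle_mass_integrable:
  "(\<lambda>t. 1 / sqrt (1 + real m * (1 - cos t))) integrable_on {0..2*pi}"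
proof (rule integrable_continuous_interval)
  have "1 + real m * (1 - cos t) > 0" for t
    by (intro add_pos_nonneg mult_nonneg_nonneg) auto
  then show "continuous_on {0..2*pi} (\<lambda>t. 1 / sqrt (1 + real m * (1 - cos t)))"
    by (intro continuous_intros) (metis order_less_irrefl real_sqrt_eq_zero_cancel_iff)
qed

lemma circle_mass_LIMSEQ: "circle_mass \<longlonglongrightarrow> 0"
proof -
  \<comment> \<open>The pointwise limit of the integrands; on the interval it is nonzero at the two
    end points only.\<close>
  define g where "g t = (if cos t = 1 then 1 else 0 :: real)" for t :: real
  have "(g has_integral 0) {0..2*pi}"
  proof (rule has_integral_spike_finite[of "{0, 2 * pi}"])
    fix t assume t: "t \<in> {0..2*pi} - {0, 2*pi}"
    have "cos t \<noteq> 1"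
    proof
      assume "cos t = 1"
      then obtain n :: int where n: "t = real_of_int n * 2 * pi" by (auto simp: cos_one_2pi_int)
      have "0 < t" "t < 2 * pi" using t by auto
      moreover have tt: "t = real_of_int n * (2 * pi)" using n by simp
      ultimately have "0 < real_of_int n * (2 * pi)" "real_of_int n * (2 * pi) < 1 * (2 * pi)" by auto
      moreover have pi2: "0 < 2 * pi" by simp
      ultimately have "0 < real_of_int n" "real_of_int n < 1"
        using zero_less_mult_pos2 mult_less_cancel_right_pos[OF pi2] by blast+
      then show False by simp
    qed
    then show "g t = (\<lambda>_. 0) t" by (simp add: g_def)
  qed (auto intro: has_integral_0)
  then have "integral {0..2*pi} g = 0" by (rule integral_unique)
  moreover have "circle_mass \<longlonglongrightarrow> integral {0..2*pi} g"
    unfolding circle_mass_def[abs_def]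
  proof (rule dominated_convergence(2)[where h = "\<lambda>_. 1"])
    fix m t
    have "1 \<le> sqrt (1 + real m * (1 - cos t))" by simp
    then show "norm (1 / sqrt (1 + real m * (1 - cos t))) \<le> 1" by (simp add: divide_le_eq)
  next
    fix t
    show "(\<lambda>m. 1 / sqrt (1 + real m * (1 - cos t))) \<longlonglongrightarrow> g t"
    proof (cases "cos t = 1")
      case False
      then have pos: "0 < 1 - cos t" using cos_le_one[of t] by linarith
      have "filterlim (\<lambda>m. 1 + real m * (1 - cos t)) at_top sequentially"
        by (intro filterlim_tendsto_add_at_top[OF tendsto_const]
              filterlim_at_top_mult_tendsto_pos[OF tendsto_const pos] filterlim_real_sequentially)
      then have "filterlim (\<lambda>m. sqrt (1 + real m * (1 - cos t))) at_top sequentially"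
        by (rule filterlim_compose[OF sqrt_at_top])
      from tendsto_inverse_0_at_top[OF this] False show ?thesis
        by (simp add: g_def inverse_eq_divide)
    qed (simp add: g_def)
  qed (rule circle_mass_integrable, rule integrable_const_ivl)
  ultimately show ?thesis by simp
qed

text \<open>One half of \<open>Phi\<close> with small \<open>\<beta>\<close> supplies the decay,
  while the other has modulus at most 1 on the circle. The threshold is uniform in \<open>n\<close>,
  so it also serves for \<open>- n\<close> after the two signs are exchanged.\<close>

lemma phi_hat_small_of_spread:
  assumes e: "0 < e"
  shows "\<exists>D>0. \<forall>\<alpha>p \<beta>p \<alpha>m \<beta>m \<delta>p \<delta>m n. (\<alpha>p, \<beta>p, \<alpha>m, \<beta>m, \<delta>p, \<delta>m) \<in> Omega \<longrightarrow>
    \<beta>p 0 \<le> 1 / 2 \<longrightarrow> D \<le> \<delta>p \<longrightarrow> norm (phi_hat (\<alpha>p, \<beta>p, \<alpha>m, \<beta>m, \<delta>p, \<delta>m) n) < e"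
proof -
  have "\<forall>\<^sub>F m in sequentially. circle_mass m < e"
    using circle_mass_LIMSEQ e by (rule order_tendstoD(2))
  \<comment> \<open>\<open>Suc m\<close> serves as the threshold, which has to be positive.\<close>
  then obtain m where m: "circle_mass (Suc m) < e"
    by (auto simp: eventually_sequentially) (meson le_SucI order_refl)
  show ?thesis
  proof (intro exI[of _ "real (Suc m)"] conjI allI impI)
    fix \<alpha>p \<beta>p \<alpha>m \<beta>m \<delta>p \<delta>m n
    assume \<omega>: "(\<alpha>p, \<beta>p, \<alpha>m, \<beta>m, \<delta>p, \<delta>m) \<in> Omega" (is "?\<omega> \<in> _") and b: "\<beta>p 0 \<le> 1 / 2" and d: "real (Suc m) \<le> \<delta>p"
    note ab = Omega_ab[OF \<omega>]
    have b': "\<beta>p i \<le> 1 / 2" for i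
      using ab(1) b decseqD[of \<beta>p 0 i] by (auto simp: ab_seqs_def)
    have le: "norm (Phi (cis t) ?\<omega>) \<le> 1 / sqrt (1 + real (Suc m) * (1 - cos t))" for t
    proof -
      have "Phi (cis t) ?\<omega> = Psi \<delta>p \<alpha>p \<beta>p (cis t) * Psi \<delta>m \<alpha>m \<beta>m (inverse (cis t))"
        by (intro Phi_eq_Psi ab) (simp_all add: norm_inverse)
      then have "norm (Phi (cis t) ?\<omega>) \<le> norm (Psi \<delta>p \<alpha>p \<beta>p (cis t)) * 1"
        by (simp only: norm_mult) (intro mult_left_mono norm_Psi_le_one ab, auto simp: norm_inverse)
      then have "norm (Phi (cis t) ?\<omega>) ^ 2 \<le> norm (Psi \<delta>p \<alpha>p \<beta>p (cis t)) ^ 2"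
        by (intro power_mono) auto
      also have "\<dots> \<le> 1 / (1 + \<delta>p * (1 - Re (cis t)))"
        by (intro norm_Psi_circle_le ab b') simp
      also have "\<dots> \<le> 1 / (1 + real (Suc m) * (1 - cos t))"
        using d by (intro divide_left_mono add_left_mono mult_pos_pos add_pos_nonneg)
          (auto intro!: mult_right_mono mult_nonneg_nonneg simp del: of_nat_Suc)
      finally have "sqrt (norm (Phi (cis t) ?\<omega>) ^ 2) \<le> sqrt (1 / (1 + real (Suc m) * (1 - cos t)))"
        by (rule real_sqrt_le_mono)
      then show ?thesis by (simp add: real_sqrt_divide del: of_nat_Suc)
    qed
    have "norm (integral {0..2*pi} (\<lambda>t. Phi (cis t) ?\<omega> * cis (- (real_of_int n * t)))) \<le> circle_mass (Suc m)"
      unfolding circle_mass_def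
      by (rule integral_norm_bound_integral[OF fc_integrable[OF continuous_on_circle_Phi[OF \<omega>]] circle_mass_integrable])
         (use le in \<open>simp add: norm_mult del: of_nat_Suc\<close>)
    also note m
    finally have "norm (integral {0..2*pi} (\<lambda>t. Phi (cis t) ?\<omega> * cis (- (real_of_int n * t)))) < e" .
    moreover have "1 \<le> 2 * pi" using pi_ge_two by linarith
    then have "x / (2 * pi) \<le> x" if "0 \<le> x" for x
      using that mult_left_mono[of 1 "2 * pi" x] by (simp add: divide_le_eq)
    ultimately have "norm (integral {0..2*pi} (\<lambda>t. Phi (cis t) ?\<omega> * cis (- (real_of_int n * t)))) / (2 * pi) < e"
      by (meson norm_ge_zero order_le_less_trans)
    then show "norm (phi_hat ?\<omega> n) < e"
      unfolding phi_hat_eq_fc[OF \<omega>] fc_def by (simp add: norm_divide)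
  qed simp
qed

text \<open>At a real point slightly below 1 the plus half tends to 0 as \<open>\<delta>p\<close>
  grows, and the minus half, evaluated slightly above 1, stays bounded because
  \<open>\<delta>m\<close> does. The point depends on \<open>D\<close> only, so the power of it
  belonging to \<open>n\<close> is a fixed constant.\<close>

lemma phi_hat_small_of_drift:
  assumes D: "0 < D" and e: "0 < e"
  shows "\<exists>C. \<forall>\<alpha>p \<beta>p \<alpha>m \<beta>m \<delta>p \<delta>m. (\<alpha>p, \<beta>p, \<alpha>m, \<beta>m, \<delta>p, \<delta>m) \<in> Omega \<longrightarrow>
    \<delta>m \<le> D \<longrightarrow> C \<le> \<delta>p \<longrightarrow> norm (phi_hat (\<alpha>p, \<beta>p, \<alpha>m, \<beta>m, \<delta>p, \<delta>m) n) < e"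
proof -
  \<comment> \<open>Chosen so that \<open>inverse (1 - y) = 1 + w\<close> with
    \<open>w = 1 / (2 * D)\<close>. Then \<open>\<alpha>m i * w \<le> D * w = 1 / 2\<close> avoids
    the poles of the minus half, and that half is at most
    \<open>exp (2 * w * D) = exp 1\<close>.\<close>
  define y where "y = 1 / (2 * D + 1)"
  define w where "w = 1 / (2 * D)"
  have y: "0 < y" "y < 1" and w: "0 < w" using D by (auto simp: y_def w_def)
  have xw: "inverse (1 - y) = 1 + w" using D by (simp add: y_def w_def field_simps)
  define X where "X = (1 - y) powi n"
  have X: "0 < X" using y by (simp add: X_def)
  \<comment> \<open>Solves \<open>exp 1 / (C * y) = e * X\<close>; the additional 1 in
    \<open>1 + \<delta>p * y\<close> makes the final inequality strict.\<close>
  define C where "C = exp 1 / (X * e * y)"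
  show ?thesis
  proof (intro exI[of _ C] allI impI)
    fix \<alpha>p \<beta>p \<alpha>m \<beta>m \<delta>p \<delta>m
    assume \<omega>: "(\<alpha>p, \<beta>p, \<alpha>m, \<beta>m, \<delta>p, \<delta>m) \<in> Omega" (is "?\<omega> \<in> _") and d: "\<delta>m \<le> D" "C \<le> \<delta>p"
    note ab = Omega_ab[OF \<omega>]
    have aw: "\<alpha>m i * w \<le> 1 / 2" for i
    proof -
      have "\<alpha>m i \<le> \<delta>m / (real i + 1)" by (rule ab_sequence_le[OF ab(2,4)])
      also have "\<dots> \<le> \<delta>m / 1" using ab(11) by (intro divide_left_mono) auto
      finally have "\<alpha>m i * w \<le> D * w" using d w by (intro mult_right_mono) auto
      then show ?thesis using D by (simp add: w_def)
    qed
    have ap: "\<alpha>p 0 * ((1 - y) - 1) < 1"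
    proof -
      have "0 \<le> \<alpha>p 0 * y" using ab(1) y by (auto simp: ab_seqs_def)
      then show ?thesis by simp
    qed
    have am: "\<alpha>m 0 * (inverse (1 - y) - 1) < 1" using aw[of 0] unfolding xw by simp
    obtain p where p: "totally_positive p" "\<And>k. phi_hat ?\<omega> k = of_real (p k)"
      using phi_hat_totally_positive[OF \<omega>] by blast
    have hs: "((\<lambda>k. p k * (1 - y) powi k) has_sum Re (Phi (of_real (1 - y)) ?\<omega>)) UNIV"
      using y ap am by (intro phi_hat_real_has_sum[OF \<omega> p(2)]) auto
    have "(\<Sum>k\<in>{n}. p k * (1 - y) powi k) \<le> Re (Phi (of_real (1 - y)) ?\<omega>)"
      using hs by (rule finite_sum_le_has_sum) (use y totally_positive_nonneg[OF p(1)] in auto)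
    then have "p n * X \<le> norm (Phi (of_real (1 - y)) ?\<omega>)"
      using complex_Re_le_cmod[of "Phi (of_real (1 - y)) ?\<omega>"] by (simp add: X_def)
    also have "Phi (of_real (1 - y)) ?\<omega> = Psi \<delta>p \<alpha>p \<beta>p (of_real (1 - y)) *
        Psi \<delta>m \<alpha>m \<beta>m (of_real (1 + w))"
    proof -
      have inv: "inverse (complex_of_real (1 - y)) = of_real (1 + w)"
        unfolding xw[symmetric] by simp
      have "norm (complex_of_real (1 - y)) = 1 - y" "norm (complex_of_real (1 + w)) = inverse (1 - y)"
        using y w unfolding norm_of_real xw by auto
      then show ?thesis
        unfolding inv[symmetric] using ap am inv by (intro Phi_eq_Psi ab) auto
    qed
    also have "norm \<dots> \<le> 1 / (1 + \<delta>p * y) * exp (2 * w * \<delta>m)"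
      unfolding norm_mult
    proof (rule mult_mono)
      show "norm (Psi \<delta>p \<alpha>p \<beta>p (of_real (1 - y))) \<le> 1 / (1 + \<delta>p * y)"
        by (intro norm_Psi_real_le ab y)
      show "norm (Psi \<delta>m \<alpha>m \<beta>m (of_real (1 + w))) \<le> exp (2 * w * \<delta>m)"
        using w by (intro norm_Psi_real_ge_one_le ab aw) auto
    qed (use ab(10) y in auto)
    also have "\<dots> \<le> 1 / (1 + \<delta>p * y) * exp 1"
    proof (rule mult_left_mono)
      have "2 * w * \<delta>m \<le> 2 * w * D" using w d by (intro mult_left_mono) auto
      then show "exp (2 * w * \<delta>m) \<le> exp 1" using D by (simp add: w_def)
    qed (use ab(10) y in auto)
    finally have "p n * X \<le> exp 1 / (1 + \<delta>p * y)" by simp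
    also have "\<dots> < e * X"
    proof -
      have "C * y \<le> \<delta>p * y" using d y by (intro mult_right_mono) auto
      then have "exp 1 / (X * e) < 1 + \<delta>p * y" using y by (simp add: C_def)
      then have "exp 1 < (1 + \<delta>p * y) * (X * e)" using X e by (simp add: pos_divide_less_eq)
      then show ?thesis using ab(10) y by (simp add: pos_divide_less_eq add_pos_nonneg mult_ac)
    qed
    finally have "p n < e" using X by simp
    then show "norm (phi_hat ?\<omega> n) < e"
      using totally_positive_nonneg[OF p(1), of n] by (simp add: p(2))
  qed
qed

lemma Omega_swap:
  "(\<alpha>p, \<beta>p, \<alpha>m, \<beta>m, \<delta>p, \<delta>m) \<in> Omega \<Longrightarrow> (\<alpha>m, \<beta>m, \<alpha>p, \<beta>p, \<delta>m, \<delta>p) \<in> Omega"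
  by (auto simp: Omega_def add.commute)

text \<open>The substitution of \<open>inverse u\<close> for \<open>u\<close> exchanges the two
  signs. It reduces large \<open>\<delta>m\<close> to large \<open>\<delta>p\<close>.\<close>

lemma phi_hat_swap:
  assumes \<omega>: "(\<alpha>p, \<beta>p, \<alpha>m, \<beta>m, \<delta>p, \<delta>m) \<in> Omega"
  shows "phi_hat (\<alpha>m, \<beta>m, \<alpha>p, \<beta>p, \<delta>m, \<delta>p) n = phi_hat (\<alpha>p, \<beta>p, \<alpha>m, \<beta>m, \<delta>p, \<delta>m) (- n)"
proof -
  note ab = Omega_ab[OF \<omega>]
  have "fc (\<lambda>u. Phi u (\<alpha>m, \<beta>m, \<alpha>p, \<beta>p, \<delta>m, \<delta>p)) n = fc (\<lambda>u. Phi (inverse u) (\<alpha>p, \<beta>p, \<alpha>m, \<beta>m, \<delta>p, \<delta>m)) n"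
  proof (rule fc_cong)
    fix u :: complex assume "norm u = 1"
    then show "Phi u (\<alpha>m, \<beta>m, \<alpha>p, \<beta>p, \<delta>m, \<delta>p) = Phi (inverse u) (\<alpha>p, \<beta>p, \<alpha>m, \<beta>m, \<delta>p, \<delta>m)"
      by (subst (1 2) Phi_eq_Psi) (use ab in \<open>auto simp: norm_inverse\<close>)
  qed
  then show ?thesis
    using \<omega> Omega_swap[OF \<omega>] fc_reflect by (simp add: phi_hat_eq_fc)
qed

theorem phi_hat_vanishes:
  assumes e: "0 < e"
  shows "\<exists>C. \<forall>\<omega>\<in>Omega - Omega_le C. norm (phi_hat \<omega> n) < e"
proof -
  obtain D where D: "0 < D" "\<And>\<alpha>p \<beta>p \<alpha>m \<beta>m \<delta>p \<delta>m n. (\<alpha>p, \<beta>p, \<alpha>m, \<beta>m, \<delta>p, \<delta>m) \<in> Omega \<Longrightarrow>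
    \<beta>p 0 \<le> 1 / 2 \<Longrightarrow> D \<le> \<delta>p \<Longrightarrow> norm (phi_hat (\<alpha>p, \<beta>p, \<alpha>m, \<beta>m, \<delta>p, \<delta>m) n) < e"
    using phi_hat_small_of_spread[OF e] by auto
  obtain C1 where C1: "\<And>\<alpha>p \<beta>p \<alpha>m \<beta>m \<delta>p \<delta>m. (\<alpha>p, \<beta>p, \<alpha>m, \<beta>m, \<delta>p, \<delta>m) \<in> Omega \<Longrightarrow>
    \<delta>m \<le> D \<Longrightarrow> C1 \<le> \<delta>p \<Longrightarrow> norm (phi_hat (\<alpha>p, \<beta>p, \<alpha>m, \<beta>m, \<delta>p, \<delta>m) n) < e"
    using phi_hat_small_of_drift[OF D(1) e, of n] by auto
  obtain C2 where C2: "\<And>\<alpha>p \<beta>p \<alpha>m \<beta>m \<delta>p \<delta>m. (\<alpha>p, \<beta>p, \<alpha>m, \<beta>m, \<delta>p, \<delta>m) \<in> Omega \<Longrightarrow>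
    \<delta>m \<le> D \<Longrightarrow> C2 \<le> \<delta>p \<Longrightarrow> norm (phi_hat (\<alpha>p, \<beta>p, \<alpha>m, \<beta>m, \<delta>p, \<delta>m) (- n)) < e"
    using phi_hat_small_of_drift[OF D(1) e, of "- n"] by auto
  \<comment> \<open>\<open>D\<close> has to come first, since the drift thresholds \<open>C1\<close>
    and \<open>C2\<close> depend on it. As \<open>D \<le> C\<close>, outside
    \<open>Omega_le C\<close> either one \<open>\<delta>\<close> exceeds \<open>C\<close> while the
    other is at most \<open>D\<close>, or both exceed \<open>D\<close>.\<close>
  define C where "C = max D (max C1 C2)"
  show ?thesis
  proof (intro exI[of _ C] ballI)
    fix \<omega> assume "\<omega> \<in> Omega - Omega_le C"
    moreover obtain \<alpha>p \<beta>p \<alpha>m \<beta>m \<delta>p \<delta>m where \<omega>: "\<omega> = (\<alpha>p, \<beta>p, \<alpha>m, \<beta>m, \<delta>p, \<delta>m)" by (cases \<omega>)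
    ultimately have mem: "(\<alpha>p, \<beta>p, \<alpha>m, \<beta>m, \<delta>p, \<delta>m) \<in> Omega" and out: "C < \<delta>p \<or> C < \<delta>m"
      by (auto simp: Omega_le_def)
    note mem' = Omega_swap[OF mem]
    have swap: "norm (phi_hat \<omega> n) = norm (phi_hat (\<alpha>m, \<beta>m, \<alpha>p, \<beta>p, \<delta>m, \<delta>p) (- n))"
      unfolding \<omega> phi_hat_swap[OF mem] by simp
    consider "\<delta>m \<le> D" "C < \<delta>p" | "\<delta>p \<le> D" "C < \<delta>m" | "D < \<delta>p" "D < \<delta>m"
      using out by (fastforce simp: C_def)
    then show "norm (phi_hat \<omega> n) < e"
    proof cases
      case 1
      then show ?thesis using C1[OF mem] by (simp add: \<omega> C_def)
    next
      case 2
      then show ?thesis using C2[OF mem'] unfolding swap by (simp add: C_def)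
    next
      case 3
      \<comment> \<open>Whichever sign has the small \<open>\<beta>\<close>, its own
        \<open>\<delta>\<close> exceeds \<open>D\<close>, so the spread estimate applies directly or
        after the swap.\<close>
      have "\<beta>p 0 \<le> 1 / 2 \<or> \<beta>m 0 \<le> 1 / 2" using Omega_ab(7)[OF mem, of 0 0] by linarith
      then show ?thesis
        using D(2)[OF mem, of n] D(2)[OF mem', of "- n"] 3 swap by (auto simp: \<omega>)
    qed
  qed
qed

section \<open>Expansions in the basis \<open>\<sigma>\<close>\<close>

lemma mcoeff_sum: "mcoeff (sum f A) M = (\<Sum>a\<in>A. mcoeff (f a) M)"
  by (induction A rule: infinite_finite_induct) auto

lemma mcoeff_phi: "mcoeff (phi n) M = (if M = {#n#} then 1 else 0)"
  unfolding phi_def by (subst mcoeff_Abs[where d = 1]) (auto split: if_splits)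

lemma mcoeff_signof_mult: "mcoeff (signof p * x) M = signof p * mcoeff x M"
  by (cases p rule: sign_cases) (auto simp: sign_def)

lemma mcoeff_monomial_mult:
  assumes "\<And>M. mcoeff x M = (if M = A then 1 else 0)" "\<And>M. mcoeff y M = (if M = B then 1 else 0)"
  shows "mcoeff (x * y) M = (if M = A + B then 1 else 0)"
proof -
  have "mcoeff (x * y) M = (\<Sum>p | fst p + snd p = M. if p = (A, B) then 1 else 0)"
    unfolding mcoeff_mult case_prod_unfold assms by (intro sum.cong) auto
  also have "\<dots> = (if M = A + B then 1 else 0)"
    using finite_mset_splits[of M, unfolded case_prod_unfold] by (subst sum.delta) auto
  finally show ?thesis .
qed

lemma mcoeff_prod_phi:
  "mcoeff (\<Prod>i = 0..<n. phi (g i)) M = (if M = image_mset g (mset_set {0..<n}) then 1 else 0)" for n :: nat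
proof (induction n arbitrary: M)
  case (Suc n)
  have "mcoeff ((\<Prod>i = 0..<n. phi (g i)) * phi (g n)) M
      = (if M = image_mset g (mset_set {0..<n}) + {#g n#} then 1 else 0)"
    by (rule mcoeff_monomial_mult) (auto simp: Suc mcoeff_phi)
  then show ?case by (simp add: atLeast0_lessThan_Suc mult.commute)
qed (simp add: mcoeff_1)

text \<open>The monomial contributed by the permutation \<open>p\<close> to the Leibniz expansion of
  \<open>sigma l\<close>.\<close>

definition sigma_monomial :: "int list \<Rightarrow> (nat \<Rightarrow> nat) \<Rightarrow> int multiset" where
  "sigma_monomial l p = image_mset (\<lambda>i. l ! i - int i + int (p i)) (mset_set {0..<length l})"

lemma mcoeff_sigma:
  "mcoeff (sigma l) M =
    (\<Sum>p | p permutes {0..<length l}. signof p * (if M = sigma_monomial l p then 1 else 0))"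
proof -
  have "sigma l = (\<Sum>p | p permutes {0..<length l}. signof p * (\<Prod>i = 0..<length l. phi (l ! i - int i + int (p i))))"
    unfolding sigma_def jacobi_trudi_det_def fdet_def[symmetric] fdet_leibniz ..
  then show ?thesis
    by (simp only: mcoeff_sum mcoeff_signof_mult mcoeff_prod_phi sigma_monomial_def)
qed

text \<open>The order parameter for triangularity: among the monomials of \<open>sigma l\<close> it
  is least at \<open>mset l\<close> only, and it bounds every index, so that only finitely many
  monomials of a given degree lie below a given value.\<close>

definition square_sum :: "int multiset \<Rightarrow> int" where
  "square_sum M = (\<Sum>m\<in>#M. m\<^sup>2)"

lemma square_sum_image: "finite A \<Longrightarrow> square_sum (image_mset g (mset_set A)) = (\<Sum>i\<in>A. (g i)\<^sup>2)"
  by (simp add: square_sum_def sum_unfold_sum_mset image_mset.compositionality o_def)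

lemma square_sum_nonneg: "0 \<le> square_sum M"
  by (induction M) (auto simp: square_sum_def)

lemma member_le_square_sum:
  assumes "m \<in># M"
  shows "\<bar>m\<bar> \<le> square_sum M"
proof -
  have "\<bar>m\<bar> * 1 \<le> \<bar>m\<bar> * \<bar>m\<bar>" by (cases "m = 0") (simp, rule mult_left_mono, auto)
  also have "\<dots> = m\<^sup>2" by (simp add: power2_eq_square)
  also have "m\<^sup>2 \<le> square_sum M"
  proof -
    obtain M' where "M = add_mset m M'" using assms by (metis mset_add)
    then show ?thesis using square_sum_nonneg[of M'] by (simp add: square_sum_def)
  qed
  finally show ?thesis by simp
qed

text \<open>Strict increase forces \<open>i \<le> p i\<close>, and the two sides have the same
  sum.\<close>

lemma permutes_increasing_eq_id:
  fixes n :: nat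
  assumes p: "p permutes {0..<n}" and inc: "\<And>i j. i < j \<Longrightarrow> j < n \<Longrightarrow> p i < p j"
  shows "p = id"
proof -
  have ge: "i \<le> p i" if "i < n" for i
    using that
  proof (induction i)
    case (Suc i)
    then show ?case using inc[of i "Suc i"] by simp
  qed simp
  have "(\<Sum>i = 0..<n. p i) = (\<Sum>i = 0..<n. i)"
    using sum.permute[OF p, of "\<lambda>i. i"] by (simp add: o_def)
  then have "(\<Sum>i = 0..<n. p i - i) = 0"
    using sum_subtractf_nat[of "{0..<n}" "\<lambda>i. i" p] ge by simp
  then have le: "p i \<le> i" if "i < n" for i using that by auto
  show ?thesis
  proof
    fix i show "p i = id i"
      using le[of i] ge[of i] permutes_not_in[OF p, of i] by (cases "i < n") auto
  qed
qed

text \<open>Undoing an inversion of \<open>p\<close> lowers the sum, so that the minimum over all permutations is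
  attained at the identity only.\<close>

lemma rearrangement_squares:
  fixes x :: "nat \<Rightarrow> int"
  assumes x: "sdec n x" and p: "p permutes {0..<n}" "p \<noteq> id"
  shows "(\<Sum>i = 0..<n. (x i + int i)\<^sup>2) < (\<Sum>i = 0..<n. (x i + int (p i))\<^sup>2)"
proof -
  define T where "T p = (\<Sum>i = 0..<n. (x i + int (p i))\<^sup>2)" for p
  have step: "\<exists>p'. p' permutes {0..<n} \<and> T p' < T p" if p: "p permutes {0..<n}" "p \<noteq> id" for p
  proof -
    obtain i j where ij: "i < j" "j < n" "\<not> p i < p j"
      using permutes_increasing_eq_id[OF p(1)] p(2) by blast
    have "p i \<noteq> p j" using ij permutes_inj[OF p(1)] by (auto dest: injD)
    then have pij: "p j < p i" using ij by simp
    let ?p = "p \<circ> Transposition.transpose i j"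
    let ?R = "{0..<n} - {i} - {j}"
    have perm: "?p permutes {0..<n}"
      using ij by (intro permutes_compose[OF _ p(1)] permutes_swap_id) auto
    have split: "T q = (x i + int (q i))\<^sup>2 + ((x j + int (q j))\<^sup>2 + (\<Sum>k\<in>?R. (x k + int (q k))\<^sup>2))" for q
    proof -
      have "T q = (x i + int (q i))\<^sup>2 + (\<Sum>k\<in>{0..<n} - {i}. (x k + int (q k))\<^sup>2)"
        unfolding T_def using ij by (intro sum.remove) auto
      also have "(\<Sum>k\<in>{0..<n} - {i}. (x k + int (q k))\<^sup>2) = (x j + int (q j))\<^sup>2 + (\<Sum>k\<in>?R. (x k + int (q k))\<^sup>2)"
        using ij by (intro sum.remove) auto
      finally show ?thesis .
    qed
    have "(\<Sum>k\<in>?R. (x k + int (?p k))\<^sup>2) = (\<Sum>k\<in>?R. (x k + int (p k))\<^sup>2)"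
      by (intro sum.cong) (auto simp: transpose_def)
    moreover have "(x i + int (p j))\<^sup>2 + (x j + int (p i))\<^sup>2 < (x i + int (p i))\<^sup>2 + (x j + int (p j))\<^sup>2"
    proof -
      have "0 < (x i - x j) * (int (p i) - int (p j))"
        using x ij pij by (intro mult_pos_pos) (auto simp: sdec_def)
      then show ?thesis by (simp add: power2_eq_square algebra_simps)
    qed
    ultimately have "T ?p < T p"
      unfolding split[of ?p] split[of p] by simp
    with perm show ?thesis by blast
  qed
  have fin: "finite {p. p permutes {0..<n}}" by (simp add: finite_permutations)
  have min: "\<exists>m\<in>{p. p permutes {0..<n}}. \<forall>q\<in>{p. p permutes {0..<n}}. T m \<le> T q"
  proof -
    have "Min (T ` {p. p permutes {0..<n}}) \<in> T ` {p. p permutes {0..<n}}"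
      using fin p(1) by (intro Min_in) auto
    then obtain m where "m \<in> {p. p permutes {0..<n}}" "Min (T ` {p. p permutes {0..<n}}) = T m" by auto
    moreover have "Min (T ` {p. p permutes {0..<n}}) \<le> T q" if "q \<in> {p. p permutes {0..<n}}" for q
      using fin that by (intro Min_le) auto
    ultimately show ?thesis by auto
  qed
  then obtain m where m: "m permutes {0..<n}" "\<And>q. q permutes {0..<n} \<Longrightarrow> T m \<le> T q" by auto
  have "m = id" using step[OF m(1)] m(2) by (meson not_le)
  obtain p' where "p' permutes {0..<n}" "T p' < T p" using step[OF p] by blast
  then have "T id < T p" using m(2)[of p'] \<open>m = id\<close> by simp
  then show ?thesis by (simp add: T_def)
qed

lemma sigma_monomial_id: "sigma_monomial l id = mset l"
proof -
  have "sigma_monomial l id = image_mset ((!) l) (mset [0..<length l])"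
    by (simp add: sigma_monomial_def)
  also have "\<dots> = mset (map ((!) l) [0..<length l])" by (simp only: mset_map)
  finally show ?thesis by (simp only: map_nth)
qed

lemma square_sum_sigma_monomial:
  assumes "l \<in> sigs N" "p permutes {0..<N}" "p \<noteq> id"
  shows "square_sum (mset l) < square_sum (sigma_monomial l p)"
proof -
  have N: "length l = N" using assms by (simp add: sigs_def)
  have "sdec N (\<lambda>i. l ! i - int i)"
    unfolding sdec_def
  proof (intro allI impI)
    fix i j assume ij: "i < j" "j < N"
    then have "l ! j \<le> l ! i" using assms(1) by (auto simp: sigs_def sorted_wrt_iff_nth_less)
    then show "l ! j - int j < l ! i - int i" using ij by simp
  qed
  from rearrangement_squares[OF this assms(2,3)]
  show ?thesis
    unfolding sigma_monomial_id[symmetric] sigma_monomial_def N by (simp add: square_sum_image)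
qed

text \<open>Triangularity: every permutation other than the identity contributes a monomial with
  larger sum of squares. Together with the coefficient 1 at \<open>mset l\<close>, this makes the
  passage to the \<open>sigma l\<close> unitriangular.\<close>

lemma mcoeff_sigma_nonzero:
  assumes "l \<in> sigs N" "mcoeff (sigma l) M \<noteq> 0"
  shows "size M = N" "M = mset l \<or> square_sum (mset l) < square_sum M"
proof -
  have N: "length l = N" using assms by (simp add: sigs_def)
  obtain p where "p \<in> {p. p permutes {0..<N}}" "signof p * (if M = sigma_monomial l p then 1 else 0 :: complex) \<noteq> 0"
    using assms(2) unfolding mcoeff_sigma N by (rule sum.not_neutral_contains_not_neutral)
  then have p: "p permutes {0..<N}" "M = sigma_monomial l p" by (auto split: if_splits)
  then show "size M = N" by (simp add: sigma_monomial_def N)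
  show "M = mset l \<or> square_sum (mset l) < square_sum M"
    using square_sum_sigma_monomial[OF assms(1) p(1)] p(2) sigma_monomial_id by (cases "p = id") auto
qed

lemma mcoeff_sigma_diag:
  assumes "l \<in> sigs N"
  shows "mcoeff (sigma l) (mset l) = 1"
proof -
  have N: "length l = N" using assms by (simp add: sigs_def)
  have "mset l \<noteq> sigma_monomial l p" if "p permutes {0..<N}" "p \<noteq> id" for p
    using square_sum_sigma_monomial[OF assms that] by auto
  then have "mcoeff (sigma l) (mset l) = (\<Sum>p\<in>{id}. signof p * (if mset l = sigma_monomial l p then 1 else 0))"
    unfolding mcoeff_sigma N
    by (intro sum.mono_neutral_right) (auto simp: finite_permutations permutes_id)
  then show ?thesis by (simp add: sigma_monomial_id)
qed

section \<open>Solving the triangular system: existence and uniqueness of expansions\<close>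

definition signature_of :: "int multiset \<Rightarrow> int list" where
  "signature_of M = rev (sorted_list_of_multiset M)"

lemma mset_signature_of [simp]: "mset (signature_of M) = M"
  by (simp add: signature_of_def)

lemma signature_of_in_sigs: "signature_of M \<in> sigs (size M)"
proof -
  have "length (signature_of M) = size M" by (metis mset_signature_of size_mset)
  then show ?thesis by (simp add: sigs_def signature_of_def sorted_wrt_rev)
qed

lemma signature_of_mset:
  assumes "l \<in> sigs N"
  shows "signature_of (mset l) = l"
proof -
  have "sorted (rev l)" using assms by (simp add: sigs_def sorted_wrt_rev)
  then have "sort l = rev l" by (intro properties_for_sort) auto
  then show ?thesis by (simp add: signature_of_def)
qed

lemma sigs_subset_all_sigs: "sigs N \<subseteq> all_sigs"
  by (auto simp: all_sigs_def)

lemma in_all_sigsD: "l \<in> all_sigs \<Longrightarrow> l \<in> sigs (length l)"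
  by (auto simp: all_sigs_def sigs_def)

definition sigma_support :: "int multiset \<Rightarrow> int list set" where
  "sigma_support M = {l \<in> all_sigs. mcoeff (sigma l) M \<noteq> 0}"

lemma sigma_supportD:
  assumes "l \<in> sigma_support M"
  shows "l \<in> sigs (size M)" "l = signature_of M \<or> square_sum (mset l) < square_sum M"
proof -
  have l: "l \<in> sigs (length l)" "mcoeff (sigma l) M \<noteq> 0"
    using assms in_all_sigsD by (auto simp: sigma_support_def)
  show "l \<in> sigs (size M)" using l mcoeff_sigma_nonzero(1)[OF l] by simp
  show "l = signature_of M \<or> square_sum (mset l) < square_sum M"
    using mcoeff_sigma_nonzero(2)[OF l] signature_of_mset[OF l(1)] by auto
qed

lemma signature_of_in_support: "signature_of M \<in> sigma_support M"
  using mcoeff_sigma_diag[OF signature_of_in_sigs[of M]] signature_of_in_sigs[of M] sigs_subset_all_sigs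
  by (auto simp: sigma_support_def)

text \<open>A signature \<open>l\<close> in the support has
  \<open>square_sum (mset l) \<le> square_sum M\<close>, which bounds its entries, and its length is
  the size of \<open>M\<close>.\<close>

lemma finite_sigma_support: "finite (sigma_support M)"
proof (rule finite_subset)
  show "sigma_support M \<subseteq> {l. set l \<subseteq> {- square_sum M..square_sum M} \<and> length l = size M}"
  proof
    fix l assume l: "l \<in> sigma_support M"
    have "square_sum (mset l) \<le> square_sum M"
      using sigma_supportD(2)[OF l] by auto
    then have "\<bar>m\<bar> \<le> square_sum M" if "m \<in> set l" for m
      using member_le_square_sum[of m "mset l"] that by simp
    then have "set l \<subseteq> {- square_sum M..square_sum M}" by (auto simp: abs_le_iff minus_le_iff)
    then show "l \<in> {l. set l \<subseteq> {- square_sum M..square_sum M} \<and> length l = size M}"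
      using sigma_supportD(1)[OF l] by (simp add: sigs_def)
  qed
qed (simp add: finite_lists_length_eq)

lemma sigma_expansion_iff:
  "sigma_expansion x a \<longleftrightarrow> (\<forall>l. l \<notin> all_sigs \<longrightarrow> a l = 0) \<and>
     (\<forall>M. mcoeff x M = (\<Sum>l\<in>sigma_support M. a l * mcoeff (sigma l) M))"
  by (simp add: sigma_expansion_def sigma_support_def)

lemma sum_sigma_support:
  "(\<Sum>l\<in>sigma_support M. a l * mcoeff (sigma l) M) =
    a (signature_of M) + (\<Sum>l\<in>sigma_support M - {signature_of M}. a l * mcoeff (sigma l) M)"
  using mcoeff_sigma_diag[OF signature_of_in_sigs[of M]]
  by (subst sum.remove[OF finite_sigma_support signature_of_in_support]) simp

text \<open>Forward substitution: the equation for the monomial \<open>M\<close> determines the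
  unknown at \<open>signature_of M\<close> from those with smaller \<open>square_sum\<close>.
  Unknowns are indexed by multisets, which correspond to signatures.\<close>

function triangular_coeff :: "phi_series \<Rightarrow> int multiset \<Rightarrow> complex" where
  "triangular_coeff x M = mcoeff x M -
     (\<Sum>l\<in>sigma_support M - {signature_of M}. triangular_coeff x (mset l) * mcoeff (sigma l) M)"
  by pat_completeness auto
termination
proof (relation "Wellfounded.measure (\<lambda>(x, M). nat (square_sum M))")
  fix M l assume "l \<in> sigma_support M - {signature_of M}"
  then have "square_sum (mset l) < square_sum M" using sigma_supportD(2) by blast
  with square_sum_nonneg[of "mset l"] show "((x, mset l), (x, M)) \<in> Wellfounded.measure (\<lambda>(x, M). nat (square_sum M))" for x :: phi_series
    by simp
qed simp

declare triangular_coeff.simps [simp del]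

lemma sigma_expansion_exists: "\<exists>a. sigma_expansion x a"
proof (rule exI)
  let ?a = "\<lambda>l. if l \<in> all_sigs then triangular_coeff x (mset l) else 0"
  have "signature_of M \<in> all_sigs" for M
    using signature_of_in_sigs sigs_subset_all_sigs by blast
  moreover have "(\<Sum>l\<in>sigma_support M - {signature_of M}. ?a l * mcoeff (sigma l) M) =
      (\<Sum>l\<in>sigma_support M - {signature_of M}. triangular_coeff x (mset l) * mcoeff (sigma l) M)" for M
    by (intro sum.cong) (auto simp: sigma_support_def)
  moreover have "mcoeff x M = triangular_coeff x M +
      (\<Sum>l\<in>sigma_support M - {signature_of M}. triangular_coeff x (mset l) * mcoeff (sigma l) M)" for M
    by (subst triangular_coeff.simps) simp
  ultimately show "sigma_expansion x ?a"
    unfolding sigma_expansion_iff sum_sigma_support by auto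
qed

text \<open>Induction on \<open>square_sum\<close>: in the equation for \<open>M\<close> all terms
  but the diagonal one vanish already. By linearity this gives uniqueness, and so the description
  defining \<open>sigma_coeff\<close> denotes.\<close>

lemma sigma_expansion_zero_unique:
  assumes "sigma_expansion 0 a"
  shows "a l = 0"
proof (cases "l \<in> all_sigs")
  case False
  then show ?thesis using assms by (simp add: sigma_expansion_iff)
next
  case True
  have "a (signature_of M) = 0" for M
  proof (induction "nat (square_sum M)" arbitrary: M rule: less_induct)
    case less
    have "a l = 0" if l: "l \<in> sigma_support M - {signature_of M}" for l
    proof -
      have "square_sum (mset l) < square_sum M" using l sigma_supportD(2) by blast
      with square_sum_nonneg[of "mset l"] have "a (signature_of (mset l)) = 0" by (intro less) simp
      then show ?thesis using l sigma_supportD(1) signature_of_mset by fastforce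
    qed
    then have "(\<Sum>l\<in>sigma_support M - {signature_of M}. a l * mcoeff (sigma l) M) = 0"
      by (intro sum.neutral) simp
    moreover have "0 = (\<Sum>l\<in>sigma_support M. a l * mcoeff (sigma l) M)"
      using assms by (simp add: sigma_expansion_iff)
    ultimately show ?case unfolding sum_sigma_support by simp
  qed
  from this[of "mset l"] show ?thesis using signature_of_mset[OF in_all_sigsD[OF True]] by simp
qed

lemma sigma_expansion_add:
  "sigma_expansion x a \<Longrightarrow> sigma_expansion y b \<Longrightarrow> sigma_expansion (x + y) (\<lambda>l. a l + b l)"
  by (simp add: sigma_expansion_iff sum.distrib distrib_right)

lemma sigma_expansion_diff:
  "sigma_expansion x a \<Longrightarrow> sigma_expansion y b \<Longrightarrow> sigma_expansion (x - y) (\<lambda>l. a l - b l)"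
  by (simp add: sigma_expansion_iff sum_subtractf left_diff_distrib)

lemma sigma_expansion_unique:
  assumes "sigma_expansion x a" "sigma_expansion x b"
  shows "a = b"
proof
  fix l
  have "sigma_expansion 0 (\<lambda>l. a l - b l)" using sigma_expansion_diff[OF assms] by simp
  from sigma_expansion_zero_unique[OF this] show "a l = b l" by simp
qed

lemma sigma_coeff_eqI: "sigma_expansion x a \<Longrightarrow> sigma_coeff x = a"
  unfolding sigma_coeff_def using sigma_expansion_unique by blast

lemma sigma_expansion_sigma_coeff: "sigma_expansion x (sigma_coeff x)"
  using sigma_expansion_exists[of x] sigma_coeff_eqI by metis

lemma sigma_coeff_add: "sigma_coeff (x + y) l = sigma_coeff x l + sigma_coeff y l"
  using sigma_coeff_eqI[OF sigma_expansion_add[OF sigma_expansion_sigma_coeff sigma_expansion_sigma_coeff]]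
  by metis

lemma sigma_coeff_zero: "sigma_coeff 0 l = 0"
  by (rule sigma_expansion_zero_unique[OF sigma_expansion_sigma_coeff])

lemma sigma_coeff_sum: "sigma_coeff (sum f A) l = (\<Sum>a\<in>A. sigma_coeff (f a) l)"
  by (induction A rule: infinite_finite_induct) (auto simp: sigma_coeff_zero sigma_coeff_add)

text \<open>Cutting the coefficients down to \<open>sigs N\<close> gives another expansion of
  \<open>x\<close>, because \<open>sigma l\<close> is homogeneous of degree the length of
  \<open>l\<close>; uniqueness then identifies the two.\<close>

lemma sigma_coeff_graded:
  assumes x: "x \<in> graded N" and l: "l \<notin> sigs N"
  shows "sigma_coeff x l = 0"
proof -
  note ex = sigma_expansion_sigma_coeff[of x, unfolded sigma_expansion_iff]
  have "sigma_expansion x (\<lambda>l. if l \<in> sigs N then sigma_coeff x l else 0)"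
    unfolding sigma_expansion_iff
  proof (intro conjI allI impI)
    fix M
    show "mcoeff x M = (\<Sum>l\<in>sigma_support M. (if l \<in> sigs N then sigma_coeff x l else 0) * mcoeff (sigma l) M)"
    proof (cases "size M = N")
      case True
      then show ?thesis using ex sigma_supportD(1)[of _ M] by (auto intro!: sum.cong)
    next
      case False
      then have "l \<notin> sigs N" if "l \<in> sigma_support M" for l
        using sigma_supportD(1)[OF that] by (auto simp: sigs_def)
      moreover have "mcoeff x M = 0" using x False by (auto simp: graded_def)
      ultimately show ?thesis by (simp add: sum.neutral)
    qed
  qed (use sigs_subset_all_sigs in auto)
  then have "sigma_coeff x = (\<lambda>l. if l \<in> sigs N then sigma_coeff x l else 0)"
    by (rule sigma_coeff_eqI)
  then show ?thesis using l by metis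
qed

section \<open>Functions vanishing at infinity\<close>

lemma C0_OmegaD:
  assumes "f \<in> C0_Omega"
  shows "continuous_on Omega f" "\<exists>B>0. \<forall>\<omega>\<in>Omega. norm (f \<omega>) \<le> B"
    "0 < e \<Longrightarrow> \<exists>K. compact K \<and> K \<subseteq> Omega \<and> (\<forall>\<omega>\<in>Omega - K. norm (f \<omega>) < e)"
  using assms by (auto simp: C0_Omega_def C_Omega_def bounded_pos)

lemma C0_OmegaI:
  assumes "continuous_on Omega f" "\<And>\<omega>. \<omega> \<in> Omega \<Longrightarrow> norm (f \<omega>) \<le> B"
    and "\<And>e. 0 < e \<Longrightarrow> \<exists>K. compact K \<and> K \<subseteq> Omega \<and> (\<forall>\<omega>\<in>Omega - K. norm (f \<omega>) < e)"
  shows "f \<in> C0_Omega"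
proof -
  have "bounded (f ` Omega)" unfolding bounded_iff using assms(2) by blast
  then show ?thesis using assms(1,3) by (simp add: C0_Omega_def C_Omega_def)
qed

lemma zero_in_C0_Omega: "(\<lambda>_. 0) \<in> C0_Omega"
  by (rule C0_OmegaI[where B = 0]) (auto intro!: exI[of _ "{}"])

lemma C0_Omega_add:
  assumes f: "f \<in> C0_Omega" and g: "g \<in> C0_Omega"
  shows "(\<lambda>\<omega>. f \<omega> + g \<omega>) \<in> C0_Omega"
proof -
  obtain B B' where B: "\<And>\<omega>. \<omega> \<in> Omega \<Longrightarrow> norm (f \<omega>) \<le> B" "\<And>\<omega>. \<omega> \<in> Omega \<Longrightarrow> norm (g \<omega>) \<le> B'"
    using C0_OmegaD(2)[OF f] C0_OmegaD(2)[OF g] by auto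
  show ?thesis
  proof (rule C0_OmegaI[where B = "B + B'"])
    show "continuous_on Omega (\<lambda>\<omega>. f \<omega> + g \<omega>)"
      by (intro continuous_intros C0_OmegaD(1) f g)
    show "norm (f \<omega> + g \<omega>) \<le> B + B'" if "\<omega> \<in> Omega" for \<omega>
      using B[OF that] norm_triangle_mono by blast
    fix e :: real assume e: "0 < e"
    obtain K K' where K: "compact K" "K \<subseteq> Omega" "\<forall>\<omega>\<in>Omega - K. norm (f \<omega>) < e / 2"
      and K': "compact K'" "K' \<subseteq> Omega" "\<forall>\<omega>\<in>Omega - K'. norm (g \<omega>) < e / 2"
      using C0_OmegaD(3)[OF f, of "e / 2"] C0_OmegaD(3)[OF g, of "e / 2"] e by auto
    have "norm (f \<omega> + g \<omega>) < e" if "\<omega> \<in> Omega - (K \<union> K')" for \<omega>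
    proof -
      have "norm (f \<omega>) < e / 2" "norm (g \<omega>) < e / 2" using K(3) K'(3) that by auto
      then show ?thesis using norm_triangle_ineq[of "f \<omega>" "g \<omega>"] by linarith
    qed
    then show "\<exists>K. compact K \<and> K \<subseteq> Omega \<and> (\<forall>\<omega>\<in>Omega - K. norm (f \<omega> + g \<omega>) < e)"
      using K K' by (intro exI[of _ "K \<union> K'"]) (auto intro: compact_Un)
  qed
qed

lemma C0_Omega_mult_bounded:
  assumes f: "f \<in> C0_Omega" and g: "continuous_on Omega g" "0 < B" "\<And>\<omega>. \<omega> \<in> Omega \<Longrightarrow> norm (g \<omega>) \<le> B"
  shows "(\<lambda>\<omega>. g \<omega> * f \<omega>) \<in> C0_Omega"
proof -
  obtain B' where B': "\<And>\<omega>. \<omega> \<in> Omega \<Longrightarrow> norm (f \<omega>) \<le> B'"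
    using C0_OmegaD(2)[OF f] by auto
  show ?thesis
  proof (rule C0_OmegaI[where B = "B * B'"])
    show "continuous_on Omega (\<lambda>\<omega>. g \<omega> * f \<omega>)"
      by (intro continuous_intros C0_OmegaD(1) f g)
    show "norm (g \<omega> * f \<omega>) \<le> B * B'" if "\<omega> \<in> Omega" for \<omega>
      using B'[OF that] g(2) g(3)[OF that] unfolding norm_mult by (intro mult_mono) auto
    fix e :: real assume e: "0 < e"
    then obtain K where K: "compact K" "K \<subseteq> Omega" "\<forall>\<omega>\<in>Omega - K. norm (f \<omega>) < e / B"
      using C0_OmegaD(3)[OF f, of "e / B"] g(2) by auto
    have "norm (g \<omega> * f \<omega>) < e" if w: "\<omega> \<in> Omega - K" for \<omega>
    proof -
      have "norm (g \<omega> * f \<omega>) \<le> B * norm (f \<omega>)"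
        using g(3)[of \<omega>] w unfolding norm_mult by (intro mult_right_mono) auto
      also have "\<dots> < B * (e / B)" using K(3) w g(2) by (intro mult_strict_left_mono) auto
      also have "\<dots> = e" using g(2) by simp
      finally show ?thesis .
    qed
    then show "\<exists>K. compact K \<and> K \<subseteq> Omega \<and> (\<forall>\<omega>\<in>Omega - K. norm (g \<omega> * f \<omega>) < e)"
      using K by blast
  qed
qed

lemma C0_Omega_mult:
  assumes "f \<in> C0_Omega" "g \<in> C0_Omega"
  shows "(\<lambda>\<omega>. g \<omega> * f \<omega>) \<in> C0_Omega"
  using C0_OmegaD(1,2)[OF assms(2)] C0_Omega_mult_bounded[OF assms(1)] by blast

lemma C0_Omega_cmult:
  assumes "f \<in> C0_Omega"
  shows "(\<lambda>\<omega>. c * f \<omega>) \<in> C0_Omega"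
  by (rule C0_Omega_mult_bounded[OF assms, where B = "norm c + 1"]) (auto intro: add_nonneg_pos)

lemma C0_Omega_sum:
  "(\<And>a. a \<in> A \<Longrightarrow> f a \<in> C0_Omega) \<Longrightarrow> (\<lambda>\<omega>. \<Sum>a\<in>A. f a \<omega>) \<in> C0_Omega"
  by (induction A rule: infinite_finite_induct) (auto intro: C0_Omega_add zero_in_C0_Omega)

text \<open>The empty product is the constant 1, which does not vanish at infinity on a noncompact
  space; hence \<open>Suc n\<close> factors. This is where degree 0 is excluded.\<close>

lemma C0_Omega_prod:
  assumes "\<And>i. i < Suc n \<Longrightarrow> f i \<in> C0_Omega"
  shows "(\<lambda>\<omega>. \<Prod>i = 0..<Suc n. f i \<omega>) \<in> C0_Omega"
  using assms
proof (induction n)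
  case (Suc n)
  have "(\<lambda>\<omega>. (\<Prod>i = 0..<Suc n. f i \<omega>) * f (Suc n) \<omega>) \<in> C0_Omega"
    by (rule C0_Omega_mult) (use Suc in auto)
  then show ?case by simp
qed simp

lemma C0_Omega_uniform_limit:
  assumes "\<And>e. 0 < e \<Longrightarrow> \<exists>g\<in>C0_Omega. \<forall>\<omega>\<in>Omega. norm (f \<omega> - g \<omega>) \<le> e"
  shows "f \<in> C0_Omega"
proof -
  obtain g1 where g1: "g1 \<in> C0_Omega" "\<And>\<omega>. \<omega> \<in> Omega \<Longrightarrow> norm (f \<omega> - g1 \<omega>) \<le> 1"
    using assms[of 1] by auto
  obtain B where B: "\<And>\<omega>. \<omega> \<in> Omega \<Longrightarrow> norm (g1 \<omega>) \<le> B"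
    using C0_OmegaD(2)[OF g1(1)] by auto
  show ?thesis
  proof (rule C0_OmegaI[where B = "B + 1"])
    have "\<exists>g. g \<in> C0_Omega \<and> (\<forall>\<omega>\<in>Omega. norm (f \<omega> - g \<omega>) \<le> inverse (real (Suc n)))" for n
      using assms[of "inverse (real (Suc n))"] by (simp add: Bex_def)
    then obtain g where "\<forall>n. g n \<in> C0_Omega \<and> (\<forall>\<omega>\<in>Omega. norm (f \<omega> - g n \<omega>) \<le> inverse (real (Suc n)))"
      by (rule choice[OF allI, THEN exE])
    then have g: "\<And>n. g n \<in> C0_Omega" "\<And>n \<omega>. \<omega> \<in> Omega \<Longrightarrow> norm (f \<omega> - g n \<omega>) \<le> inverse (real (Suc n))"
      by blast+
    have "uniform_limit Omega g f sequentially"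
    proof (rule uniform_limitI)
      fix e :: real assume "0 < e"
      then have "\<forall>\<^sub>F n in sequentially. inverse (real (Suc n)) < e"
        using LIMSEQ_inverse_real_of_nat by (rule order_tendstoD(2)[rotated])
      then show "\<forall>\<^sub>F n in sequentially. \<forall>\<omega>\<in>Omega. dist (g n \<omega>) (f \<omega>) < e"
      proof eventually_elim
        case (elim n)
        show ?case
        proof
          fix \<omega> assume "\<omega> \<in> Omega"
          from order_le_less_trans[OF g(2)[OF this] elim] show "dist (g n \<omega>) (f \<omega>) < e"
            by (simp only: dist_norm norm_minus_commute)
        qed
      qed
    qed
    then show "continuous_on Omega f"
      by (rule uniform_limit_theorem[rotated]) (auto intro!: always_eventually C0_OmegaD(1) g)
    show "norm (f \<omega>) \<le> B + 1" if "\<omega> \<in> Omega" for \<omega>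
      using g1(2)[OF that] B[OF that] norm_triangle_sub[of "f \<omega>" "g1 \<omega>"] by linarith
    fix e :: real assume e: "0 < e"
    then obtain h where h: "h \<in> C0_Omega" "\<And>\<omega>. \<omega> \<in> Omega \<Longrightarrow> norm (f \<omega> - h \<omega>) \<le> e / 2"
      using assms[of "e / 2"] by auto
    obtain K where K: "compact K" "K \<subseteq> Omega" "\<forall>\<omega>\<in>Omega - K. norm (h \<omega>) < e / 2"
      using C0_OmegaD(3)[OF h(1), of "e / 2"] e by auto
    have "norm (f \<omega>) < e" if "\<omega> \<in> Omega - K" for \<omega>
    proof -
      have "norm (f \<omega> - h \<omega>) \<le> e / 2" "norm (h \<omega>) < e / 2" using h(2) K(3) that by auto
      then show ?thesis using norm_triangle_sub[of "f \<omega>" "h \<omega>"] by linarith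
    qed
    then show "\<exists>K. compact K \<and> K \<subseteq> Omega \<and> (\<forall>\<omega>\<in>Omega - K. norm (f \<omega>) < e)"
      using K by blast
  qed
qed

lemma phi_hat_in_C0_Omega: "(\<lambda>\<omega>. phi_hat \<omega> n) \<in> C0_Omega"
proof (rule C0_OmegaI[OF continuous_on_phi_hat norm_phi_hat_le_one])
  fix e :: real assume "0 < e"
  then obtain C where "\<forall>\<omega>\<in>Omega - Omega_le C. norm (phi_hat \<omega> n) < e"
    using phi_hat_vanishes by blast
  then show "\<exists>K. compact K \<and> K \<subseteq> Omega \<and> (\<forall>\<omega>\<in>Omega - K. norm (phi_hat \<omega> n) < e)"
    using compact_Omega_le Omega_le_subset by blast
qed

lemma sigma_hat_in_C0_Omega:
  assumes "l \<in> sigs N" "1 \<le> N"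
  shows "sigma_hat l \<in> C0_Omega"
proof -
  obtain n where n: "length l = Suc n" using assms by (cases N) (auto simp: sigs_def)
  have "(\<lambda>\<omega>. \<Sum>p | p permutes {0..<Suc n}. signof p * (\<Prod>i = 0..<Suc n. phi_hat \<omega> (l ! i - int i + int (p i)))) \<in> C0_Omega"
    by (intro C0_Omega_sum C0_Omega_cmult C0_Omega_prod phi_hat_in_C0_Omega)
  moreover have "sigma_hat l = (\<lambda>\<omega>. \<Sum>p | p permutes {0..<Suc n}.
      signof p * (\<Prod>i = 0..<Suc n. phi_hat \<omega> (l ! i - int i + int (p i))))"
    unfolding sigma_hat_def[abs_def] jacobi_trudi_det_fdet[OF n] fdet_leibniz ..
  ultimately show ?thesis by simp
qed

section \<open>The homomorphism on series\<close>

text \<open>The dimension-weighted sums are at most 1 at every point, so \<open>Dim l\<close> in the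
  bound for the coefficients is absorbed and the estimate is uniform in \<open>\<omega>\<close>. The
  set \<open>G\<close> will be the complement of a finite exceptional set.\<close>

lemma sigma_series_bound:
  assumes \<omega>: "\<omega> \<in> Omega" and G: "G \<subseteq> sigs N" and e: "0 \<le> e"
    and a: "\<And>l. l \<in> G \<Longrightarrow> norm (a l) \<le> e * Dim l"
  shows "(\<lambda>l. a l * sigma_hat l \<omega>) summable_on G" "norm (infsum (\<lambda>l. a l * sigma_hat l \<omega>) G) \<le> e"
proof -
  define d where "d l = Dim l * norm (sigma_hat l \<omega>)" for l
  have d0: "0 \<le> d l" if "l \<in> sigs N" for l
    using Dim_pos[OF that] by (simp add: d_def)
  have le1: "sum d F \<le> 1" if "finite F" "F \<subseteq> G" for F
    using sigma_hat_nonneg_and_sum_le_one(2)[OF \<omega> that(1)] that(2) G unfolding d_def by blast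
  have d: "d summable_on G"
    by (rule nonneg_bdd_above_summable_on) (use d0 G le1 in \<open>auto intro!: bdd_aboveI[of _ 1]\<close>)
  have inf_d: "infsum d G \<le> 1"
    by (rule infsum_le_finite_sums[OF d]) (use le1 in auto)
  have bd: "norm (a l * sigma_hat l \<omega>) \<le> e * d l" if "l \<in> G" for l
    using mult_right_mono[OF a[OF that], of "norm (sigma_hat l \<omega>)"] by (simp add: norm_mult d_def mult_ac)
  have ed: "(\<lambda>l. e * d l) summable_on G" by (intro summable_on_cmult_right d)
  have abs: "(\<lambda>l. norm (a l * sigma_hat l \<omega>)) summable_on G"
    by (rule summable_on_comparison_test[OF ed bd]) auto
  then show "(\<lambda>l. a l * sigma_hat l \<omega>) summable_on G" by (rule abs_summable_summable)
  have "norm (infsum (\<lambda>l. a l * sigma_hat l \<omega>) G) \<le> infsum (\<lambda>l. norm (a l * sigma_hat l \<omega>)) G"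
    by (rule norm_infsum_bound[OF abs])
  also have "\<dots> \<le> infsum (\<lambda>l. e * d l) G" by (rule infsum_mono[OF abs ed bd])
  also have "\<dots> = e * infsum d G" by (simp add: infsum_cmult_right')
  also have "\<dots> \<le> e" using mult_left_mono[OF inf_d e] by simp
  finally show "norm (infsum (\<lambda>l. a l * sigma_hat l \<omega>) G) \<le> e" .
qed

lemma scrR0_graded_exceptional:
  assumes y: "y \<in> scrR0_graded N" and e: "0 < e"
  shows "\<exists>E. finite E \<and> E \<subseteq> sigs N \<and> (\<forall>l\<in>sigs N - E. norm (sigma_coeff y l) \<le> e * Dim l)"
proof (intro exI conjI ballI)
  let ?E = "{l \<in> sigs N. \<not> norm (sigma_coeff y l) / Dim l \<le> e}"
  show "finite ?E" using y e by (simp add: scrR0_graded_def)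
  show "?E \<subseteq> sigs N" by auto
  show "norm (sigma_coeff y l) \<le> e * Dim l" if "l \<in> sigs N - ?E" for l
    using that Dim_pos[of l N] by (auto simp: divide_le_eq)
qed

text \<open>The series is split into the finitely many exceptional terms and a remainder controlled
  by \<open>sigma_series_bound\<close>. The set \<open>E\<close> may be chosen independently of
  \<open>\<omega>\<close>, which turns the second claim into uniform approximation.\<close>

lemma series_hat_decompose:
  assumes y: "y \<in> scrR0_graded N" and \<omega>: "\<omega> \<in> Omega"
    and E: "finite E" "E \<subseteq> sigs N" and rest: "\<And>l. l \<in> sigs N - E \<Longrightarrow> norm (sigma_coeff y l) \<le> e * Dim l"
    and e: "0 \<le> e"
  shows "((\<lambda>l. sigma_coeff y l * sigma_hat l \<omega>) has_sum series_hat y \<omega>) all_sigs"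
    and "norm (series_hat y \<omega> - (\<Sum>l\<in>E. sigma_coeff y l * sigma_hat l \<omega>)) \<le> e"
proof -
  let ?f = "\<lambda>l. sigma_coeff y l * sigma_hat l \<omega>"
  have zero: "sigma_coeff y l = 0" if "l \<notin> sigs N" for l
    using sigma_coeff_graded y that by (auto simp: scrR0_graded_def)
  note bound = sigma_series_bound[OF \<omega> _ e, of "sigs N - E" N "sigma_coeff y", OF Diff_subset rest]
  have "(?f has_sum infsum ?f (sigs N - E)) (sigs N - E)"
    by (rule has_sum_infsum[OF bound(1)])
  then have "(?f has_sum (sum ?f E + infsum ?f (sigs N - E))) (E \<union> (sigs N - E))"
    by (intro has_sum_Un_disjoint has_sum_finite E) auto
  also have "E \<union> (sigs N - E) = sigs N" using E by auto
  also have "(?f has_sum (sum ?f E + infsum ?f (sigs N - E))) (sigs N) \<longleftrightarrow>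
      (?f has_sum (sum ?f E + infsum ?f (sigs N - E))) all_sigs"
    by (rule has_sum_cong_neutral) (use zero sigs_subset_all_sigs in auto)
  finally have *: "(?f has_sum (sum ?f E + infsum ?f (sigs N - E))) all_sigs" .
  then have eq: "series_hat y \<omega> = sum ?f E + infsum ?f (sigs N - E)"
    unfolding series_hat_def by (rule infsumI)
  then show "(?f has_sum series_hat y \<omega>) all_sigs" using * by simp
  show "norm (series_hat y \<omega> - sum ?f E) \<le> e" unfolding eq using bound(2) by simp
qed

lemma series_hat_graded_in_C0_Omega:
  assumes y: "y \<in> scrR0_graded N" and N: "1 \<le> N"
  shows "series_hat y \<in> C0_Omega"
proof (rule C0_Omega_uniform_limit)
  fix e :: real assume e: "0 < e"
  obtain E where E: "finite E" "E \<subseteq> sigs N" and E': "\<forall>l\<in>sigs N - E. norm (sigma_coeff y l) \<le> e * Dim l"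
    using scrR0_graded_exceptional[OF y e] by blast
  note E = E bspec[OF E']
  have "(\<lambda>\<omega>. \<Sum>l\<in>E. sigma_coeff y l * sigma_hat l \<omega>) \<in> C0_Omega"
    using E N by (intro C0_Omega_sum C0_Omega_cmult sigma_hat_in_C0_Omega) auto
  moreover have "norm (series_hat y \<omega> - (\<Sum>l\<in>E. sigma_coeff y l * sigma_hat l \<omega>)) \<le> e" if "\<omega> \<in> Omega" for \<omega>
    using e by (intro series_hat_decompose(2)[OF y that E]) auto
  ultimately show "\<exists>g\<in>C0_Omega. \<forall>\<omega>\<in>Omega. norm (series_hat y \<omega> - g \<omega>) \<le> e"
    by (intro bexI[of _ "\<lambda>\<omega>. \<Sum>l\<in>E. sigma_coeff y l * sigma_hat l \<omega>"] ballI) assumption+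
qed

lemma series_hat_scrR0_in_C0_Omega:
  assumes "\<psi> \<in> scrR0"
  shows "series_hat \<psi> \<in> C0_Omega"
proof -
  obtain d y where \<psi>: "\<psi> = (\<Sum>N=1..d. y N)" and y: "\<And>N. N \<in> {1..d} \<Longrightarrow> y N \<in> scrR0_graded N"
    using assms unfolding scrR0_def by blast
  have sum: "(\<lambda>\<omega>. \<Sum>N=1..d. series_hat (y N) \<omega>) \<in> C0_Omega"
    using y by (intro C0_Omega_sum series_hat_graded_in_C0_Omega[of _ N for N]) auto
  have eq: "series_hat \<psi> \<omega> = (\<Sum>N=1..d. series_hat (y N) \<omega>)" if \<omega>: "\<omega> \<in> Omega" for \<omega>
  proof -
    have "((\<lambda>l. sigma_coeff (y N) l * sigma_hat l \<omega>) has_sum series_hat (y N) \<omega>) all_sigs" if N: "N \<in> {1..d}" for N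
    proof -
      have "0 < (1::real)" by simp
      from scrR0_graded_exceptional[OF y[OF N] this]
      obtain E where E: "finite E" "E \<subseteq> sigs N" and E': "\<forall>l\<in>sigs N - E. norm (sigma_coeff (y N) l) \<le> 1 * Dim l"
        by blast
      note E = E bspec[OF E']
      show ?thesis by (rule series_hat_decompose(1)[OF y[OF N] \<omega> E]) auto
    qed
    then have "((\<lambda>l. \<Sum>N=1..d. sigma_coeff (y N) l * sigma_hat l \<omega>) has_sum (\<Sum>N=1..d. series_hat (y N) \<omega>)) all_sigs"
      by (intro has_sum_finite_sum) auto
    then have "infsum (\<lambda>l. \<Sum>N=1..d. sigma_coeff (y N) l * sigma_hat l \<omega>) all_sigs = (\<Sum>N=1..d. series_hat (y N) \<omega>)"
      by (rule infsumI)
    then show ?thesis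
      by (simp only: series_hat_def[of "sum y {1..d}"] \<psi> sigma_coeff_sum sum_distrib_right)
  qed
  show ?thesis
  \<comment> \<open>The two functions agree on \<open>Omega\<close> only, not as total functions.
    Approximation on \<open>Omega\<close> with error 0 transfers membership.\<close>
  proof (rule C0_Omega_uniform_limit)
    fix e :: real assume "0 < e"
    then have "norm (series_hat \<psi> \<omega> - (\<Sum>N=1..d. series_hat (y N) \<omega>)) \<le> e" if "\<omega> \<in> Omega" for \<omega>
      using eq[OF that] by simp
    then show "\<exists>g\<in>C0_Omega. \<forall>\<omega>\<in>Omega. norm (series_hat \<psi> \<omega> - g \<omega>) \<le> e"
      using sum by (intro bexI[of _ "\<lambda>\<omega>. \<Sum>N=1..d. series_hat (y N) \<omega>"] ballI)
  qed
qed

text \<open>Only finitely many degrees occur, and in each of them the ratios are at most 1 outside a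
  finite set.\<close>

lemma scrR0_subset_scrR: "scrR0 \<subseteq> scrR"
proof
  fix \<psi> assume "\<psi> \<in> scrR0"
  then obtain d y where \<psi>: "\<psi> = (\<Sum>N=1..d. y N)" and y: "\<And>N. N \<in> {1..d} \<Longrightarrow> y N \<in> scrR0_graded N"
    unfolding scrR0_def by blast
  let ?s = "\<lambda>N. SUP l\<in>sigs N. ennreal (norm (sigma_coeff \<psi> l) / Dim l)"
  have coeff: "sigma_coeff \<psi> l = (if N \<in> {1..d} then sigma_coeff (y N) l else 0)" if l: "l \<in> sigs N" for l N
  proof -
    have "sigma_coeff (y M) l = 0" if "M \<in> {1..d}" "M \<noteq> N" for M
      using sigma_coeff_graded[of "y M" M l] y[OF that(1)] that(2) l by (auto simp: scrR0_graded_def sigs_def)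
    then have "(\<Sum>M=1..d. sigma_coeff (y M) l) = (\<Sum>M=1..d. if M = N then sigma_coeff (y N) l else 0)"
      by (intro sum.cong refl) (simp split: if_split)
    then show ?thesis unfolding \<psi> sigma_coeff_sum by (simp only: sum.delta finite_atLeastAtMost)
  qed
  have zero: "?s N = 0" if "N \<notin> {1..d}" for N
  proof (rule antisym)
    have "sigma_coeff \<psi> l = 0" if "l \<in> sigs N" for l
      using coeff[OF that] \<open>N \<notin> {1..d}\<close> by (simp only: if_False)
    then show "?s N \<le> 0" by (intro SUP_least) simp
  qed simp
  have fin: "?s N < \<infinity>" if N: "N \<in> {1..d}" for N
  proof -
    have "0 < (1::real)" by simp
    from scrR0_graded_exceptional[OF y[OF N] this]
    obtain E where E: "finite E" "E \<subseteq> sigs N" and E': "\<forall>l\<in>sigs N - E. norm (sigma_coeff (y N) l) \<le> 1 * Dim l"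
      by blast
    note E = E bspec[OF E']
    \<comment> \<open>The summand 1 covers the signatures outside \<open>E\<close>, the sum those in
      \<open>E\<close>.\<close>
    define B where "B = 1 + (\<Sum>l\<in>E. norm (sigma_coeff (y N) l) / Dim l)"
    have pos: "0 \<le> norm (sigma_coeff (y N) l) / Dim l" if "l \<in> sigs N" for l
      using Dim_pos[OF that] by simp
    have B1: "1 \<le> B" unfolding B_def using E pos by (auto intro!: sum_nonneg)
    have "norm (sigma_coeff \<psi> l) / Dim l \<le> B" if l: "l \<in> sigs N" for l
    proof (cases "l \<in> E")
      case True
      have "norm (sigma_coeff (y N) l) / Dim l \<le> (\<Sum>l\<in>E. norm (sigma_coeff (y N) l) / Dim l)"
        by (rule member_le_sum[OF True]) (use E pos in auto)
      then show ?thesis using coeff[OF l] N by (simp add: B_def)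
    next
      case False
      then have "norm (sigma_coeff (y N) l) / Dim l \<le> 1"
        using E(3)[of l] l Dim_pos[OF l] by (simp add: divide_le_eq)
      then show ?thesis using coeff[OF l] N B1 by simp
    qed
    then have "?s N \<le> ennreal B" by (intro SUP_least ennreal_leI)
    then show ?thesis by (rule order_le_less_trans) simp
  qed
  have "series_norm \<psi> = (\<Sum>N\<in>{1..d}. ?s N)"
    unfolding series_norm_def by (rule suminf_finite) (use zero in auto)
  also have "\<dots> < \<infinity>" using fin by simp
  finally show "\<psi> \<in> scrR" by (simp add: scrR_def)
qed

text \<open>The algebraic identities of a homomorphism are pointwise on \<open>Omega\<close> and
  restrict from \<open>scrR\<close> to the subset \<open>scrR0\<close>; the smaller target is the
  first conjunct, which is proved outright.\<close>

theorem corollary3p10: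
  shows "(\<forall>\<psi>\<in>scrR0. series_hat \<psi> \<in> C0_Omega) \<and>
         (algebra_hom_on scrR C_Omega series_hat \<longrightarrow> algebra_hom_on scrR0 C0_Omega series_hat)"
  using series_hat_scrR0_in_C0_Omega scrR0_subset_scrR unfolding algebra_hom_on_def by (simp add: subset_iff)

end
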